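(* Let $z:\mathbb X\to[0,\infty)$ be measurable with $\lambda_z(B)=\int_Bz\,d\lambda<\infty$ for all $B\in\mathcal X_{\mathsf b}$, and let $v:\mathbb X\times\mathbb X\to\mathbb R\cup\{\infty\}$ be a measurable symmetric pair potential. Assume (i) $v(x,y)\ge0$ for $\lambda_z^2$-almost all $(x,y)\in\mathbb X^2$, and (ii) $\int_{\mathbb X}|f(x,y)|\,d\lambda_z(y)<\infty$ for $\lambda$-almost all $x\in\mathbb X$, where $f(x,y)=e^{-v(x,y)}-1$. Then $\mathscr G(z)\ne\varnothing$.
   Context: $(\mathbb X,\mathrm{dist})$ is a complete separable metric space with Borel $\sigma$-algebra $\mathcal X$, $\mathcal X_{\mathsf b}$ the bounded Borel sets, $\lambda$ a measure finite on bounded sets. $\mathcal N$ is the set of measures $\eta$ on $\mathbb X$ with $\eta(B)\in\mathbb N_0$ for $B\in\mathcal X_{\mathsf b}$, with $\sigma$-algebra $\mathfrak N$ generated by $\eta\mapsto\eta(B)$. $W(x;\eta)=\int v(x,y)\,d\eta(y)$. $\mathscr G(z)$ is the set of probability measures $\mathsf P$ on $(\mathcal N,\mathfrak N)$ satisfying $\mathsf E[\int_{\mathbb X}F(x,\eta)\,d\eta(x)]=\int_{\mathbb X}\mathsf E[F(x,\eta+\delta_x)e^{-W(x;\eta)}]z(x)\,d\lambda(x)$ for all measurable $F:\mathbb X\times\mathcal N\to[0,\infty)$. *)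

theory Defs
  imports "HOL-Probability.Probability"
begin

definition N_space :: "('a::polish_space) measure set" where
  "N_space = {\<eta>. sets \<eta> = sets borel \<and>
      (\<forall>B\<in>sets borel. bounded B \<longrightarrow> (\<exists>n::nat. emeasure \<eta> B = of_nat n))}"

definition N_sigma :: "('a::polish_space) measure measure" where
  "N_sigma = sigma N_space
     {{\<eta>\<in>N_space. emeasure \<eta> B \<in> A} | B A. B \<in> sets borel \<and> bounded B \<and> A \<in> sets (borel :: ennreal measure)}"

definition add_point :: "('a::polish_space) measure \<Rightarrow> 'a \<Rightarrow> 'a measure" where
  "add_point \<eta> x = measure_of UNIV (sets borel) (\<lambda>A. emeasure \<eta> A + indicator A x)"

text \<open>W(x;eta) = integral of v(x,y) d eta(y), with the convention infinity - infinity = infinity.\<close>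
definition W_int :: "('a::polish_space \<Rightarrow> 'a \<Rightarrow> ereal) \<Rightarrow> 'a \<Rightarrow> 'a measure \<Rightarrow> ereal" where
  "W_int v x \<eta> =
    (let Ip = (\<integral>\<^sup>+ y. e2ennreal (max 0 (v x y)) \<partial>\<eta>);
         In = (\<integral>\<^sup>+ y. e2ennreal (max 0 (- v x y)) \<partial>\<eta>)
     in if Ip = \<infinity> then \<infinity> else enn2ereal Ip - enn2ereal In)"

definition exp_neg :: "ereal \<Rightarrow> ennreal" where
  "exp_neg w = (if w = \<infinity> then 0 else if w = -\<infinity> then \<infinity> else ennreal (exp (- real_of_ereal w)))"

text \<open>The set G(z) of Gibbs point processes (GNZ equation).\<close>
definition Gibbs :: "('a::polish_space) measure \<Rightarrow> ('a \<Rightarrow> real) \<Rightarrow> ('a \<Rightarrow> 'a \<Rightarrow> ereal)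
    \<Rightarrow> 'a measure measure set" where
  "Gibbs lam z v = {P. prob_space P \<and> space P = space N_sigma \<and> sets P = sets N_sigma \<and>
     (\<forall>F \<in> borel_measurable (borel \<Otimes>\<^sub>M N_sigma).
        (\<integral>\<^sup>+ \<eta>. (\<integral>\<^sup>+ x. F (x, \<eta>) \<partial>\<eta>) \<partial>P) =
        (\<integral>\<^sup>+ x. (\<integral>\<^sup>+ \<eta>. F (x, add_point \<eta> x) * exp_neg (W_int v x \<eta>) \<partial>P) * ennreal (z x) \<partial>lam))}"

definition mayer_f :: "('a \<Rightarrow> 'a \<Rightarrow> ereal) \<Rightarrow> 'a \<Rightarrow> 'a \<Rightarrow> real" where
  "mayer_f v x y = (if v x y = \<infinity> then -1 else exp (- real_of_ereal (v x y)) - 1)"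

end

theory Submission
  imports Defs
begin

text \<open>
  Let \<open>\<mu> = z \<lambda>\<close>. On a bounded window the grand-canonical measure with Papangelou intensity
  \<open>e\<^sup>-\<^sup>W\<close> satisfies the equation exactly. Since \<open>v \<ge> 0\<close>, this intensity is at most \<open>1\<close>, so on
  every bounded set all these measures are dominated by one and the same finite Poisson measure.
  Hence their limit along an ultrafilter is countably additive on the events of each bounded window,
  and, being dominated by product measures, these local limits disintegrate into kernels and extend
  to a measure on all configurations by the theorem of Ionescu-Tulcea.
  Limits along an ultrafilter do not commute with integrals, so the equation is passed to the limit
  only after the interaction has been cut at a window \<open>\<Lambda>\<close>, which makes both sides local. The cut
  costs at most \<open>\<integral>\<^sub>B min 1 (\<integral>\<^bsub>-\<Lambda>\<^esub> \<bar>f(x, y)\<bar> d\<mu>(y)) d\<mu>(x)\<close> for test functions supported in \<open>B\<close>,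
  uniformly in the volume, and this vanishes as \<open>\<Lambda>\<close> grows.
\<close>

subsection \<open>Measures from functionals\<close>

text \<open>\<open>N_sigma\<close> carries no topology here, so neither tightness nor regular
  conditional laws are at hand; domination replaces both, giving setwise limits and, through
  densities, the kernels. Disjoint shells, rather than the nested windows, turn a configuration into
  a point of a countable product, where an extension theorem for kernels applies. The dominating
  Poisson measures are left unnormalised, since only finiteness matters. Points of a configuration
  are never enumerated: the n-point measures are built by successive insertion, and almost sure
  properties are proved by induction on insertions. The truncation min 1 answers the weak form of
  (ii): the integral of |f(x, y)| over y is finite for almost every x, but need not be integrable in
  x over a bounded set. Since (i) holds only almost everywhere, the construction is carried out for
  the positive part of v, and the GNZ equation of the resulting process itself shows that almost
  surely the negative part contributes nothing to W.\<close>

lemma measure_of_functional: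
  fixes \<Phi> :: "('b \<Rightarrow> ennreal) \<Rightarrow> ennreal"
  assumes cong: "\<And>f g. (\<And>x. x \<in> space M \<Longrightarrow> f x = g x) \<Longrightarrow> \<Phi> f = \<Phi> g"
    and mult: "\<And>c f. f \<in> borel_measurable M \<Longrightarrow> \<Phi> (\<lambda>x. c * f x) = c * \<Phi> f"
    and add: "\<And>f g. f \<in> borel_measurable M \<Longrightarrow> g \<in> borel_measurable M \<Longrightarrow>
      \<Phi> (\<lambda>x. f x + g x) = \<Phi> f + \<Phi> g"
    and SUP: "\<And>F. (\<And>i::nat. F i \<in> borel_measurable M) \<Longrightarrow> incseq F \<Longrightarrow>
      \<Phi> (\<lambda>x. SUP i. F i x) = (SUP i. \<Phi> (F i))"
  obtains Q where "sets Q = sets M"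
    and "\<And>f. f \<in> borel_measurable M \<Longrightarrow> (\<integral>\<^sup>+x. f x \<partial>Q) = \<Phi> f"
proof -
  \<comment> \<open>Countable additivity of \<open>\<mu>\<close> is monotone continuity of
    \<open>\<Phi>\<close> along partial sums of indicators. The assumption \<open>cong\<close> is
    there because functions are total while a measure only sees their values on
    \<open>space M\<close>.\<close>
  define \<mu> where "\<mu> A = \<Phi> (indicator A)" for A
  define Q where "Q = measure_of (space M) (sets M) \<mu>"
  have zero: "\<Phi> (\<lambda>_. 0) = 0"
    using mult[of "\<lambda>_. 0" 0] by simp
  have sum: "\<Phi> (\<lambda>x. \<Sum>i<n. f i x) = (\<Sum>i<n. \<Phi> (f i))"
    if [measurable]: "\<And>i. f i \<in> borel_measurable M" for n :: nat and f
    by (induction n) (simp_all add: zero add)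
  have em: "emeasure Q A = \<mu> A" if "A \<in> sets M" for A
    unfolding Q_def
  proof (rule emeasure_measure_of_sigma)
    show "sigma_algebra (space M) (sets M)" ..
    show "positive (sets M) \<mu>"
      using zero by (simp add: positive_def \<mu>_def indicator_def[abs_def])
    show "A \<in> sets M" by fact
    show "countably_additive (sets M) \<mu>"
    proof (rule countably_additiveI)
      fix A :: "nat \<Rightarrow> 'b set"
      assume A: "range A \<subseteq> sets M" "disjoint_family A"
      have [measurable]: "A i \<in> sets M" for i using A by auto
      have inc: "incseq (\<lambda>n x. \<Sum>i<n. indicator (A i) x :: ennreal)"
        by (auto simp: incseq_def le_fun_def intro!: sum_mono2)
      have "\<mu> (\<Union>i. A i) = \<Phi> (\<lambda>x. \<Sum>i. indicator (A i) x)"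
        unfolding \<mu>_def by (intro cong) (simp add: suminf_indicator[OF A(2)])
      also have "\<dots> = \<Phi> (\<lambda>x. SUP n. \<Sum>i<n. indicator (A i) x)"
        by (simp add: suminf_eq_SUP)
      also have "\<dots> = (SUP n. \<Phi> (\<lambda>x. \<Sum>i<n. indicator (A i) x))"
        by (rule SUP[OF _ inc]) measurable
      also have "\<dots> = (\<Sum>i. \<mu> (A i))"
        by (simp add: sum suminf_eq_SUP \<mu>_def)
      finally show "(\<Sum>i. \<mu> (A i)) = \<mu> (\<Union>i. A i)" by simp
    qed
  qed
  have sQ: "sets Q = sets M" by (simp add: Q_def)
  have spQ: "space Q = space M" by (simp add: Q_def)
  have "(\<integral>\<^sup>+x. f x \<partial>Q) = \<Phi> f" if "f \<in> borel_measurable M" for f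
    using that
  proof (induction f rule: borel_measurable_induct)
    case (cong f g)
    have "(\<integral>\<^sup>+x. f x \<partial>Q) = (\<integral>\<^sup>+x. g x \<partial>Q)" using cong by (intro nn_integral_cong) (simp add: spQ)
    moreover have "\<Phi> f = \<Phi> g" using cong(3) by (intro assms(1)) simp
    ultimately show ?case using cong by simp
  next
    case (set A)
    then show ?case using em[of A] by (simp add: sQ \<mu>_def)
  next
    case (mult u c)
    then show ?case by (simp add: assms(2) nn_integral_cmult measurable_cong_sets[OF sQ])
  next
    case (add u v)
    then show ?case by (simp add: assms(3) nn_integral_add measurable_cong_sets[OF sQ])
  next
    case (seq U)
    have "(\<integral>\<^sup>+x. (SUP i. U i) x \<partial>Q) = (\<integral>\<^sup>+x. (SUP i. U i x) \<partial>Q)"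
      by (simp add: image_image)
    also have "\<dots> = (SUP i. \<integral>\<^sup>+x. U i x \<partial>Q)"
      using seq by (intro nn_integral_monotone_convergence_SUP) (auto simp: measurable_cong_sets[OF sQ])
    also have "\<dots> = (SUP i. \<Phi> (U i))" using seq by simp
    also have "\<dots> = \<Phi> (\<lambda>x. SUP i. U i x)" using seq by (intro SUP[symmetric]) auto
    also have "(\<lambda>x. SUP i. U i x) = (SUP i. U i)" by (auto simp: fun_eq_iff image_image)
    finally show ?case .
  qed
  with sQ show ?thesis by (rule that)
qed

subsection \<open>Ultrafilter limits\<close>

text \<open>A free ultrafilter in the language of filters: lying below \<open>sequentially\<close>,
  it keeps every statement that holds for all large indices.\<close>

definition ultra :: "nat filter \<Rightarrow> bool" where
  "ultra U \<longleftrightarrow> U \<noteq> bot \<and> U \<le> sequentially \<and>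
     (\<forall>P. eventually P U \<or> eventually (\<lambda>x. \<not> P x) U)"

text \<open>Zorn's lemma for the reversed order. A minimal proper filter decides every predicate,
  because intersecting it with the complement of an undecided one would give a smaller proper
  filter.\<close>

lemma ultra_exists: "\<exists>U. ultra U"
proof -
  let ?A = "{F::nat filter. F \<noteq> bot \<and> F \<le> sequentially}"
  have "\<exists>m\<in>?A. \<forall>a\<in>?A. (\<lambda>x y. y \<le> x) m a \<longrightarrow> a = m"
  proof (rule predicate_Zorn)
    show "partial_order_on ?A (relation_of (\<lambda>x y. y \<le> x) ?A)"
      by (auto simp: partial_order_on_def preorder_on_def refl_on_def trans_def antisym_def
          relation_of_def)
    fix C assume C: "C \<in> Chains (relation_of (\<lambda>x y. y \<le> x) ?A)"
    have "\<exists>u. u \<noteq> bot \<and> u \<le> sequentially \<and> (\<forall>a\<in>C. u \<le> a)"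
    proof (cases "C = {}")
      case True
      then show ?thesis by (intro exI[of _ sequentially]) auto
    next
      case False
      have CA: "C \<subseteq> ?A" and lin: "\<And>F G. F \<in> C \<Longrightarrow> G \<in> C \<Longrightarrow> F \<le> G \<or> G \<le> F"
        using C by (auto simp: Chains_def relation_of_def)
      \<comment> \<open>On a chain the members form a filter base, so nothing holds eventually for
        the infimum that does not already hold for some member; in particular the infimum stays
        proper.\<close>
      have ev: "eventually P (Inf C) \<longleftrightarrow> (\<exists>b\<in>C. eventually P b)" for P
      proof (rule eventually_Inf_base[OF False])
        show "\<exists>x\<in>C. x \<le> inf F G" if "F \<in> C" "G \<in> C" for F G
          using lin[OF that] that by (auto simp: le_inf_iff)
      qed
      have "Inf C \<noteq> bot"
      proof (rule notI)
        assume "Inf C = bot"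
        then have "eventually (\<lambda>_. False) (Inf C)" by simp
        then have "\<exists>b\<in>C. eventually (\<lambda>_. False) b" by (simp only: ev)
        then have "bot \<in> C" by (simp add: eventually_False)
        then show False using CA by auto
      qed
      moreover have "Inf C \<le> sequentially"
      proof -
        obtain F where "F \<in> C" using False by auto
        then show ?thesis using CA by (intro Inf_lower2[of F]) auto
      qed
      ultimately show ?thesis by (intro exI[of _ "Inf C"]) (auto intro: Inf_lower)
    qed
    then show "\<exists>u\<in>?A. \<forall>a\<in>C. u \<le> a" by blast
  qed
  then obtain U where U: "U \<noteq> bot" "U \<le> sequentially"
    and min: "\<And>F. F \<noteq> bot \<Longrightarrow> F \<le> U \<Longrightarrow> F = U"
    by (auto dest: order_trans)
  have "eventually (\<lambda>x. \<not> P x) U" if "\<not> eventually P U" for P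
  proof -
    have "inf U (principal {x. \<not> P x}) \<noteq> bot"
      using that by (simp add: trivial_limit_def eventually_inf_principal)
    then have "inf U (principal {x. \<not> P x}) = U" by (intro min) auto
    then have "U \<le> principal {x. \<not> P x}" by (metis inf.cobounded2)
    then show ?thesis by (simp add: le_principal)
  qed
  with U show ?thesis unfolding ultra_def by blast
qed

text \<open>Compactness of \<open>ennreal\<close> provides a cluster point, and an ultrafilter
  converges to each of its cluster points.\<close>

lemma ultra_tendsto_ennreal:
  fixes f :: "nat \<Rightarrow> ennreal"
  assumes "ultra U"
  obtains l where "(f \<longlongrightarrow> l) U"
proof -
  have "filtermap f U \<noteq> bot" using assms by (simp add: ultra_def filtermap_bot_iff)
  then obtain l where l: "inf (nhds l) (filtermap f U) \<noteq> bot"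
    using compact_UNIV[where 'a=ennreal] unfolding compact_filter by (auto simp: le_principal)
  have "filtermap f U \<le> nhds l"
  proof (rule filter_leI, rule ccontr)
    fix P assume P: "eventually P (nhds l)" and n: "\<not> eventually P (filtermap f U)"
    from n assms have "eventually (\<lambda>x. \<not> P x) (filtermap f U)"
      by (auto simp: ultra_def eventually_filtermap)
    with P have "eventually (\<lambda>_. False) (inf (nhds l) (filtermap f U))"
      unfolding eventually_inf by (metis (mono_tags, lifting))
    with l show False by (simp add: trivial_limit_def)
  qed
  then show ?thesis using that by (simp add: filterlim_def)
qed

text \<open>Finite additivity survives any limit. Continuity at the empty set is inherited from the
  finite measure \<open>D\<close>, and for a finite additive set function this is already countable
  additivity.\<close>

lemma ultralimit_measure:
  fixes Q :: "nat \<Rightarrow> 'b measure"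
  assumes U: "ultra U" and D: "finite_measure D"
    and sets: "\<And>n. sets (Q n) = sets D"
    and dom: "\<And>n A. A \<in> sets D \<Longrightarrow> emeasure (Q n) A \<le> emeasure D A"
  obtains L where "sets L = sets D"
    and "\<And>A. A \<in> sets D \<Longrightarrow> ((\<lambda>n. emeasure (Q n) A) \<longlongrightarrow> emeasure L A) U"
proof -
  interpret D: finite_measure D by fact
  have U0: "U \<noteq> bot" using U by (simp add: ultra_def)
  have "\<forall>A. \<exists>l. ((\<lambda>n. emeasure (Q n) A) \<longlongrightarrow> l) U"
    using ultra_tendsto_ennreal[OF U] by metis
  then obtain l where l: "\<And>A. ((\<lambda>n. emeasure (Q n) A) \<longlongrightarrow> l A) U" by metis
  have le: "l A \<le> emeasure D A" if "A \<in> sets D" for A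
    by (rule tendsto_upperbound[OF l]) (auto simp: dom that U0)
  have addl: "l (A \<union> B) = l A + l B" if "A \<in> sets D" "B \<in> sets D" "A \<inter> B = {}" for A B
  proof -
    have "((\<lambda>n. emeasure (Q n) A + emeasure (Q n) B) \<longlongrightarrow> l A + l B) U"
      by (intro tendsto_intros l)
    also have "(\<lambda>n. emeasure (Q n) A + emeasure (Q n) B) = (\<lambda>n. emeasure (Q n) (A \<union> B))"
      using that by (intro ext plus_emeasure) (auto simp: sets)
    finally show ?thesis using tendsto_unique[OF U0 l] by blast
  qed
  have l0: "l {} = 0"
    using le[of "{}"] by simp
  define L where "L = measure_of (space D) (sets D) l"
  have "emeasure L A = l A" if "A \<in> sets D" for A
    unfolding L_def
  proof (rule emeasure_measure_of_sigma)
    show "sigma_algebra (space D) (sets D)" ..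
    show "positive (sets D) l" by (simp add: positive_def l0)
    show "A \<in> sets D" by fact
    show "countably_additive (sets D) l"
    proof (rule sets.empty_continuous_imp_countably_additive)
      show "positive (sets D) l" by (simp add: positive_def l0)
      show "additive (sets D) l" by (simp add: additive_def addl)
      show "\<forall>A\<in>sets D. l A \<noteq> \<infinity>"
        using le D.emeasure_finite by (metis infinity_ennreal_def top_unique)
      fix A :: "nat \<Rightarrow> 'b set"
      assume A: "range A \<subseteq> sets D" "decseq A" "(\<Inter>i. A i) = {}"
      have "(\<lambda>i. emeasure D (A i)) \<longlonglongrightarrow> emeasure D (\<Inter>i. A i)"
        using A by (intro Lim_emeasure_decseq) auto
      then have D0: "(\<lambda>i. emeasure D (A i)) \<longlonglongrightarrow> 0" by (simp add: A(3))
      show "(\<lambda>i. l (A i)) \<longlonglongrightarrow> 0"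
        by (rule tendsto_sandwich[OF _ _ tendsto_const D0]) (use A in \<open>auto intro!: le always_eventually\<close>)
    qed
  qed
  then show ?thesis using l by (intro that[of L]) (auto simp: L_def)
qed

text \<open>Approximation by simple functions from below yields only one inequality. It is applied
  to both \<open>f\<close> and \<open>K - f\<close>, whose integrals add up to \<open>K\<close>
  under every probability measure involved, and this forces equality.\<close>

lemma ultralimit_nn_integral:
  fixes K :: real
  assumes U: "ultra U"
    and Q: "\<And>n. prob_space (Q n)" and sets: "\<And>n. sets (Q n) = sets L"
    and L: "prob_space L"
    and lim: "\<And>A. A \<in> sets L \<Longrightarrow> ((\<lambda>n. emeasure (Q n) A) \<longlongrightarrow> emeasure L A) U"
    and f[measurable]: "f \<in> borel_measurable L" and bd: "\<And>x. x \<in> space L \<Longrightarrow> f x \<le> ennreal K"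
  shows "((\<lambda>n. \<integral>\<^sup>+x. f x \<partial>Q n) \<longlongrightarrow> (\<integral>\<^sup>+x. f x \<partial>L)) U"
proof -
  have U0: "U \<noteq> bot" using U by (simp add: ultra_def)
  have sp: "space (Q n) = space L" for n using sets by (rule sets_eq_imp_space_eq)
  \<comment> \<open>The integral of a simple function is a finite sum of measures of events, and
    only such sums are known to converge along \<open>U\<close>.\<close>
  have lower: "(\<integral>\<^sup>+x. g x \<partial>L) \<le> l"
    if l: "((\<lambda>n. \<integral>\<^sup>+x. g x \<partial>Q n) \<longlongrightarrow> l) U" for g l
    unfolding nn_integral_def_finite[of L g]
  proof (rule SUP_least, clarsimp)
    fix s assume s: "simple_function L s" "s \<le> g" "\<forall>x. s x < top"
    have sQ: "simple_function (Q n) s" for n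
      using s(1) by (simp add: simple_function_def sp sets)
    have "((\<lambda>n. integral\<^sup>S (Q n) s) \<longlongrightarrow> integral\<^sup>S L s) U"
      unfolding simple_integral_def sp
      using s by (intro tendsto_sum ennreal_tendsto_cmult lim) (auto simp: simple_function_def)
    moreover have "integral\<^sup>S (Q n) s \<le> (\<integral>\<^sup>+x. g x \<partial>Q n)" for n
      using s(2) by (subst nn_integral_eq_simple_integral[OF sQ, symmetric])
        (auto intro!: nn_integral_mono simp: le_fun_def)
    ultimately show "integral\<^sup>S L s \<le> l"
      using l by (intro tendsto_le[OF U0]) auto
  qed
  obtain l where l: "((\<lambda>n. \<integral>\<^sup>+x. f x \<partial>Q n) \<longlongrightarrow> l) U" using ultra_tendsto_ennreal[OF U] .
  obtain l' where l': "((\<lambda>n. \<integral>\<^sup>+x. (ennreal K - f x) \<partial>Q n) \<longlongrightarrow> l') U"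
    using ultra_tendsto_ennreal[OF U] .
  have fQ: "f \<in> borel_measurable (Q n)" for n using f sets by (simp cong: measurable_cong_sets)
  have "(\<integral>\<^sup>+x. f x \<partial>Q n) + (\<integral>\<^sup>+x. (ennreal K - f x) \<partial>Q n) = ennreal K" for n
  proof -
    have "(\<integral>\<^sup>+x. f x \<partial>Q n) + (\<integral>\<^sup>+x. (ennreal K - f x) \<partial>Q n) = (\<integral>\<^sup>+x. f x + (ennreal K - f x) \<partial>Q n)"
      using fQ by (intro nn_integral_add[symmetric]) auto
    also have "\<dots> = (\<integral>\<^sup>+x. ennreal K \<partial>Q n)"
      using bd by (intro nn_integral_cong) (simp add: sp add_diff_inverse_ennreal)
    finally show ?thesis using prob_space.emeasure_space_1[OF Q] by simp
  qed
  then have "l + l' = ennreal K"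
    using tendsto_add[OF l l'] tendsto_unique[OF U0 _ tendsto_const] by force
  moreover have "(\<integral>\<^sup>+x. f x \<partial>L) + (\<integral>\<^sup>+x. (ennreal K - f x) \<partial>L) = ennreal K"
  proof -
    have "(\<integral>\<^sup>+x. f x \<partial>L) + (\<integral>\<^sup>+x. (ennreal K - f x) \<partial>L) = (\<integral>\<^sup>+x. f x + (ennreal K - f x) \<partial>L)"
      by (intro nn_integral_add[symmetric]) auto
    also have "\<dots> = (\<integral>\<^sup>+x. ennreal K \<partial>L)"
      using bd by (intro nn_integral_cong) (simp add: add_diff_inverse_ennreal)
    finally show ?thesis using prob_space.emeasure_space_1[OF L] by simp
  qed
  moreover have "(\<integral>\<^sup>+x. f x \<partial>L) \<le> l" "(\<integral>\<^sup>+x. (ennreal K - f x) \<partial>L) \<le> l'"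
    by (intro lower l l')+
  \<comment> \<open>Both sums equal \<open>K\<close> and the summands are ordered, so replacing one
    summand at a time changes nothing; finiteness of \<open>l'\<close> then permits
    cancellation.\<close>
  ultimately have eq: "(\<integral>\<^sup>+x. f x \<partial>L) + l' = l + l'" and fin: "l' \<noteq> \<top>"
    by (metis add_mono antisym order_refl) (use \<open>l + l' = ennreal K\<close> in auto)
  have "(\<integral>\<^sup>+x. f x \<partial>L) = l"
    using eq fin by (metis add.commute ennreal_add_left_cancel infinity_ennreal_def)
  with l show ?thesis by simp
qed

subsection \<open>Kolmogorov extension for dominated families\<close>

text \<open>A density \<open>h\<close> of \<open>J\<close> with respect to a product measure yields
  the conditional law explicitly, as \<open>h (x, y) / k x\<close> times \<open>R\<close>, so no
  regularity of the spaces is required.\<close>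

lemma dominated_disintegration:
  assumes J: "prob_space J" "sets J = sets (A \<Otimes>\<^sub>M B)"
    and S: "finite_measure S" "sets S = sets A" and R: "finite_measure R" "sets R = sets B"
    and ac: "absolutely_continuous (S \<Otimes>\<^sub>M R) J"
  obtains K where "K \<in> measurable A (subprob_algebra B)"
    and "\<And>x. x \<in> space A \<Longrightarrow> prob_space (K x)"
    and "\<And>f. f \<in> borel_measurable (A \<Otimes>\<^sub>M B) \<Longrightarrow>
      (\<integral>\<^sup>+p. f p \<partial>J) = (\<integral>\<^sup>+x. (\<integral>\<^sup>+y. f (x, y) \<partial>K x) \<partial>distr J A fst)"
proof -
  interpret J: prob_space J by fact
  interpret S: finite_measure S by fact
  interpret R: finite_measure R by fact
  interpret SR: pair_sigma_finite S R ..
  note [measurable_cong] = S(2) R(2) J(2)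
  have sSR: "sets (S \<Otimes>\<^sub>M R) = sets (A \<Otimes>\<^sub>M B)" by (intro sets_pair_measure_cong S R)
  obtain h where h0: "h \<in> borel_measurable (S \<Otimes>\<^sub>M R)" and Jh: "density (S \<Otimes>\<^sub>M R) h = J"
    using SR.P.Radon_Nikodym[OF ac] J(2) sSR by auto
  from h0 have h[measurable]: "h \<in> borel_measurable (A \<Otimes>\<^sub>M B)" by (simp cong: measurable_cong_sets add: sSR)
  have spS: "space S = space A" and spR: "space R = space B"

    by (fact sets_eq_imp_space_eq[OF S(2)], fact sets_eq_imp_space_eq[OF R(2)])
  \<comment> \<open>\<open>k\<close> is the density of the first marginal of \<open>J\<close> with
    respect to \<open>S\<close>.\<close>
  define k where "k x = (\<integral>\<^sup>+y. h (x, y) \<partial>R)" for x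
  have k[measurable]: "k \<in> borel_measurable A" unfolding k_def by measurable
  have "space J = space A \<times> space B" 
    using sets_eq_imp_space_eq[OF J(2)] by (simp add: space_pair_measure)
  with J.not_empty obtain y0 where y0: "y0 \<in> space B" by auto
  \<comment> \<open>Where the quotient makes no sense, the kernel is a point mass at
    \<open>y0\<close>, so that it is a probability measure at every point and not only almost
    everywhere. These points carry no mass of the first marginal.\<close>
  define good where "good x \<longleftrightarrow> k x \<noteq> 0 \<and> k x \<noteq> \<infinity>" for x
  have good[measurable]: "Measurable.pred A good" unfolding good_def[abs_def] by measurable
  define K where "K x = (if good x then density R (\<lambda>y. h (x, y) / k x) else return B y0)" for x
  have Kpr: "prob_space (K x)" if "x \<in> space A" for x
  proof (cases "good x")
    case True
    have "emeasure (K x) (space (K x)) = (\<integral>\<^sup>+y. h (x, y) / k x \<partial>R)"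
      using True that by (simp add: K_def emeasure_density spR cong: nn_integral_cong_simp)
    also have "\<dots> = k x / k x" using that by (simp add: nn_integral_divide k_def)
    also have "\<dots> = 1" using True by (simp add: good_def ennreal_divide_self top.not_eq_extremum)
    finally show ?thesis by (rule prob_spaceI)
  qed (use y0 in \<open>simp add: K_def prob_space_return\<close>)
  have em: "emeasure (K x) X = (if good x then (\<integral>\<^sup>+y. h (x, y) / k x * indicator X y \<partial>R) else indicator X y0)"
    if "x \<in> space A" "X \<in> sets B" for x X
    using that by (auto simp: K_def emeasure_density R(2) emeasure_return)
  have 1: "K \<in> measurable A (subprob_algebra B)"
  proof (rule measurable_subprob_algebra)
    show "subprob_space (K a)" if "a \<in> space A" for a
      using Kpr[OF that] by (rule prob_space_imp_subprob_space)
    show "sets (K a) = sets B" for a by (simp add: K_def R(2))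
    fix X assume [measurable]: "X \<in> sets B"
    have "(\<lambda>x. if good x then (\<integral>\<^sup>+y. h (x, y) / k x * indicator X y \<partial>R) else indicator X y0) \<in> borel_measurable A"
      by measurable
    then show "(\<lambda>a. emeasure (K a) X) \<in> borel_measurable A"
      by (rule measurable_cong[THEN iffD1, rotated]) (simp add: em)
  qed
  have 3: "(\<integral>\<^sup>+p. f p \<partial>J) = (\<integral>\<^sup>+x. (\<integral>\<^sup>+y. f (x, y) \<partial>K x) \<partial>distr J A fst)"
    if f[measurable]: "f \<in> borel_measurable (A \<Otimes>\<^sub>M B)" for f
  proof -
    have Jint: "(\<integral>\<^sup>+p. g p \<partial>J) = (\<integral>\<^sup>+x. \<integral>\<^sup>+y. h (x, y) * g (x, y) \<partial>R \<partial>S)"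
      if [measurable]: "g \<in> borel_measurable (A \<Otimes>\<^sub>M B)" for g
      unfolding Jh[symmetric]
      by (subst nn_integral_density) (auto simp: R.nn_integral_fst[symmetric])
    have "(\<integral>\<^sup>+x. k x \<partial>S) = (\<integral>\<^sup>+p. 1 \<partial>J)" by (simp add: Jint k_def del: nn_integral_const)
    also have "\<dots> = 1" using J.emeasure_space_1 by simp
    finally have "AE x in S. k x \<noteq> \<infinity>" by (intro nn_integral_PInf_AE) auto
    have Km[measurable]: "(\<lambda>x. \<integral>\<^sup>+y. f (x, y) \<partial>K x) \<in> borel_measurable A"
      using nn_integral_measurable_subprob_algebra2[OF _ 1, of "\<lambda>x y. f (x, y)"] f by simp
    have "(\<integral>\<^sup>+x. (\<integral>\<^sup>+y. f (x, y) \<partial>K x) \<partial>distr J A fst) = (\<integral>\<^sup>+p. (\<integral>\<^sup>+y. f (fst p, y) \<partial>K (fst p)) \<partial>J)"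
      by (subst nn_integral_distr) auto
    also have "\<dots> = (\<integral>\<^sup>+x. \<integral>\<^sup>+y. h (x, y) * (\<integral>\<^sup>+y. f (x, y) \<partial>K x) \<partial>R \<partial>S)"
      by (subst Jint) auto
    also have "\<dots> = (\<integral>\<^sup>+x. k x * (\<integral>\<^sup>+y. f (x, y) \<partial>K x) \<partial>S)"
      by (intro nn_integral_cong) (simp add: nn_integral_multc k_def spS)
    also have "\<dots> = (\<integral>\<^sup>+x. \<integral>\<^sup>+y. h (x, y) * f (x, y) \<partial>R \<partial>S)"
    proof (rule nn_integral_cong_AE, use \<open>AE x in S. k x \<noteq> \<infinity>\<close> AE_space in eventually_elim)
      fix x assume fin: "k x \<noteq> \<infinity>" and "x \<in> space S"
      then have x[simp]: "x \<in> space A" by (simp add: spS)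
      show "k x * (\<integral>\<^sup>+y. f (x, y) \<partial>K x) = (\<integral>\<^sup>+y. h (x, y) * f (x, y) \<partial>R)"
      \<comment> \<open>If \<open>k x = 0\<close>, then \<open>h (x, y)\<close> vanishes for almost
        all \<open>y\<close>, so both sides are zero whatever the fallback kernel gives.\<close>
      proof (cases "k x = 0")
        case True
        then have "AE y in R. h (x, y) = 0" by (simp add: k_def nn_integral_0_iff_AE)
        then have "(\<integral>\<^sup>+y. h (x, y) * f (x, y) \<partial>R) = (\<integral>\<^sup>+y. 0 \<partial>R)"
          by (intro nn_integral_cong_AE) auto
        with True show ?thesis by simp
      next
        case False
        have c: "k x * (h (x, y) / k x * f (x, y)) = h (x, y) * f (x, y)" for y
        proof -
          have "k x * (h (x, y) / k x * f (x, y)) = (h (x, y) / k x * k x) * f (x, y)"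
            by (simp only: mult_ac)
          also have "h (x, y) / k x * k x = h (x, y)"
            using False fin by (simp add: ennreal_divide_times ennreal_divide_self top.not_eq_extremum)
          finally show ?thesis .
        qed
        have "k x * (\<integral>\<^sup>+y. f (x, y) \<partial>K x) = k x * (\<integral>\<^sup>+y. h (x, y) / k x * f (x, y) \<partial>R)"
          using False fin by (simp add: K_def good_def nn_integral_density)
        also have "\<dots> = (\<integral>\<^sup>+y. h (x, y) * f (x, y) \<partial>R)"
          by (simp add: nn_integral_cmult[symmetric] c)
        finally show ?thesis .
      qed
    qed
    also have "\<dots> = (\<integral>\<^sup>+p. f p \<partial>J)" by (subst Jint) auto
    finally show ?thesis by simp
  qed
  from 1 Kpr 3 show ?thesis by (rule that)
qed

text \<open>By \<open>ac\<close>, the joint law of the first \<open>m\<close> coordinates and the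
  next one disintegrates into a kernel. The chain of these kernels, started from the empty product,
  reproduces every \<open>L m\<close>, hence so do the marginals of its infinite-time law.\<close>

lemma dominated_projective_limit:
  fixes M :: "nat \<Rightarrow> 'b measure"
  assumes L: "\<And>m. sets (L m) = sets (PiM {0..<m} M)" "\<And>m. prob_space (L m)"
    and consistent: "\<And>m. L m = distr (L (Suc m)) (PiM {0..<m} M) (\<lambda>\<omega>. restrict \<omega> {0..<m})"
    and S: "\<And>m. finite_measure (S m)" "\<And>m. sets (S m) = sets (PiM {0..<m} M)"
    and R: "\<And>m. finite_measure (R m)" "\<And>m. sets (R m) = sets (M m)"
    and ac: "\<And>m. absolutely_continuous (S m \<Otimes>\<^sub>M R m)
      (distr (L (Suc m)) (PiM {0..<m} M \<Otimes>\<^sub>M M m) (\<lambda>\<omega>. (restrict \<omega> {0..<m}, \<omega> m)))"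
  obtains Q where "prob_space Q" and "sets Q = sets (PiM UNIV M)"
    and "\<And>m. distr Q (PiM {0..<m} M) (\<lambda>\<omega>. restrict \<omega> {0..<m}) = L m"
proof -
  note [measurable_cong] = L(1)
  let ?J = "\<lambda>m. distr (L (Suc m)) (PiM {0..<m} M \<Otimes>\<^sub>M M m) (\<lambda>\<omega>. (restrict \<omega> {0..<m}, \<omega> m))"
  have mJ[measurable]: "(\<lambda>\<omega>. (restrict \<omega> {0..<m}, \<omega> m)) \<in> measurable (L (Suc m)) (PiM {0..<m} M \<Otimes>\<^sub>M M m)" for m
    by measurable
  have fst_J: "distr (?J m) (PiM {0..<m} M) fst = L m" for m
    by (subst distr_distr) (auto simp: comp_def consistent[of m, symmetric])
  have "\<exists>K. K \<in> measurable (PiM {0..<m} M) (subprob_algebra (M m)) \<and>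
      (\<forall>x\<in>space (PiM {0..<m} M). prob_space (K x)) \<and>
      (\<forall>f\<in>borel_measurable (PiM {0..<m} M \<Otimes>\<^sub>M M m).
        (\<integral>\<^sup>+p. f p \<partial>?J m) = (\<integral>\<^sup>+x. (\<integral>\<^sup>+y. f (x, y) \<partial>K x) \<partial>L m))" for m
  proof -
    have "prob_space (?J m)" using L(2) mJ by (rule prob_space.prob_space_distr)
    then obtain K where "K \<in> measurable (PiM {0..<m} M) (subprob_algebra (M m))"
      "\<And>x. x \<in> space (PiM {0..<m} M) \<Longrightarrow> prob_space (K x)"
      "\<And>f. f \<in> borel_measurable (PiM {0..<m} M \<Otimes>\<^sub>M M m) \<Longrightarrow>
        (\<integral>\<^sup>+p. f p \<partial>?J m) = (\<integral>\<^sup>+x. (\<integral>\<^sup>+y. f (x, y) \<partial>K x) \<partial>distr (?J m) (PiM {0..<m} M) fst)"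
      by (rule dominated_disintegration[OF _ _ S(1) S(2) R(1) R(2) ac]) auto
    then show ?thesis unfolding fst_J by blast
  qed
  then have "\<forall>m. \<exists>K. K \<in> measurable (PiM {0..<m} M) (subprob_algebra (M m)) \<and>
      (\<forall>x\<in>space (PiM {0..<m} M). prob_space (K x)) \<and>
      (\<forall>f\<in>borel_measurable (PiM {0..<m} M \<Otimes>\<^sub>M M m).
        (\<integral>\<^sup>+p. f p \<partial>?J m) = (\<integral>\<^sup>+x. (\<integral>\<^sup>+y. f (x, y) \<partial>K x) \<partial>L m))" ..
  from choice[OF this] obtain K where
    K0: "\<forall>m. K m \<in> measurable (PiM {0..<m} M) (subprob_algebra (M m)) \<and>
      (\<forall>x\<in>space (PiM {0..<m} M). prob_space (K m x)) \<and>
      (\<forall>f\<in>borel_measurable (PiM {0..<m} M \<Otimes>\<^sub>M M m).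
        (\<integral>\<^sup>+p. f p \<partial>?J m) = (\<integral>\<^sup>+x. (\<integral>\<^sup>+y. f (x, y) \<partial>K m x) \<partial>L m))" ..
  have K: "\<And>m. K m \<in> measurable (PiM {0..<m} M) (subprob_algebra (M m))"
    "\<And>m x. x \<in> space (PiM {0..<m} M) \<Longrightarrow> prob_space (K m x)"
    "\<And>m f. f \<in> borel_measurable (PiM {0..<m} M \<Otimes>\<^sub>M M m) \<Longrightarrow>
        (\<integral>\<^sup>+p. f p \<partial>?J m) = (\<integral>\<^sup>+x. (\<integral>\<^sup>+y. f (x, y) \<partial>K m x) \<partial>L m)"
    using K0 by blast+
  interpret IT: Ionescu_Tulcea K M
    by (rule Ionescu_Tulcea.intro[OF K(1,2)])
  have spL: "space (L m) = space (PiM {0..<m} M)" for m using L(1) by (rule sets_eq_imp_space_eq)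
  \<comment> \<open>The empty product has the single point \<open>\<lambda>_. undefined\<close>;
    this is where the chain starts, and \<open>L 0\<close> can only be the point mass there.\<close>
  have C: "IT.C 0 m (\<lambda>_. undefined) = L m" for m
  proof (induction m)
    case 0
    show ?case
    proof (rule measure_eqI)
      show "sets (IT.C 0 0 (\<lambda>_. undefined)) = sets (L 0)" by (simp add: L)
      fix X assume "X \<in> sets (IT.C 0 0 (\<lambda>_. undefined))"
      then have "X = {} \<or> X = {\<lambda>_. undefined}" by (auto simp: sets_PiM_empty)
      then show "emeasure (IT.C 0 0 (\<lambda>_. undefined)) X = emeasure (L 0) X"
        using prob_space.emeasure_space_1[OF L(2)[of 0]]
        by (auto simp: spL space_PiM emeasure_return sets_PiM_empty)
    qed
  next
    case (Suc m)
    show ?case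
    proof (rule measure_eqI)
      show *: "sets (IT.C 0 (Suc m) (\<lambda>_. undefined)) = sets (L (Suc m))"
        by (subst IT.sets_C) (auto simp: L space_PiM)
      fix X assume "X \<in> sets (IT.C 0 (Suc m) (\<lambda>_. undefined))"
      then have X[measurable]: "X \<in> sets (PiM {0..<Suc m} M)" by (simp only: * L)
      have upd[measurable]: "(\<lambda>p. (fst p)(m := snd p)) \<in> measurable (PiM {0..<m} M \<Otimes>\<^sub>M M m) (PiM {0..<Suc m} M)"
        by (rule measurable_fun_upd[where J="{0..<m}"]) auto
      have "emeasure (IT.C 0 (Suc m) (\<lambda>_. undefined)) X = emeasure (L m \<bind> IT.eP m) X"
        by (simp add: Suc)
      also have "\<dots> = (\<integral>\<^sup>+\<omega>. emeasure (IT.eP m \<omega>) X \<partial>L m)"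
        by (rule emeasure_bind[OF _ _ X])
          (use prob_space.not_empty[OF L(2)] IT.measurable_eP[of m] L(1) in \<open>auto cong: measurable_cong_sets\<close>)
      also have "\<dots> = (\<integral>\<^sup>+x. (\<integral>\<^sup>+y. indicator X (x(m := y)) \<partial>K m x) \<partial>L m)"
      proof (rule nn_integral_cong)
        fix x assume "x \<in> space (L m)"
        then have x: "x \<in> space (PiM {0..<m} M)" by (simp add: spL)
        have "emeasure (IT.eP m x) X = (\<integral>\<^sup>+y. indicator X y \<partial>IT.eP m x)"
          using IT.sets_eP[OF x] by simp
        also have "\<dots> = (\<integral>\<^sup>+y. indicator X (x(m := y)) \<partial>K m x)"
          by (rule IT.nn_integral_eP[OF x]) simp
        finally show "emeasure (IT.eP m x) X = (\<integral>\<^sup>+y. indicator X (x(m := y)) \<partial>K m x)" .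
      qed
      also have "\<dots> = (\<integral>\<^sup>+p. indicator X ((fst p)(m := snd p)) \<partial>?J m)"
        by (subst K(3)) auto
      also have "\<dots> = (\<integral>\<^sup>+x. indicator X ((restrict x {0..<m})(m := x m)) \<partial>L (Suc m))"
        by (subst nn_integral_distr) auto
      also have "\<dots> = (\<integral>\<^sup>+\<omega>. indicator X \<omega> \<partial>L (Suc m))"
      proof (rule nn_integral_cong)
        fix x assume "x \<in> space (L (Suc m))"
        then have "(restrict x {0..<m})(m := x m) = x"
          by (auto simp: spL space_PiM PiE_iff extensional_def restrict_def fun_eq_iff less_Suc_eq)
        then show "indicator X ((restrict x {0..<m})(m := x m)) = (indicator X x :: ennreal)" by simp
      qed
      also have "\<dots> = emeasure (L (Suc m)) X" by (simp add: L)
      finally show "emeasure (IT.C 0 (Suc m) (\<lambda>_. undefined)) X = emeasure (L (Suc m)) X" .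
    qed
  qed
  \<comment> \<open>An initial segment is its own covering segment, so the marginal
    \<open>IT.CI {0..<m}\<close> is the law of the chain after exactly \<open>m\<close>
    steps.\<close>
  have up: "IT.up_to {0..<m} = m" for m
    by (rule antisym) (use IT.up_to_iff_Ico[of "{0..<m}" "IT.up_to {0..<m}"] in \<open>auto simp: IT.up_to_iff_Ico\<close>)
  have "distr IT.PF.lim (PiM {0..<m} M) (\<lambda>\<omega>. restrict \<omega> {0..<m}) = L m" for m
  proof -
    have "distr IT.PF.lim (PiM {0..<m} M) (\<lambda>\<omega>. restrict \<omega> {0..<m}) = IT.CI {0..<m}"
      by (rule IT.distr_lim) simp
    also have "\<dots> = distr (L m) (PiM {0..<m} M) (\<lambda>\<omega>. restrict \<omega> {0..<m})"
      by (simp add: IT.CI_def up C)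
    also have "\<dots> = distr (L m) (L m) (\<lambda>\<omega>. \<omega>)"
      by (rule distr_cong) (auto simp: L spL space_PiM)
    also have "\<dots> = L m" by (simp add: distr_id2)
    finally show ?thesis .
  qed
  moreover have "sets IT.PF.lim = sets (PiM UNIV M)" by simp
  \<comment> \<open>The total mass is read off from the marginal on the empty product.\<close>
  moreover have "prob_space IT.PF.lim"
  proof -
    have "prob_space (distr IT.PF.lim (PiM {0..<0} M) (\<lambda>\<omega>. restrict \<omega> {0..<0}))"
      using calculation(1)[of 0] L(2)[of 0] by simp
    moreover have "(\<lambda>\<omega>. restrict \<omega> {0..<0}) \<in> measurable IT.PF.lim (PiM {0..<0} M)"
      unfolding measurable_cong_sets[OF IT.PF.sets_lim refl] by (intro measurable_restrict) auto
    ultimately show ?thesis by (rule prob_space_distrD[rotated])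
  qed
  ultimately show ?thesis using that by blast
qed

subsection \<open>The space of configurations\<close>

text \<open>The centre \<open>undefined\<close> is just some fixed point. Integer radii give a
  countable exhaustion by bounded sets that starts with the empty set, so that the shells fill every
  window exactly.\<close>

definition window :: "nat \<Rightarrow> 'a::polish_space set" where
  "window n = ball undefined (real n)"

text \<open>The disjoint annuli that serve as coordinates: the shells with index below
  \<open>n\<close> make up \<open>window n\<close>.\<close>

definition shell :: "nat \<Rightarrow> 'a::polish_space set" where
  "shell n = window (Suc n) - window n"

lemma window_sets[measurable, simp]: "window n \<in> sets borel"
  by (simp add: window_def)

lemma shell_sets[measurable, simp]: "shell n \<in> sets borel"
  by (simp add: shell_def)

lemma bounded_window[simp]: "bounded (window n)"
  by (simp add: window_def)

lemma bounded_shell[simp]: "bounded (shell n)"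
  by (rule bounded_subset[OF bounded_window[of "Suc n"]]) (auto simp: shell_def)

lemma window_mono: "m \<le> n \<Longrightarrow> window m \<subseteq> window n"
  unfolding window_def by (rule subset_ball) simp

lemma bounded_subset_window: "bounded B \<Longrightarrow> \<exists>n. B \<subseteq> window n"
proof -
  assume "bounded B"
  then obtain e where e: "\<And>y. y \<in> B \<Longrightarrow> dist undefined y \<le> e"
    using bounded_any_center[of B undefined] by blast
  obtain n :: nat where "e < real n" using reals_Archimedean2 by blast
  with e have "B \<subseteq> window n" by (force simp: window_def)
  then show ?thesis ..
qed

lemma ex_window: "\<exists>n. x \<in> window n"
  using bounded_subset_window[of "{x}"] by auto

lemma UN_window: "(\<Union>n. window n) = UNIV"
  using ex_window by auto

lemma window_0[simp]: "window 0 = {}"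
  by (simp add: window_def)

lemma window_shell_disjoint: "m \<le> j \<Longrightarrow> window m \<inter> shell j = {}"
  using window_mono[of m j] by (auto simp: shell_def)

lemma disjoint_shell: "disjoint_family shell"
  unfolding disjoint_family_on_def
proof (intro ballI impI)
  fix m n :: nat assume "m \<noteq> n"
  then show "shell m \<inter> shell n = {}"
  proof (induction m n rule: linorder_wlog)
    case (le m n)
    then show ?case using window_mono[of "Suc m" n] by (auto simp: shell_def)
  qed auto
qed

lemma UN_shell: "(\<Union>j<n. shell j) = window n"
proof (induction n)
  case (Suc n)
  then show ?case using window_mono[of n "Suc n"] by (auto simp: lessThan_Suc shell_def)
qed simp

section \<open>Measurability of counts and of integrals over a configuration\<close>

lemma space_N_sigma[simp]: "space N_sigma = N_space"
  unfolding N_sigma_def by (rule space_measure_of) auto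

lemma sets_N_sigma: "sets N_sigma = sigma_sets N_space
     {{\<eta>\<in>N_space. emeasure \<eta> B \<in> A} | B A. B \<in> sets borel \<and> bounded B \<and> A \<in> sets (borel :: ennreal measure)}"
  unfolding N_sigma_def by (rule sets_measure_of) auto

lemma N_spaceI:
  assumes "sets \<eta> = sets borel"
    and "\<And>B. B \<in> sets borel \<Longrightarrow> bounded B \<Longrightarrow> \<exists>n::nat. emeasure \<eta> B = of_nat n"
  shows "\<eta> \<in> N_space"
  using assms by (simp add: N_space_def)

lemma N_space_sets[simp]: "\<eta> \<in> N_space \<Longrightarrow> sets \<eta> = sets borel"
  by (simp add: N_space_def)

lemma N_space_space[simp]: "\<eta> \<in> N_space \<Longrightarrow> space \<eta> = UNIV"
  using sets_eq_imp_space_eq[of \<eta> borel] by simp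

lemma N_space_nat:
  assumes "\<eta> \<in> N_space" "B \<in> sets borel" "bounded B"
  obtains n :: nat where "emeasure \<eta> B = of_nat n"
  using assms unfolding N_space_def by blast

lemma N_space_finite:
  assumes "\<eta> \<in> N_space" "B \<in> sets borel" "bounded B" shows "emeasure \<eta> B < \<infinity>"
proof -
  obtain n :: nat where "emeasure \<eta> B = of_nat n" using assms by (rule N_space_nat)
  then show ?thesis by (simp add: of_nat_less_top)
qed

lemma measurable_N_sigmaI:
  fixes g :: "'b \<Rightarrow> 'a::polish_space measure"
  assumes "\<And>\<omega>. \<omega> \<in> space M \<Longrightarrow> g \<omega> \<in> N_space"
    and "\<And>B. B \<in> sets borel \<Longrightarrow> bounded B \<Longrightarrow> (\<lambda>\<omega>. emeasure (g \<omega>) B) \<in> borel_measurable M"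
  shows "g \<in> measurable M N_sigma"
  unfolding N_sigma_def
proof (rule measurable_measure_of)
  fix y :: "'a measure set" assume "y \<in> {{\<eta>\<in>N_space. emeasure \<eta> B \<in> A} | B A. B \<in> sets borel \<and> bounded B \<and> A \<in> sets (borel :: ennreal measure)}"
  then obtain B A where y: "y = {\<eta>\<in>N_space. emeasure \<eta> B \<in> A}" "B \<in> sets borel" "bounded B" "A \<in> sets borel"
    by auto
  have "g -` y \<inter> space M = (\<lambda>\<omega>. emeasure (g \<omega>) B) -` A \<inter> space M"
    using assms(1) by (auto simp: y)
  then show "g -` y \<inter> space M \<in> sets M"
    using measurable_sets[OF assms(2)[OF y(2,3)] y(4)] by simp
qed (use assms(1) in auto)

lemma measurable_emeasure_bounded:
  assumes "B \<in> sets borel" "bounded B"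
  shows "(\<lambda>\<eta>. emeasure \<eta> B) \<in> borel_measurable N_sigma"
proof (rule measurableI)
  fix A :: "ennreal set" assume "A \<in> sets borel"
  then show "(\<lambda>\<eta>. emeasure \<eta> B) -` A \<inter> space N_sigma \<in> sets N_sigma"
    unfolding sets_N_sigma using assms by (intro sigma_sets.Basic) auto
qed auto

text \<open>A Dynkin argument starting from rectangles. Its complement step subtracts counts, which
  is legitimate only when they are finite; hence everything is first intersected with a window and
  the windows are released by monotone limits.\<close>

lemma measurable_emeasure_config_Pair:
  assumes g[measurable]: "g \<in> measurable M N_sigma" and C: "C \<in> sets (M \<Otimes>\<^sub>M borel)"
  shows "(\<lambda>\<omega>. emeasure (g \<omega>) (Pair \<omega> -` C)) \<in> borel_measurable M"
proof -
  have gN: "g \<omega> \<in> N_space" if "\<omega> \<in> space M" for \<omega>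
    using measurable_space[OF g that] by simp
  have meas: "(\<lambda>\<omega>. emeasure (g \<omega>) B) \<in> borel_measurable M" if "B \<in> sets borel" "bounded B" for B
    using measurable_compose[OF g measurable_emeasure_bounded[OF that]] .
  let ?s = "\<lambda>n C \<omega>. emeasure (g \<omega>) (window n \<inter> Pair \<omega> -` C)"
  have C_sub: "Pair \<omega> -` C \<in> sets borel" if "C \<in> sets (M \<Otimes>\<^sub>M borel)" for \<omega> C
    using that by (rule sets_Pair1)
  have win: "?s n C \<in> borel_measurable M" for n
    using Int_stable_pair_measure_generator pair_measure_closed C[unfolded sets_pair_measure]
  proof (induct rule: sigma_sets_induct_disjoint)
    case (basic A)
    then obtain X Y where A: "A = X \<times> Y" "X \<in> sets M" "Y \<in> sets borel" by auto
    have "?s n A \<omega> = emeasure (g \<omega>) (window n \<inter> Y) * indicator X \<omega>" for \<omega>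
      by (auto simp: A indicator_def)
    moreover have "bounded (window n \<inter> Y)" by (rule bounded_subset[OF bounded_window[of n]]) auto
    ultimately show ?case using A by (auto intro!: borel_measurable_times_ennreal meas)
  next
    case empty
    then show ?case by simp
  next
    case (compl A)
    then have A: "A \<in> sets (M \<Otimes>\<^sub>M borel)" by (simp add: sets_pair_measure)
    have "?s n (space M \<times> space borel - A) \<omega> = emeasure (g \<omega>) (window n) - ?s n A \<omega>" if "\<omega> \<in> space M" for \<omega>
    proof -
      have "window n \<inter> Pair \<omega> -` (space M \<times> space borel - A) = window n - (window n \<inter> Pair \<omega> -` A)"
        using that by auto
      then show ?thesis
        using gN[OF that] N_space_finite[OF gN[OF that], of "window n \<inter> Pair \<omega> -` A"] C_sub[OF A, of \<omega>]
        by (simp add: emeasure_Diff bounded_subset[OF bounded_window[of n]] less_top)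
    qed
    moreover have "(\<lambda>\<omega>. emeasure (g \<omega>) (window n) - ?s n A \<omega>) \<in> borel_measurable M"
      using compl meas[of "window n"] by auto
    ultimately show ?case by (subst measurable_cong) auto
  next
    case (union F)
    then have F: "F i \<in> sets (M \<Otimes>\<^sub>M borel)" for i by (auto simp: sets_pair_measure)
    have "?s n (\<Union>i. F i) \<omega> = (\<Sum>i. ?s n (F i) \<omega>)" if "\<omega> \<in> space M" for \<omega>
    proof -
      have "(\<Sum>i. ?s n (F i) \<omega>) = emeasure (g \<omega>) (\<Union>i. window n \<inter> Pair \<omega> -` F i)"
        using union(1) gN[OF that] C_sub[OF F]
        by (intro suminf_emeasure) (auto simp: disjoint_family_on_def)
      also have "(\<Union>i. window n \<inter> Pair \<omega> -` F i) = window n \<inter> Pair \<omega> -` (\<Union>i. F i)" by auto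
      finally show ?thesis by simp
    qed
    moreover have "(\<lambda>\<omega>. \<Sum>i. ?s n (F i) \<omega>) \<in> borel_measurable M"
      using union by auto
    ultimately show ?case by (subst measurable_cong) auto
  qed
  have "emeasure (g \<omega>) (Pair \<omega> -` C) = (SUP n. ?s n C \<omega>)" if "\<omega> \<in> space M" for \<omega>
  proof -
    have "(SUP n. ?s n C \<omega>) = emeasure (g \<omega>) (\<Union>n. window n \<inter> Pair \<omega> -` C)"
      using gN[OF that] C_sub[OF C, of \<omega>] window_mono
      by (intro SUP_emeasure_incseq) (auto simp: incseq_def)
    also have "(\<Union>n. window n \<inter> Pair \<omega> -` C) = Pair \<omega> -` C" using UN_window by auto
    finally show ?thesis by simp
  qed
  moreover have "(\<lambda>\<omega>. SUP n. ?s n C \<omega>) \<in> borel_measurable M" using win by measurable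
  ultimately show ?thesis by (subst measurable_cong) auto
qed

text \<open>A configuration is a kernel of possibly infinite mass, so the rules for subprobability
  kernels do not apply; the monotone class induction is carried out directly from the case of
  indicators.\<close>

lemma measurable_nn_integral_config:
  assumes f: "f \<in> borel_measurable (M \<Otimes>\<^sub>M borel)" and g[measurable]: "g \<in> measurable M N_sigma"
  shows "(\<lambda>\<omega>. \<integral>\<^sup>+y. f (\<omega>, y) \<partial>g \<omega>) \<in> borel_measurable M"
proof -
  have gN: "g \<omega> \<in> N_space" if "\<omega> \<in> space M" for \<omega>
    using measurable_space[OF g that] by simp
  show ?thesis
    using f
  proof (induction f rule: borel_measurable_induct)
    case (cong f h)
    then have "(\<integral>\<^sup>+y. f (\<omega>, y) \<partial>g \<omega>) = (\<integral>\<^sup>+y. h (\<omega>, y) \<partial>g \<omega>)" if "\<omega> \<in> space M" for \<omega>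
      using that by (intro nn_integral_cong) (auto simp: space_pair_measure)
    with cong show ?case by (simp cong: measurable_cong)
  next
    case (set A)
    have "(\<integral>\<^sup>+y. indicator A (\<omega>, y) \<partial>g \<omega>) = emeasure (g \<omega>) (Pair \<omega> -` A)" if "\<omega> \<in> space M" for \<omega>
    proof -
      have "(\<integral>\<^sup>+y. indicator A (\<omega>, y) \<partial>g \<omega>) = (\<integral>\<^sup>+y. indicator (Pair \<omega> -` A) y \<partial>g \<omega>)"
        by (intro nn_integral_cong) (auto simp: indicator_def)
      then show ?thesis using gN[OF that] sets_Pair1[OF set] by simp
    qed
    then show ?case using measurable_emeasure_config_Pair[OF g set] by (simp cong: measurable_cong)
  next
    case (mult u c)
    have "(\<integral>\<^sup>+y. c * u (\<omega>, y) \<partial>g \<omega>) = c * (\<integral>\<^sup>+y. u (\<omega>, y) \<partial>g \<omega>)" if "\<omega> \<in> space M" for \<omega>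
      using measurable_Pair2[OF mult(2) that] gN[OF that] by (intro nn_integral_cmult) (simp cong: measurable_cong_sets)
    with mult show ?case by (simp cong: measurable_cong)
  next
    case (add u v)
    have "(\<integral>\<^sup>+y. v (\<omega>, y) + u (\<omega>, y) \<partial>g \<omega>) = (\<integral>\<^sup>+y. v (\<omega>, y) \<partial>g \<omega>) + (\<integral>\<^sup>+y. u (\<omega>, y) \<partial>g \<omega>)"
      if "\<omega> \<in> space M" for \<omega>
      using measurable_Pair2[OF add(1) that] measurable_Pair2[OF add(3) that] gN[OF that]
      by (intro nn_integral_add) (simp_all cong: measurable_cong_sets)
    with add show ?case by (simp cong: measurable_cong)
  next
    case (seq U)
    have "(\<integral>\<^sup>+y. (SUP i. U i) (\<omega>, y) \<partial>g \<omega>) = (SUP i. \<integral>\<^sup>+y. U i (\<omega>, y) \<partial>g \<omega>)"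
      if "\<omega> \<in> space M" for \<omega>
      unfolding SUP_apply using seq gN[OF that] that
      by (intro nn_integral_monotone_convergence_SUP) (auto simp: incseq_def le_fun_def cong: measurable_cong_sets)
    with seq show ?case by (simp cong: measurable_cong)
  qed
qed

text \<open>The generators of \<open>N_sigma\<close> only involve bounded sets; a constant section
  extends this to all Borel sets.\<close>

lemma measurable_emeasure_config[measurable]:
  assumes [measurable]: "B \<in> sets borel"
  shows "(\<lambda>\<eta>. emeasure \<eta> B) \<in> borel_measurable N_sigma"
proof -
  have "(\<lambda>\<eta>. emeasure \<eta> (Pair \<eta> -` (space N_sigma \<times> B))) \<in> borel_measurable N_sigma"
    by (rule measurable_emeasure_config_Pair[where g="\<lambda>x. x", OF measurable_ident_sets[OF refl] pair_measureI[OF sets.top assms]])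
  then show ?thesis by (rule measurable_cong[THEN iffD1, rotated]) auto
qed

subsection \<open>Operations on configurations\<close>

text \<open>Encoded as a density so that the restriction remains a measure on the whole space, hence
  an element of \<open>N_space\<close>.\<close>

definition restr :: "'a::polish_space set \<Rightarrow> 'a measure \<Rightarrow> 'a measure" where
  "restr B \<eta> = density \<eta> (indicator B)"

text \<open>Component \<open>j\<close> contributes only what it has in \<open>shell j\<close>;
  anything it has elsewhere is discarded, so gluing is defined on the full product without support
  conditions.\<close>

definition glue :: "(nat \<Rightarrow> 'a::polish_space measure) \<Rightarrow> 'a measure" where
  "glue \<omega> = measure_of UNIV (sets borel) (\<lambda>A. \<Sum>j. emeasure (\<omega> j) (A \<inter> shell j))"

lemma null_measure_N[simp]: "null_measure borel \<in> N_space"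
  by (rule N_spaceI) (auto intro: exI[of _ 0])

lemma sets_restr[simp]: "sets (restr B \<eta>) = sets \<eta>"
  by (simp add: restr_def)

lemma emeasure_restr: "\<eta> \<in> N_space \<Longrightarrow> A \<in> sets borel \<Longrightarrow> B \<in> sets borel \<Longrightarrow>
    emeasure (restr B \<eta>) A = emeasure \<eta> (A \<inter> B)"
  unfolding restr_def
  by (subst emeasure_density) (auto simp: indicator_inter_arith[symmetric] Int_commute cong: measurable_cong_sets)

lemma restr_N[simp]:
  assumes "\<eta> \<in> N_space" "B \<in> sets borel" shows "restr B \<eta> \<in> N_space"
proof -
  have "\<exists>n::nat. emeasure (restr B \<eta>) A = of_nat n" if "A \<in> sets borel" "bounded A" for A
  proof -
    have "bounded (A \<inter> B)" using that(2) by (rule bounded_subset) auto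
    moreover have "A \<inter> B \<in> sets borel" using assms that by auto
    ultimately obtain n :: nat where "emeasure \<eta> (A \<inter> B) = of_nat n"
      using N_space_nat[OF assms(1)] by blast
    then show ?thesis using assms that by (auto simp: emeasure_restr)
  qed
  then show ?thesis using N_space_sets[OF assms(1)] by (intro N_spaceI) simp_all
qed

lemma nn_integral_restr: "\<eta> \<in> N_space \<Longrightarrow> B \<in> sets borel \<Longrightarrow> f \<in> borel_measurable borel \<Longrightarrow>
    (\<integral>\<^sup>+x. f x \<partial>restr B \<eta>) = (\<integral>\<^sup>+x. indicator B x * f x \<partial>\<eta>)"
  unfolding restr_def by (rule nn_integral_density) (auto cong: measurable_cong_sets)

lemma restr_restr: "\<eta> \<in> N_space \<Longrightarrow> A \<in> sets borel \<Longrightarrow> B \<in> sets borel \<Longrightarrow>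
    restr A (restr B \<eta>) = restr (A \<inter> B) \<eta>"
  by (rule measure_eqI) (auto simp: emeasure_restr Int_assoc)

lemma measurable_restr[measurable]:
  assumes [measurable]: "B \<in> sets borel" shows "restr B \<in> measurable N_sigma N_sigma"
proof (rule measurable_N_sigmaI)
  fix A :: "'a set" assume A[measurable]: "A \<in> sets borel"
  have "(\<lambda>\<eta>. emeasure \<eta> (A \<inter> B)) \<in> borel_measurable N_sigma" by measurable
  then show "(\<lambda>\<eta>. emeasure (restr B \<eta>) A) \<in> borel_measurable N_sigma"
    by (rule measurable_cong[THEN iffD1, rotated]) (simp add: emeasure_restr)
qed simp

lemma sets_add_point[simp]: "sets (add_point \<eta> x) = sets borel"
  unfolding add_point_def by (subst sets_measure_of) (auto simp: sets.sigma_sets_eq[of borel, simplified])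

lemma emeasure_add_point:
  assumes "sets \<eta> = sets borel" "A \<in> sets borel"
  shows "emeasure (add_point \<eta> x) A = emeasure \<eta> A + indicator A x"
  unfolding add_point_def
proof (rule emeasure_measure_of_sigma)
  show "sigma_algebra UNIV (sets borel)" using sets.sigma_algebra_axioms[of borel] by simp
  show "positive (sets borel) (\<lambda>A. emeasure \<eta> A + indicator A x)" by (simp add: positive_def)
  show "countably_additive (sets borel) (\<lambda>A. emeasure \<eta> A + indicator A x)"
  proof (rule countably_additiveI)
    fix A :: "nat \<Rightarrow> 'a set" assume A: "range A \<subseteq> sets borel" "disjoint_family A"
    show "(\<Sum>i. emeasure \<eta> (A i) + indicator (A i) x) = emeasure \<eta> (\<Union>i. A i) + indicator (\<Union>i. A i) x"
      using A assms by (subst suminf_add[symmetric]) (auto simp: suminf_emeasure suminf_indicator)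
  qed
  show "A \<in> sets borel" by fact
qed

lemma nn_integral_add_point:
  assumes "sets \<eta> = sets borel" "f \<in> borel_measurable borel"
  shows "(\<integral>\<^sup>+y. f y \<partial>add_point \<eta> x) = (\<integral>\<^sup>+y. f y \<partial>\<eta>) + f x"
proof -
  have sp: "space \<eta> = UNIV" "space (add_point \<eta> x) = UNIV"
    using sets_eq_imp_space_eq[OF assms(1)] sets_eq_imp_space_eq[OF sets_add_point[of \<eta> x]] by simp_all
  show ?thesis
    using assms(2)
  proof (induction f rule: borel_measurable_induct)
    case (cong f g)
    then show ?case by (auto simp: sp cong: nn_integral_cong_simp)
  next
    case (set A)
    then show ?case using assms(1) by (simp add: emeasure_add_point)
  next
    case (mult u c)
    then show ?case using assms(1)
      by (simp add: nn_integral_cmult distrib_left cong: measurable_cong_sets)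
  next
    case (add u v)
    then show ?case using assms(1)
      by (simp add: nn_integral_add add_ac cong: measurable_cong_sets)
  next
    case (seq U)
    have "(\<integral>\<^sup>+y. (SUP i. U i y) \<partial>add_point \<eta> x) = (SUP i. \<integral>\<^sup>+y. U i y \<partial>add_point \<eta> x)"
      unfolding SUP_apply using seq
      by (intro nn_integral_monotone_convergence_SUP) (auto cong: measurable_cong_sets)
    also have "\<dots> = (SUP i. (\<integral>\<^sup>+y. U i y \<partial>\<eta>) + U i x)" using seq by simp
    also have "\<dots> = (SUP i. \<integral>\<^sup>+y. U i y \<partial>\<eta>) + (SUP i. U i x)"
      using \<open>incseq U\<close> by (intro ennreal_SUP_add) (auto simp: incseq_def le_fun_def intro!: nn_integral_mono)
    also have "(SUP i. \<integral>\<^sup>+y. U i y \<partial>\<eta>) = (\<integral>\<^sup>+y. (SUP i. U i y) \<partial>\<eta>)"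
      unfolding SUP_apply using seq assms(1)
      by (intro nn_integral_monotone_convergence_SUP[symmetric]) (auto cong: measurable_cong_sets)
    finally show ?case unfolding SUP_apply .
  qed
qed

lemma add_point_N[simp]:
  assumes "\<eta> \<in> N_space" shows "add_point \<eta> x \<in> N_space"
proof -
  have "\<exists>n::nat. emeasure (add_point \<eta> x) A = of_nat n" if A: "A \<in> sets borel" "bounded A" for A
  proof -
    obtain n :: nat where "emeasure \<eta> A = of_nat n" using assms A by (rule N_space_nat)
    then have "emeasure (add_point \<eta> x) A = of_nat (n + (if x \<in> A then 1 else 0))"
      using assms A by (simp add: emeasure_add_point indicator_def)
    then show ?thesis ..
  qed
  then show ?thesis by (intro N_spaceI) simp_all
qed

lemma add_point_commute: "\<eta> \<in> N_space \<Longrightarrow> add_point (add_point \<eta> x) y = add_point (add_point \<eta> y) x"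
  by (rule measure_eqI) (auto simp: emeasure_add_point add_ac)

lemma restr_add_point: "\<eta> \<in> N_space \<Longrightarrow> B \<in> sets borel \<Longrightarrow>
    restr B (add_point \<eta> x) = (if x \<in> B then add_point (restr B \<eta>) x else restr B \<eta>)"
  by (rule measure_eqI) (auto simp: emeasure_restr emeasure_add_point split: split_indicator)

lemma measurable_add_point[measurable (raw)]:
  fixes f :: "'b \<Rightarrow> 'a::polish_space"
  assumes [measurable]: "g \<in> measurable M N_sigma" "f \<in> measurable M borel"
  shows "(\<lambda>\<omega>. add_point (g \<omega>) (f \<omega>)) \<in> measurable M N_sigma"
proof (rule measurable_N_sigmaI)
  have gN: "g \<omega> \<in> N_space" if "\<omega> \<in> space M" for \<omega>
    using measurable_space[OF assms(1) that] by simp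
  then show "add_point (g \<omega>) (f \<omega>) \<in> N_space" if "\<omega> \<in> space M" for \<omega>
    using that by simp
  fix A :: "'a set" assume A[measurable]: "A \<in> sets borel"
  have "(\<lambda>\<omega>. emeasure (g \<omega>) A + indicator A (f \<omega>)) \<in> borel_measurable M" by measurable
  then show "(\<lambda>\<omega>. emeasure (add_point (g \<omega>) (f \<omega>)) A) \<in> borel_measurable M"
    by (rule measurable_cong[THEN iffD1, rotated]) (simp add: emeasure_add_point gN)
qed

lemma sets_glue[simp]: "sets (glue \<omega>) = sets borel"
  unfolding glue_def by (subst sets_measure_of) (auto simp: sets.sigma_sets_eq[of borel, simplified])

lemma emeasure_glue:
  assumes \<omega>: "\<And>j. sets (\<omega> j) = sets borel" and "A \<in> sets borel"
  shows "emeasure (glue \<omega>) A = (\<Sum>j. emeasure (\<omega> j) (A \<inter> shell j))"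
  unfolding glue_def
proof (rule emeasure_measure_of_sigma)
  let ?m = "\<lambda>A. \<Sum>j. emeasure (\<omega> j) (A \<inter> shell j)"
  show "sigma_algebra UNIV (sets borel)" using sets.sigma_algebra_axioms[of borel] by simp
  show "positive (sets borel) ?m" by (simp add: positive_def)
  show "countably_additive (sets borel) ?m"
  proof (rule countably_additiveI)
    fix A :: "nat \<Rightarrow> 'a set" assume A: "range A \<subseteq> sets borel" "disjoint_family A"
    have 1: "(\<Sum>i. emeasure (\<omega> j) (A i \<inter> shell j)) = emeasure (\<omega> j) (\<Union>i. A i \<inter> shell j)" for j
      using A \<omega> by (intro suminf_emeasure) (auto simp: disjoint_family_on_def)
    have "(\<Sum>i. ?m (A i)) = (\<Sum>j. \<Sum>i. emeasure (\<omega> j) (A i \<inter> shell j))"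
      using nn_integral_suminf[of "\<lambda>i j. emeasure (\<omega> j) (A i \<inter> shell j)" "count_space UNIV"]
      by (simp add: nn_integral_count_space_nat)
    also have "\<dots> = ?m (\<Union>i. A i)"
      by (simp add: 1)
    finally show "(\<Sum>i. ?m (A i)) = ?m (\<Union>i. A i)" by simp
  qed
  show "A \<in> sets borel" by fact
qed

text \<open>Only finitely many shells meet a window. This makes counts of glued configurations
  finite on bounded sets and makes their restriction to \<open>window m\<close> depend on the first
  \<open>m\<close> coordinates alone.\<close>

lemma emeasure_glue_window:
  assumes \<omega>: "\<And>j. sets (\<omega> j) = sets borel" and "A \<in> sets borel" "A \<subseteq> window m"
  shows "emeasure (glue \<omega>) A = (\<Sum>j<m. emeasure (\<omega> j) (A \<inter> shell j))"
proof -
  have 0: "emeasure (\<omega> j) (A \<inter> shell j) = 0" if "m \<le> j" for j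
  proof -
    have "A \<inter> shell j = {}"
      using assms(3) window_shell_disjoint[of m j] that by auto
    then show ?thesis by simp
  qed
  have "(\<Sum>j. emeasure (\<omega> j) (A \<inter> shell j)) = (\<Sum>j<m. emeasure (\<omega> j) (A \<inter> shell j))"
    by (rule suminf_finite) (simp_all add: 0 not_less)
  then show ?thesis using assms by (simp add: emeasure_glue)
qed

lemma glue_N:
  assumes \<omega>: "\<And>j. \<omega> j \<in> N_space" shows "glue \<omega> \<in> N_space"
proof -
  have "\<exists>n::nat. emeasure (glue \<omega>) A = of_nat n" if A: "A \<in> sets borel" "bounded A" for A
  proof -
    obtain m where m: "A \<subseteq> window m" using bounded_subset_window[OF A(2)] ..
    have "\<exists>n::nat. emeasure (\<omega> j) (A \<inter> shell j) = of_nat n" for j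
      using N_space_nat[OF \<omega>[of j], of "A \<inter> shell j"] A bounded_subset[OF A(2), of "A \<inter> shell j"] by auto
    then obtain n :: "nat \<Rightarrow> nat" where "\<And>j. emeasure (\<omega> j) (A \<inter> shell j) = of_nat (n j)" by metis
    then have "emeasure (glue \<omega>) A = of_nat (\<Sum>j<m. n j)"
      using \<omega> A m by (simp add: emeasure_glue_window)
    then show ?thesis ..
  qed
  then show ?thesis by (intro N_spaceI) simp_all
qed

lemma measurable_glue:
  fixes g :: "'b \<Rightarrow> nat \<Rightarrow> 'a::polish_space measure"
  assumes [measurable]: "\<And>j. (\<lambda>\<omega>. g \<omega> j) \<in> measurable M N_sigma"
  shows "(\<lambda>\<omega>. glue (g \<omega>)) \<in> measurable M N_sigma"
proof (rule measurable_N_sigmaI)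
  have gN: "g \<omega> j \<in> N_space" if "\<omega> \<in> space M" for \<omega> j
    using measurable_space[OF assms that] by simp
  then show "glue (g \<omega>) \<in> N_space" if "\<omega> \<in> space M" for \<omega>
    using that by (simp add: glue_N)
  fix A :: "'a set" assume A[measurable]: "A \<in> sets borel"
  have "(\<lambda>\<omega>. emeasure (g \<omega> j) (A \<inter> shell j)) \<in> borel_measurable M" for j
    by (rule measurable_compose[OF assms measurable_emeasure_config]) simp
  then have "(\<lambda>\<omega>. \<Sum>j. emeasure (g \<omega> j) (A \<inter> shell j)) \<in> borel_measurable M" by measurable
  then show "(\<lambda>\<omega>. emeasure (glue (g \<omega>)) A) \<in> borel_measurable M"
    by (rule measurable_cong[THEN iffD1, rotated]) (simp add: emeasure_glue gN)
qed

lemma measurable_nn_integral_config_id[measurable (raw)]: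
  assumes "(\<lambda>(\<eta>, y). f \<eta> y) \<in> borel_measurable (N_sigma \<Otimes>\<^sub>M borel)"
  shows "(\<lambda>\<eta>. \<integral>\<^sup>+y. f \<eta> y \<partial>\<eta>) \<in> borel_measurable N_sigma"
  using measurable_nn_integral_config[OF assms measurable_ident_sets[OF refl]] by simp

lemma N_space_in_sets[measurable, simp]: "N_space \<in> sets N_sigma"
  using sets.top[of N_sigma] by simp

lemma sigma_finite_N: "\<eta> \<in> N_space \<Longrightarrow> sigma_finite_measure \<eta>"
  by (rule sigma_finite_measure.intro, rule exI[of _ "range window"])
    (auto simp: UN_window N_space_finite less_top[symmetric] dest: N_space_finite[OF _ window_sets bounded_window])

subsection \<open>Finite-volume Gibbs measures\<close>

locale boundedly_finite =
  fixes mu :: "'a::polish_space measure"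
  assumes sets_mu[measurable_cong, simp]: "sets mu = sets borel"
    and mu_finite: "\<And>B. B \<in> sets borel \<Longrightarrow> bounded B \<Longrightarrow> emeasure mu B < \<infinity>"
begin

lemma space_mu[simp]: "space mu = UNIV"
  using sets_eq_imp_space_eq[OF sets_mu] by simp

sublocale sigma_finite_measure mu
proof -
  have "emeasure mu (window n) \<noteq> \<infinity>" for n
    using mu_finite[OF window_sets bounded_window, of n] by (simp add: less_top)
  then show "sigma_finite_measure mu"
    by (intro sigma_finite_measure.intro exI[of _ "range window"]) (auto simp: UN_window)
qed

end

text \<open>\<open>p x \<eta>\<close> is the conditional intensity of a further point at
  \<open>x\<close>. The cocycle identity \<open>p_sym\<close> makes the weight of a finite
  configuration independent of the order of insertion, and \<open>p_le_1\<close> makes the sum over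
  the number of points converge. The instances are the Boltzmann factor and the constant 1.\<close>

locale papangelou = boundedly_finite mu for mu :: "'a::polish_space measure" +
  fixes p :: "'a \<Rightarrow> 'a measure \<Rightarrow> ennreal"
  assumes p_pair: "(\<lambda>(x, \<eta>). p x \<eta>) \<in> borel_measurable (borel \<Otimes>\<^sub>M N_sigma)"
    and p_le_1: "\<And>x \<eta>. p x \<eta> \<le> 1"
    and p_sym: "\<And>x y \<eta>. \<eta> \<in> N_space \<Longrightarrow> p x \<eta> * p y (add_point \<eta> x) = p y \<eta> * p x (add_point \<eta> y)"
begin

lemma p_measurable[measurable (raw)]:
  assumes [measurable]: "f \<in> measurable M borel" "g \<in> measurable M N_sigma"
  shows "(\<lambda>\<omega>. p (f \<omega>) (g \<omega>)) \<in> borel_measurable M"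
  using measurable_compose[OF _ p_pair, of "\<lambda>\<omega>. (f \<omega>, g \<omega>)"] by simp

text \<open>The weight of n points inserted one after another into \<open>\<Lambda>\<close>: the
  image of the n-fold product of \<open>mu\<close> under the density that multiplies the successive
  intensities. Every ordering is counted, so the factor 1/n! is still missing.\<close>

primrec layer :: "'a set \<Rightarrow> nat \<Rightarrow> 'a measure measure" where
  "layer \<Lambda> 0 = return N_sigma (null_measure borel)"
| "layer \<Lambda> (Suc n) = distr (density (layer \<Lambda> n \<Otimes>\<^sub>M mu) (\<lambda>(\<eta>, x). indicator \<Lambda> x * p x \<eta>))
     N_sigma (\<lambda>(\<eta>, x). add_point \<eta> x)"

lemma sets_layer[simp, measurable_cong]: "sets (layer \<Lambda> n) = sets N_sigma"
  by (cases n) auto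

lemma space_layer[simp]: "space (layer \<Lambda> n) = N_space"
  using sets_eq_imp_space_eq[OF sets_layer] by simp

text \<open>The integrand on the right-hand side of the GNZ equation in \<open>\<Lambda>\<close>, as
  a function of the configuration.\<close>

definition insertion :: "'a set \<Rightarrow> ('a \<times> 'a measure \<Rightarrow> ennreal) \<Rightarrow> 'a measure \<Rightarrow> ennreal" where
  "insertion \<Lambda> F \<eta> = (\<integral>\<^sup>+x. indicator \<Lambda> x * p x \<eta> * F (x, add_point \<eta> x) \<partial>mu)"

lemma nn_integral_layer_0:
  "G \<in> borel_measurable N_sigma \<Longrightarrow> (\<integral>\<^sup>+\<eta>. G \<eta> \<partial>layer \<Lambda> 0) = G (null_measure borel)"
  by (simp add: nn_integral_return)

lemma nn_integral_layer_Suc: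
  assumes [measurable]: "\<Lambda> \<in> sets borel" "G \<in> borel_measurable N_sigma"
  shows "(\<integral>\<^sup>+\<eta>. G \<eta> \<partial>layer \<Lambda> (Suc n)) =
    (\<integral>\<^sup>+\<eta>. (\<integral>\<^sup>+x. indicator \<Lambda> x * p x \<eta> * G (add_point \<eta> x) \<partial>mu) \<partial>layer \<Lambda> n)"
proof -
  have "(\<integral>\<^sup>+\<eta>. G \<eta> \<partial>layer \<Lambda> (Suc n)) =
      (\<integral>\<^sup>+q. (indicator \<Lambda> (snd q) * p (snd q) (fst q)) * G (add_point (fst q) (snd q)) \<partial>(layer \<Lambda> n \<Otimes>\<^sub>M mu))"
    unfolding layer.simps by (subst nn_integral_distr, measurable, subst nn_integral_density) (auto simp: split_beta', (measurable)?)
  also have "\<dots> = (\<integral>\<^sup>+\<eta>. (\<integral>\<^sup>+x. indicator \<Lambda> x * p x \<eta> * G (add_point \<eta> x) \<partial>mu) \<partial>layer \<Lambda> n)"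
    by (subst nn_integral_fst[symmetric]) simp_all
  finally show ?thesis .
qed

lemma measurable_insertion[measurable]:
  assumes [measurable]: "\<Lambda> \<in> sets borel" "F \<in> borel_measurable (borel \<Otimes>\<^sub>M N_sigma)"
  shows "insertion \<Lambda> F \<in> borel_measurable N_sigma"
  unfolding insertion_def[abs_def] by measurable

lemma layer_finite:
  assumes \<Lambda>[measurable]: "\<Lambda> \<in> sets borel"
  shows "emeasure (layer \<Lambda> n) (space (layer \<Lambda> n)) \<le> emeasure mu \<Lambda> ^ n"
proof (induction n)
  case 0
  then show ?case by (simp add: emeasure_return)
next
  case (Suc n)
  have "emeasure (layer \<Lambda> (Suc n)) (space (layer \<Lambda> (Suc n))) = (\<integral>\<^sup>+\<eta>. 1 \<partial>layer \<Lambda> (Suc n))"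
    by simp
  also have "\<dots> = (\<integral>\<^sup>+\<eta>. (\<integral>\<^sup>+x. indicator \<Lambda> x * p x \<eta> * 1 \<partial>mu) \<partial>layer \<Lambda> n)"
    by (rule nn_integral_layer_Suc) auto
  also have "\<dots> \<le> (\<integral>\<^sup>+\<eta>. (\<integral>\<^sup>+x. indicator \<Lambda> x \<partial>mu) \<partial>layer \<Lambda> n)"
    by (intro nn_integral_mono) (auto simp: p_le_1 split: split_indicator)
  also have "\<dots> = emeasure mu \<Lambda> * emeasure (layer \<Lambda> n) (space (layer \<Lambda> n))"
    by simp
  also have "\<dots> \<le> emeasure mu \<Lambda> ^ Suc n"
    using Suc by (simp add: mult_left_mono)
  finally show ?case .
qed

lemma finite_measure_layer:
  assumes "\<Lambda> \<in> sets borel" "bounded \<Lambda>" shows "finite_measure (layer \<Lambda> n)"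
proof (rule finite_measureI)
  have "emeasure mu \<Lambda> ^ n < \<top>" using mu_finite[OF assms] by (simp add: power_less_top_ennreal)
  then show "emeasure (layer \<Lambda> n) (space (layer \<Lambda> n)) \<noteq> \<infinity>"
    using layer_finite[OF assms(1), of n] by (auto simp: top_unique)
qed

text \<open>Any of the n + 1 points may be the marked one, and by symmetry each choice contributes
  the same. In the induction the marked point is either the last inserted one, which gives
  \<open>insertion\<close> directly, or an older one, which is covered by the induction
  hypothesis.\<close>

lemma layer_GNZ:
  assumes \<Lambda>[measurable]: "\<Lambda> \<in> sets borel" and F: "F \<in> borel_measurable (borel \<Otimes>\<^sub>M N_sigma)"
  shows "(\<integral>\<^sup>+\<eta>. (\<integral>\<^sup>+x. F (x, \<eta>) \<partial>\<eta>) \<partial>layer \<Lambda> (Suc n)) =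
    of_nat (Suc n) * (\<integral>\<^sup>+\<eta>. insertion \<Lambda> F \<eta> \<partial>layer \<Lambda> n)"
  using F
proof (induction n arbitrary: F)
  \<comment> \<open>\<open>F'\<close> averages \<open>F\<close> over the last inserted point while
    the mark stays at an older point; it has the type of \<open>F\<close> again, so the induction
    hypothesis applies to it.\<close>
  define F' where "F' F = (\<lambda>(y, \<eta>). \<integral>\<^sup>+x. indicator \<Lambda> x * p x \<eta> * F (y, add_point \<eta> x) \<partial>mu)"
    for F :: "'a \<times> 'a measure \<Rightarrow> ennreal"
  have F'[measurable]: "F' F \<in> borel_measurable (borel \<Otimes>\<^sub>M N_sigma)"
    if [measurable]: "F \<in> borel_measurable (borel \<Otimes>\<^sub>M N_sigma)" for F
    unfolding F'_def by measurable
  have rec1: "(\<integral>\<^sup>+\<eta>. (\<integral>\<^sup>+x. F (x, \<eta>) \<partial>\<eta>) \<partial>layer \<Lambda> (Suc n)) =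
      (\<integral>\<^sup>+\<eta>. (\<integral>\<^sup>+x. F' F (x, \<eta>) \<partial>\<eta>) \<partial>layer \<Lambda> n) + (\<integral>\<^sup>+\<eta>. insertion \<Lambda> F \<eta> \<partial>layer \<Lambda> n)"
    if [measurable]: "F \<in> borel_measurable (borel \<Otimes>\<^sub>M N_sigma)" for F n
  proof -
    have "(\<integral>\<^sup>+\<eta>. (\<integral>\<^sup>+x. F (x, \<eta>) \<partial>\<eta>) \<partial>layer \<Lambda> (Suc n)) = (\<integral>\<^sup>+\<eta>. (\<integral>\<^sup>+x. indicator \<Lambda> x * p x \<eta> *
        (\<integral>\<^sup>+y. F (y, add_point \<eta> x) \<partial>add_point \<eta> x) \<partial>mu) \<partial>layer \<Lambda> n)"
      by (rule nn_integral_layer_Suc) measurable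
    also have "\<dots> = (\<integral>\<^sup>+\<eta>. (\<integral>\<^sup>+x. F' F (x, \<eta>) \<partial>\<eta>) + insertion \<Lambda> F \<eta> \<partial>layer \<Lambda> n)"
    proof (rule nn_integral_cong)
      fix \<eta> :: "'a measure" assume "\<eta> \<in> space (layer \<Lambda> n)"
      then have \<eta>[simp]: "\<eta> \<in> N_space" by simp
      then have [measurable]: "\<eta> \<in> space N_sigma" by simp
      note [measurable_cong] = N_space_sets[OF \<eta>]
      interpret \<eta>: sigma_finite_measure \<eta> by (rule sigma_finite_N) simp
      interpret pair: pair_sigma_finite \<eta> mu ..
      have [measurable]: "(\<lambda>x. add_point \<eta> x) \<in> measurable borel N_sigma"
        by (intro measurable_add_point measurable_const) auto
      have [measurable]: "(\<lambda>x. p x \<eta>) \<in> borel_measurable borel" by measurable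
      have "(\<integral>\<^sup>+x. indicator \<Lambda> x * p x \<eta> * (\<integral>\<^sup>+y. F (y, add_point \<eta> x) \<partial>add_point \<eta> x) \<partial>mu) =
          (\<integral>\<^sup>+x. (\<integral>\<^sup>+y. indicator \<Lambda> x * p x \<eta> * F (y, add_point \<eta> x) \<partial>\<eta>) +
            indicator \<Lambda> x * p x \<eta> * F (x, add_point \<eta> x) \<partial>mu)"
        by (intro nn_integral_cong) (simp add: nn_integral_add_point nn_integral_cmult distrib_left cong: measurable_cong_sets)
      also have "\<dots> = (\<integral>\<^sup>+x. (\<integral>\<^sup>+y. indicator \<Lambda> x * p x \<eta> * F (y, add_point \<eta> x) \<partial>\<eta>) \<partial>mu) + insertion \<Lambda> F \<eta>"
        unfolding insertion_def by (rule nn_integral_add) measurable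
      also have "(\<integral>\<^sup>+x. (\<integral>\<^sup>+y. indicator \<Lambda> x * p x \<eta> * F (y, add_point \<eta> x) \<partial>\<eta>) \<partial>mu) =
          (\<integral>\<^sup>+y. (\<integral>\<^sup>+x. indicator \<Lambda> x * p x \<eta> * F (y, add_point \<eta> x) \<partial>mu) \<partial>\<eta>)"
        by (rule pair.Fubini') measurable
      finally show "(\<integral>\<^sup>+x. indicator \<Lambda> x * p x \<eta> * (\<integral>\<^sup>+y. F (y, add_point \<eta> x) \<partial>add_point \<eta> x) \<partial>mu) =
          (\<integral>\<^sup>+x. F' F (x, \<eta>) \<partial>\<eta>) + insertion \<Lambda> F \<eta>" by (simp add: F'_def)
    qed
    also have "\<dots> = (\<integral>\<^sup>+\<eta>. (\<integral>\<^sup>+x. F' F (x, \<eta>) \<partial>\<eta>) \<partial>layer \<Lambda> n) + (\<integral>\<^sup>+\<eta>. insertion \<Lambda> F \<eta> \<partial>layer \<Lambda> n)"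
      by (rule nn_integral_add) measurable
    finally show ?thesis .
  qed
  \<comment> \<open>Inserting the marked point before or after the averaged one has the same weight:
    this is the cocycle identity together with Fubini.\<close>
  have rec2: "(\<integral>\<^sup>+\<eta>. insertion \<Lambda> (F' F) \<eta> \<partial>layer \<Lambda> n) = (\<integral>\<^sup>+\<eta>. insertion \<Lambda> F \<eta> \<partial>layer \<Lambda> (Suc n))"
    if [measurable]: "F \<in> borel_measurable (borel \<Otimes>\<^sub>M N_sigma)" for F n
  proof -
    interpret pair: pair_sigma_finite mu mu ..
    have "(\<integral>\<^sup>+\<eta>. insertion \<Lambda> F \<eta> \<partial>layer \<Lambda> (Suc n)) =
        (\<integral>\<^sup>+\<eta>. (\<integral>\<^sup>+x. indicator \<Lambda> x * p x \<eta> * insertion \<Lambda> F (add_point \<eta> x) \<partial>mu) \<partial>layer \<Lambda> n)"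
      by (rule nn_integral_layer_Suc) measurable
    also have "\<dots> = (\<integral>\<^sup>+\<eta>. insertion \<Lambda> (F' F) \<eta> \<partial>layer \<Lambda> n)"
    proof (rule nn_integral_cong)
      fix \<eta> :: "'a measure" assume "\<eta> \<in> space (layer \<Lambda> n)"
      then have \<eta>[simp]: "\<eta> \<in> N_space" by simp
      then have [measurable]: "\<eta> \<in> space N_sigma" by simp
      note [measurable_cong] = N_space_sets[OF \<eta>]
      have [measurable]: "(\<lambda>x. add_point \<eta> x) \<in> measurable borel N_sigma"
        by (intro measurable_add_point measurable_const) auto
      let ?h = "\<lambda>x y. indicator \<Lambda> x * p x \<eta> * (indicator \<Lambda> y * p y (add_point \<eta> x) * F (y, add_point (add_point \<eta> x) y))"
      have "(\<integral>\<^sup>+x. indicator \<Lambda> x * p x \<eta> * insertion \<Lambda> F (add_point \<eta> x) \<partial>mu) = (\<integral>\<^sup>+x. (\<integral>\<^sup>+y. ?h x y \<partial>mu) \<partial>mu)"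
        unfolding insertion_def by (intro nn_integral_cong nn_integral_cmult[symmetric]) measurable
      also have "\<dots> = (\<integral>\<^sup>+y. (\<integral>\<^sup>+x. ?h x y \<partial>mu) \<partial>mu)"
        by (rule pair.Fubini'[symmetric]) measurable
      also have "\<dots> = (\<integral>\<^sup>+y. indicator \<Lambda> y * p y \<eta> * F' F (y, add_point \<eta> y) \<partial>mu)"
      proof (rule nn_integral_cong)
        fix y :: 'a
        have "?h x y = indicator \<Lambda> y * p y \<eta> * (indicator \<Lambda> x * p x (add_point \<eta> y) * F (y, add_point (add_point \<eta> y) x))" for x
        proof -
          have "?h x y = indicator \<Lambda> x * indicator \<Lambda> y * (p x \<eta> * p y (add_point \<eta> x)) * F (y, add_point (add_point \<eta> x) y)"
            by (simp only: mult_ac)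
          also have "\<dots> = indicator \<Lambda> x * indicator \<Lambda> y * (p y \<eta> * p x (add_point \<eta> y)) * F (y, add_point (add_point \<eta> y) x)"
            by (simp only: p_sym[OF \<eta>] add_point_commute[OF \<eta>, of x y])
          finally show ?thesis by (simp only: mult_ac)
        qed
        then show "(\<integral>\<^sup>+x. ?h x y \<partial>mu) = indicator \<Lambda> y * p y \<eta> * F' F (y, add_point \<eta> y)"
          unfolding F'_def by (simp add: nn_integral_cmult)
      qed
      finally show "(\<integral>\<^sup>+x. indicator \<Lambda> x * p x \<eta> * insertion \<Lambda> F (add_point \<eta> x) \<partial>mu) = insertion \<Lambda> (F' F) \<eta>"
        by (simp add: insertion_def)
    qed
    finally show ?thesis by simp
  qed
  {
    case 0
    note [measurable] = 0
    have "(\<integral>\<^sup>+\<eta>. (\<integral>\<^sup>+x. F' F (x, \<eta>) \<partial>\<eta>) \<partial>layer \<Lambda> 0) = 0"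
      by (subst nn_integral_layer_0, measurable)
    then show ?case by (simp add: rec1[OF 0] del: layer.simps)
  next
    case (Suc n)
    note [measurable] = Suc.prems
    show ?case
      by (subst rec1[OF Suc.prems], subst Suc.IH[OF F'[OF Suc.prems]], subst rec2[OF Suc.prems])
        (simp add: distrib_right add_ac del: layer.simps)
  }
qed

section \<open>Grand-canonical measures and their GNZ equation\<close>

lemma ex_grand_canonical:
  "\<exists>R. sets R = sets N_sigma \<and> (\<forall>G\<in>borel_measurable N_sigma.
     (\<integral>\<^sup>+\<eta>. G \<eta> \<partial>R) = (\<Sum>n. ennreal (1 / fact n) * (\<integral>\<^sup>+\<eta>. G \<eta> \<partial>layer \<Lambda> n)))"
proof -
  define \<Phi> where "\<Phi> G = (\<Sum>n. ennreal (1 / fact n) * (\<integral>\<^sup>+\<eta>. G \<eta> \<partial>layer \<Lambda> n))" for G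
  obtain R where "sets R = sets N_sigma" "\<And>G. G \<in> borel_measurable N_sigma \<Longrightarrow> (\<integral>\<^sup>+\<eta>. G \<eta> \<partial>R) = \<Phi> G"
  proof (rule measure_of_functional[of N_sigma \<Phi>])
    fix f g :: "'a measure \<Rightarrow> ennreal"
    assume "\<And>x. x \<in> space N_sigma \<Longrightarrow> f x = g x"
    then show "\<Phi> f = \<Phi> g" unfolding \<Phi>_def by (intro arg_cong[where f=suminf] ext arg_cong2[where f="(*)"] nn_integral_cong) auto
  next
    fix c and f :: "'a measure \<Rightarrow> ennreal" assume [measurable]: "f \<in> borel_measurable N_sigma"
    show "\<Phi> (\<lambda>x. c * f x) = c * \<Phi> f"
      unfolding \<Phi>_def ennreal_suminf_cmult[symmetric]
      by (intro arg_cong[where f=suminf] ext) (simp add: nn_integral_cmult mult_ac)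
  next
    fix f g :: "'a measure \<Rightarrow> ennreal" assume [measurable]: "f \<in> borel_measurable N_sigma" "g \<in> borel_measurable N_sigma"
    show "\<Phi> (\<lambda>x. f x + g x) = \<Phi> f + \<Phi> g"
      unfolding \<Phi>_def by (subst suminf_add) (auto simp: nn_integral_add distrib_left)
  next
    fix F :: "nat \<Rightarrow> 'a measure \<Rightarrow> ennreal" assume [measurable]: "\<And>i. F i \<in> borel_measurable N_sigma" and inc: "incseq F"
    have "\<Phi> (\<lambda>x. SUP i. F i x) = (\<Sum>n. SUP i. ennreal (1 / fact n) * (\<integral>\<^sup>+\<eta>. F i \<eta> \<partial>layer \<Lambda> n))"
      unfolding \<Phi>_def using inc
      by (intro arg_cong[where f=suminf] ext)
        (simp add: nn_integral_monotone_convergence_SUP SUP_mult_left_ennreal cong: measurable_cong_sets)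
    also have "\<dots> = (SUP i. \<Phi> (F i))"
      unfolding \<Phi>_def using inc
      by (intro ennreal_suminf_SUP_eq) (auto simp: incseq_def le_fun_def intro!: mult_left_mono nn_integral_mono)
    finally show "\<Phi> (\<lambda>x. SUP i. F i x) = (SUP i. \<Phi> (F i))" .
  qed auto
  then show ?thesis by (auto simp: \<Phi>_def)
qed

text \<open>Unnormalised: its total mass is the partition function. The factor 1/n! undoes the
  counting of orderings in \<open>layer\<close>.\<close>

definition grand_canonical :: "'a set \<Rightarrow> 'a measure measure" where
  "grand_canonical \<Lambda> = (SOME R. sets R = sets N_sigma \<and> (\<forall>G\<in>borel_measurable N_sigma.
     (\<integral>\<^sup>+\<eta>. G \<eta> \<partial>R) = (\<Sum>n. ennreal (1 / fact n) * (\<integral>\<^sup>+\<eta>. G \<eta> \<partial>layer \<Lambda> n))))"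

lemma sets_grand_canonical[simp, measurable_cong]: "sets (grand_canonical \<Lambda>) = sets N_sigma"
  and nn_integral_grand_canonical: "G \<in> borel_measurable N_sigma \<Longrightarrow>
     (\<integral>\<^sup>+\<eta>. G \<eta> \<partial>grand_canonical \<Lambda>) = (\<Sum>n. ennreal (1 / fact n) * (\<integral>\<^sup>+\<eta>. G \<eta> \<partial>layer \<Lambda> n))"
  using someI_ex[OF ex_grand_canonical[of \<Lambda>]] unfolding grand_canonical_def by auto

lemma space_grand_canonical[simp]: "space (grand_canonical \<Lambda>) = N_space"
  using sets_eq_imp_space_eq[OF sets_grand_canonical] by simp

text \<open>The empty configuration alone has mass 1, and the layer bounds sum to the exponential
  series of \<open>mu \<Lambda>\<close>; hence normalisation is possible.\<close>

lemma grand_canonical_total: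
  assumes "\<Lambda> \<in> sets borel" "bounded \<Lambda>"
  shows "1 \<le> emeasure (grand_canonical \<Lambda>) N_space" "emeasure (grand_canonical \<Lambda>) N_space < \<infinity>"
proof -
  have eq: "emeasure (grand_canonical \<Lambda>) N_space = (\<Sum>n. ennreal (1 / fact n) * emeasure (layer \<Lambda> n) N_space)"
  proof -
    have "emeasure (grand_canonical \<Lambda>) N_space = (\<integral>\<^sup>+\<eta>. 1 \<partial>grand_canonical \<Lambda>)" by simp
    also have "\<dots> = (\<Sum>n. ennreal (1 / fact n) * (\<integral>\<^sup>+\<eta>. 1 \<partial>layer \<Lambda> n))"
      by (rule nn_integral_grand_canonical) simp
    finally show ?thesis by (simp del: layer.simps)
  qed
  have "1 = (\<Sum>n<1. ennreal (1 / fact n) * emeasure (layer \<Lambda> n) N_space)"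
    using null_measure_N by (simp add: emeasure_return sets.top[of N_sigma, simplified])
  also have "\<dots> \<le> emeasure (grand_canonical \<Lambda>) N_space"
    unfolding eq by (rule sum_le_suminf) auto
  finally show "1 \<le> emeasure (grand_canonical \<Lambda>) N_space" .
  obtain c where c: "0 \<le> c" "emeasure mu \<Lambda> = ennreal c"
    using mu_finite[OF assms] by (cases "emeasure mu \<Lambda>") auto
  have "emeasure (grand_canonical \<Lambda>) N_space \<le> (\<Sum>n. ennreal (c ^ n /\<^sub>R fact n))"
    unfolding eq
  proof (rule suminf_le)
    fix n
    have "ennreal (1 / fact n) * emeasure (layer \<Lambda> n) N_space \<le> ennreal (1 / fact n) * ennreal (c ^ n)"
      using layer_finite[OF assms(1), of n] c by (intro mult_left_mono) (auto simp: ennreal_power)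
    also have "\<dots> = ennreal (c ^ n /\<^sub>R fact n)"
      using c by (simp add: ennreal_mult[symmetric] divide_inverse mult.commute)
    finally show "ennreal (1 / fact n) * emeasure (layer \<Lambda> n) N_space \<le> ennreal (c ^ n /\<^sub>R fact n)" .
  qed auto
  also have "\<dots> = ennreal (\<Sum>n. c ^ n /\<^sub>R fact n)"
    using c by (intro suminf_ennreal2 summable_exp_generic) auto
  also have "\<dots> < \<infinity>" by simp
  finally show "emeasure (grand_canonical \<Lambda>) N_space < \<infinity>" .
qed

lemma finite_measure_grand_canonical:
  "\<Lambda> \<in> sets borel \<Longrightarrow> bounded \<Lambda> \<Longrightarrow> finite_measure (grand_canonical \<Lambda>)"
  by (rule finite_measureI) (use grand_canonical_total in \<open>auto simp: less_top[symmetric]\<close>)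

text \<open>The factor n + 1 from \<open>layer_GNZ\<close> turns 1/(n+1)! into 1/n!, so the series
  is shifted by one index; nothing is lost at index 0 because the empty configuration has no point
  to mark.\<close>

lemma grand_canonical_GNZ:
  assumes [measurable]: "\<Lambda> \<in> sets borel" "F \<in> borel_measurable (borel \<Otimes>\<^sub>M N_sigma)"
  shows "(\<integral>\<^sup>+\<eta>. (\<integral>\<^sup>+x. F (x, \<eta>) \<partial>\<eta>) \<partial>grand_canonical \<Lambda>) = (\<integral>\<^sup>+\<eta>. insertion \<Lambda> F \<eta> \<partial>grand_canonical \<Lambda>)"
proof -
  let ?A = "\<lambda>n. \<integral>\<^sup>+\<eta>. (\<integral>\<^sup>+x. F (x, \<eta>) \<partial>\<eta>) \<partial>layer \<Lambda> n"
  have A0: "?A 0 = 0"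
    by (subst nn_integral_layer_0, measurable)
  have "(\<integral>\<^sup>+\<eta>. (\<integral>\<^sup>+x. F (x, \<eta>) \<partial>\<eta>) \<partial>grand_canonical \<Lambda>) = (\<Sum>n. ennreal (1 / fact n) * ?A n)"
    by (rule nn_integral_grand_canonical) measurable
  also have "\<dots> = (\<Sum>n. ennreal (1 / fact (Suc n)) * ?A (Suc n))"
    using A0 by (subst suminf_offset[of _ "Suc 0"]) (simp_all del: layer.simps)
  also have "\<dots> = (\<Sum>n. ennreal (1 / fact n) * (\<integral>\<^sup>+\<eta>. insertion \<Lambda> F \<eta> \<partial>layer \<Lambda> n))"
  proof (intro arg_cong[where f=suminf] ext)
    fix n
    have "ennreal (1 / fact (Suc n)) * of_nat (Suc n) = ennreal (1 / fact n)"
      unfolding ennreal_of_nat_eq_real_of_nat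
      by (subst ennreal_mult[symmetric]) (auto simp: field_simps simp del: of_nat_Suc)
    then show "ennreal (1 / fact (Suc n)) * ?A (Suc n) = ennreal (1 / fact n) * (\<integral>\<^sup>+\<eta>. insertion \<Lambda> F \<eta> \<partial>layer \<Lambda> n)"
      by (subst layer_GNZ) (auto simp: mult.assoc[symmetric])
  qed
  also have "\<dots> = (\<integral>\<^sup>+\<eta>. insertion \<Lambda> F \<eta> \<partial>grand_canonical \<Lambda>)"
    by (rule nn_integral_grand_canonical[symmetric]) measurable
  finally show ?thesis .
qed

text \<open>Every layer is reached from the empty configuration by insertions, so an
  insertion-stable property holds on each of them. This takes the place of inductions over the
  points of a configuration.\<close>

lemma grand_canonical_AE:
  assumes \<Lambda>[measurable]: "\<Lambda> \<in> sets borel" and D[measurable]: "Measurable.pred N_sigma D"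
    and base: "D (null_measure borel)" and step: "\<And>\<eta> x. \<eta> \<in> N_space \<Longrightarrow> D \<eta> \<Longrightarrow> D (add_point \<eta> x)"
  shows "AE \<eta> in grand_canonical \<Lambda>. D \<eta>"
proof -
  define G :: "'a measure \<Rightarrow> ennreal" where "G \<eta> = (if D \<eta> then 0 else 1)" for \<eta>
  have [measurable]: "G \<in> borel_measurable N_sigma" unfolding G_def[abs_def] by measurable
  have "(\<integral>\<^sup>+\<eta>. G \<eta> \<partial>layer \<Lambda> n) = 0" for n
  proof (induction n)
    case 0
    then show ?case by (subst nn_integral_layer_0) (auto simp: G_def base)
  next
    case (Suc n)
    have "(\<integral>\<^sup>+\<eta>. G \<eta> \<partial>layer \<Lambda> (Suc n)) = (\<integral>\<^sup>+\<eta>. (\<integral>\<^sup>+x. indicator \<Lambda> x * p x \<eta> * G (add_point \<eta> x) \<partial>mu) \<partial>layer \<Lambda> n)"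
      by (rule nn_integral_layer_Suc) auto
    also have "\<dots> = (\<integral>\<^sup>+\<eta>. 0 \<partial>layer \<Lambda> n)"
    proof (rule nn_integral_cong_AE)
      have "AE \<eta> in layer \<Lambda> n. G \<eta> = 0" using Suc by (subst (asm) nn_integral_0_iff_AE) auto
      then show "AE \<eta> in layer \<Lambda> n. (\<integral>\<^sup>+x. indicator \<Lambda> x * p x \<eta> * G (add_point \<eta> x) \<partial>mu) = 0"
        using AE_space
      proof eventually_elim
        fix \<eta> assume "G \<eta> = 0" "\<eta> \<in> space (layer \<Lambda> n)"
        then have "G (add_point \<eta> x) = 0" for x
          using step[of \<eta> x] by (auto simp: G_def split: if_splits)
        then show "(\<integral>\<^sup>+x. indicator \<Lambda> x * p x \<eta> * G (add_point \<eta> x) \<partial>mu) = 0" by simp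
      qed
    qed
    finally show ?case by simp
  qed
  then have "(\<integral>\<^sup>+\<eta>. G \<eta> \<partial>grand_canonical \<Lambda>) = 0" by (simp add: nn_integral_grand_canonical)
  then have "AE \<eta> in grand_canonical \<Lambda>. G \<eta> = 0" by (subst (asm) nn_integral_0_iff_AE) auto
  then show ?thesis by eventually_elim (auto simp: G_def split: if_splits)
qed

text \<open>The GNZ equation is homogeneous in the measure and null sets do not change under
  scaling, so both properties survive division by the partition function.\<close>

lemma finite_volume_gibbs:
  assumes \<Lambda>[measurable]: "\<Lambda> \<in> sets borel" and "bounded \<Lambda>"
  obtains P where "prob_space P" "sets P = sets N_sigma"
    and "\<And>F. F \<in> borel_measurable (borel \<Otimes>\<^sub>M N_sigma) \<Longrightarrow>
      (\<integral>\<^sup>+\<eta>. (\<integral>\<^sup>+x. F (x, \<eta>) \<partial>\<eta>) \<partial>P) =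
      (\<integral>\<^sup>+x. indicator \<Lambda> x * (\<integral>\<^sup>+\<eta>. F (x, add_point \<eta> x) * p x \<eta> \<partial>P) \<partial>mu)"
    and "\<And>D. Measurable.pred N_sigma D \<Longrightarrow> D (null_measure borel) \<Longrightarrow>
      (\<And>\<eta> x. \<eta> \<in> N_space \<Longrightarrow> D \<eta> \<Longrightarrow> D (add_point \<eta> x)) \<Longrightarrow> AE \<eta> in P. D \<eta>"
proof -
  let ?Z = "emeasure (grand_canonical \<Lambda>) N_space"
  define P where "P = scale_measure (1 / ?Z) (grand_canonical \<Lambda>)"
  note Z = grand_canonical_total[OF assms]
  have sP[measurable_cong]: "sets P = sets N_sigma" by (simp add: P_def)
  have prob: "prob_space P"
  proof (rule prob_spaceI)
    have "?Z \<noteq> 0" using Z(1) by auto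
    then show "emeasure P (space P) = 1"
      using Z(2) by (simp add: P_def space_scale_measure ennreal_divide_times ennreal_divide_self less_top)
  qed
  have int: "(\<integral>\<^sup>+\<eta>. G \<eta> \<partial>P) = 1 / ?Z * (\<integral>\<^sup>+\<eta>. G \<eta> \<partial>grand_canonical \<Lambda>)"
    if "G \<in> borel_measurable N_sigma" for G
    using that unfolding P_def by (intro nn_integral_scale_measure) simp
  have gnz: "(\<integral>\<^sup>+\<eta>. (\<integral>\<^sup>+x. F (x, \<eta>) \<partial>\<eta>) \<partial>P) =
      (\<integral>\<^sup>+x. indicator \<Lambda> x * (\<integral>\<^sup>+\<eta>. F (x, add_point \<eta> x) * p x \<eta> \<partial>P) \<partial>mu)"
    if [measurable]: "F \<in> borel_measurable (borel \<Otimes>\<^sub>M N_sigma)" for F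
  proof -
    interpret P: prob_space P by fact
    interpret pair: pair_sigma_finite P mu ..
    have "(\<integral>\<^sup>+\<eta>. (\<integral>\<^sup>+x. F (x, \<eta>) \<partial>\<eta>) \<partial>P) = (\<integral>\<^sup>+\<eta>. insertion \<Lambda> F \<eta> \<partial>P)"
      by (subst (1 2) int) (auto simp: grand_canonical_GNZ)
    also have "\<dots> = (\<integral>\<^sup>+x. (\<integral>\<^sup>+\<eta>. indicator \<Lambda> x * p x \<eta> * F (x, add_point \<eta> x) \<partial>P) \<partial>mu)"
      unfolding insertion_def by (rule pair.Fubini'[symmetric]) measurable
    also have "\<dots> = (\<integral>\<^sup>+x. indicator \<Lambda> x * (\<integral>\<^sup>+\<eta>. F (x, add_point \<eta> x) * p x \<eta> \<partial>P) \<partial>mu)"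
      by (intro nn_integral_cong, subst nn_integral_cmult[symmetric]) (auto simp: mult_ac)
    finally show ?thesis .
  qed
  have ae: "AE \<eta> in P. D \<eta>" if [measurable]: "Measurable.pred N_sigma D" and "D (null_measure borel)"
      "\<And>\<eta> x. \<eta> \<in> N_space \<Longrightarrow> D \<eta> \<Longrightarrow> D (add_point \<eta> x)" for D
  proof -
    have "AE \<eta> in grand_canonical \<Lambda>. D \<eta>" by (rule grand_canonical_AE) (use that in auto)
    then have "(\<integral>\<^sup>+\<eta>. indicator {\<eta>. \<not> D \<eta>} \<eta> \<partial>grand_canonical \<Lambda>) = (\<integral>\<^sup>+\<eta>. 0 \<partial>grand_canonical \<Lambda>)"
      by (intro nn_integral_cong_AE) auto
    then have "(\<integral>\<^sup>+\<eta>. indicator {\<eta>. \<not> D \<eta>} \<eta> \<partial>P) = 0" by (subst int) auto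
    then have "AE \<eta> in P. indicator {\<eta>. \<not> D \<eta>} \<eta> = (0::ennreal)"
      by (subst (asm) nn_integral_0_iff_AE) auto
    then show ?thesis by eventually_elim (auto split: split_indicator_asm)
  qed
  from prob sP gnz ae show ?thesis by (rule that)
qed

end

subsection \<open>Domination by Poisson measures\<close>

text \<open>The Mecke equation of the Poisson process, weakened to an inequality. An intensity of at
  most 1 implies it, and it no longer mentions the interaction.\<close>

definition sub_mecke :: "'a::polish_space measure \<Rightarrow> 'a measure measure \<Rightarrow> bool" where
  "sub_mecke mu P \<longleftrightarrow> (\<forall>F\<in>borel_measurable (borel \<Otimes>\<^sub>M N_sigma).
     (\<integral>\<^sup>+\<eta>. (\<integral>\<^sup>+x. F (x, \<eta>) \<partial>\<eta>) \<partial>P) \<le> (\<integral>\<^sup>+x. (\<integral>\<^sup>+\<eta>. F (x, add_point \<eta> x) \<partial>P) \<partial>mu))"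

lemma restr_null:
  assumes "\<eta> \<in> N_space" "B \<in> sets borel" "emeasure \<eta> B = 0"
  shows "restr B \<eta> = null_measure borel"
proof (rule measure_eqI)
  fix A assume "A \<in> sets (restr B \<eta>)"
  then have A: "A \<in> sets borel" using assms by simp
  have "emeasure \<eta> (A \<inter> B) \<le> emeasure \<eta> B" using assms by (intro emeasure_mono) auto
  then show "emeasure (restr B \<eta>) A = emeasure (null_measure borel) A"
    using assms A by (simp add: emeasure_restr)
qed (use assms in simp)

context boundedly_finite
begin

lemma papangelou_poisson: "papangelou mu (\<lambda>_ _. 1)"
  by unfold_locales auto

text \<open>Intensity constantly 1 means no interaction. Without normalisation this is a finite
  measure but in general not a probability measure, which suffices for domination.\<close>

abbreviation poisson :: "'a set \<Rightarrow> 'a measure measure" where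
  "poisson \<equiv> papangelou.grand_canonical mu (\<lambda>_ _. 1)"

text \<open>Removing the points in \<open>B\<close> one at a time: each of n + 1 points can be the
  removed one, so a removal gains a factor 1/(n+1) and all of them together 1/n!. The first argument
  of \<open>G\<close> sees only the exterior of \<open>B\<close>, which no removal touches, so the
  domination is conditional on the exterior.\<close>

lemma sub_mecke_domination_layer:
  assumes P: "prob_space P" and sP[measurable_cong]: "sets P = sets N_sigma" and sub: "sub_mecke mu P"
    and B[measurable]: "B \<in> sets borel" "bounded B" and G: "G \<in> borel_measurable (N_sigma \<Otimes>\<^sub>M N_sigma)"
  shows "(\<integral>\<^sup>+\<eta>. G (restr (-B) \<eta>, restr B \<eta>) * (if emeasure \<eta> B = of_nat n then 1 else 0) \<partial>P) \<le>
    ennreal (1 / fact n) * (\<integral>\<^sup>+\<eta>. (\<integral>\<^sup>+\<zeta>. G (restr (-B) \<eta>, \<zeta>) \<partial>papangelou.layer mu (\<lambda>_ _. 1) B n) \<partial>P)"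
  using G
proof (induction n arbitrary: G)
  interpret poisson: papangelou mu "\<lambda>_ _. 1" by (rule papangelou_poisson)
  interpret P: prob_space P by fact
  have spP: "space P = N_space" using sets_eq_imp_space_eq[OF sP] by simp
  {
    case 0
    note [measurable] = 0
    have "(\<integral>\<^sup>+\<zeta>. G (restr (-B) \<eta>, \<zeta>) \<partial>poisson.layer B 0) = G (restr (-B) \<eta>, null_measure borel)"
      if "\<eta> \<in> N_space" for \<eta>
    proof (rule poisson.nn_integral_layer_0)
      have "restr (-B) \<eta> \<in> space N_sigma" using that B by simp
      then show "(\<lambda>\<zeta>. G (restr (-B) \<eta>, \<zeta>)) \<in> borel_measurable N_sigma" by measurable
    qed
    then show ?case
      by (intro ord_le_eq_trans[OF nn_integral_mono[of _ _ "\<lambda>\<eta>. \<integral>\<^sup>+\<zeta>. G (restr (-B) \<eta>, \<zeta>) \<partial>poisson.layer B 0"]])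
        (auto simp: restr_null spP simp del: poisson.layer.simps)
  next
    case (Suc n)
    note G[measurable] = Suc.prems
    interpret layer: finite_measure "poisson.layer B n" by (rule poisson.finite_measure_layer) fact+
    interpret pair: pair_sigma_finite P mu ..
    interpret pair2: pair_sigma_finite "poisson.layer B n" mu ..
    let ?g = "\<lambda>\<eta>. G (restr (-B) \<eta>, restr B \<eta>) * (if emeasure \<eta> B = of_nat (Suc n) then 1 else 0)"
    \<comment> \<open>Marks a point in \<open>B\<close>: integrating \<open>?F\<close> over the
      configuration multiplies \<open>?g\<close> by the number of points in \<open>B\<close>, which
      is \<open>Suc n\<close> wherever \<open>?g\<close> does not vanish.\<close>
    let ?F = "\<lambda>(x, \<eta>). indicator B x * ?g \<eta>"
    let ?L = "\<integral>\<^sup>+\<eta>. ?g \<eta> \<partial>P"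
    let ?Y = "\<integral>\<^sup>+\<eta>. (\<integral>\<^sup>+\<zeta>. G (restr (-B) \<eta>, \<zeta>) \<partial>poisson.layer B (Suc n)) \<partial>P"
    have F: "?F \<in> borel_measurable (borel \<Otimes>\<^sub>M N_sigma)" by measurable
    have "of_nat (Suc n) * ?L = (\<integral>\<^sup>+\<eta>. of_nat (Suc n) * ?g \<eta> \<partial>P)"
      by (rule nn_integral_cmult[symmetric]) measurable
    also have "\<dots> = (\<integral>\<^sup>+\<eta>. (\<integral>\<^sup>+x. ?F (x, \<eta>) \<partial>\<eta>) \<partial>P)"
    proof (rule nn_integral_cong)
      fix \<eta> assume "\<eta> \<in> space P"
      then have [simp]: "\<eta> \<in> N_space" by (simp add: spP)
      have "(\<integral>\<^sup>+x. ?F (x, \<eta>) \<partial>\<eta>) = ?g \<eta> * (\<integral>\<^sup>+x. indicator B x \<partial>\<eta>)"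
        by (subst nn_integral_cmult[symmetric]) (auto simp: mult.commute cong: measurable_cong_sets)
      then show "of_nat (Suc n) * ?g \<eta> = (\<integral>\<^sup>+x. ?F (x, \<eta>) \<partial>\<eta>)"
        by (simp add: mult.commute)
    qed
    also have "\<dots> \<le> (\<integral>\<^sup>+x. (\<integral>\<^sup>+\<eta>. ?F (x, add_point \<eta> x) \<partial>P) \<partial>mu)"
      using sub F unfolding sub_mecke_def by blast
    also have "\<dots> \<le> (\<integral>\<^sup>+x. ennreal (1 / fact n) * (\<integral>\<^sup>+\<eta>. (\<integral>\<^sup>+\<zeta>. indicator B x * G (restr (-B) \<eta>, add_point \<zeta> x) \<partial>poisson.layer B n) \<partial>P) \<partial>mu)"
    proof (rule nn_integral_mono)
      fix x :: 'a
      have [measurable]: "(\<lambda>p. indicator B x * G (fst p, add_point (snd p) x)) \<in> borel_measurable (N_sigma \<Otimes>\<^sub>M N_sigma)"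
        by measurable
      have suc: "(emeasure (add_point \<eta> x) B = of_nat (Suc n)) = (emeasure \<eta> B = of_nat n)" if h: "\<eta> \<in> N_space" "x \<in> B" for \<eta>
      proof -
        obtain k :: nat where k: "emeasure \<eta> B = of_nat k" using N_space_nat[OF h(1) B] .
        have "emeasure (add_point \<eta> x) B = of_nat (Suc k)"
          using h B by (simp add: emeasure_add_point k add.commute)
        then show ?thesis by (simp only: k of_nat_eq_iff) simp
      qed
      have "(\<integral>\<^sup>+\<eta>. ?F (x, add_point \<eta> x) \<partial>P) = (\<integral>\<^sup>+\<eta>. (indicator B x * G (restr (-B) \<eta>, add_point (restr B \<eta>) x)) *
          (if emeasure \<eta> B = of_nat n then 1 else 0) \<partial>P)"
      proof (rule nn_integral_cong)
        fix \<eta> assume "\<eta> \<in> space P"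
        then have "\<eta> \<in> N_space" by (simp add: spP)
        then show "?F (x, add_point \<eta> x) = (indicator B x * G (restr (-B) \<eta>, add_point (restr B \<eta>) x)) *
          (if emeasure \<eta> B = of_nat n then 1 else 0)"
          using B by (cases "x \<in> B") (simp_all only: suc restr_add_point split_conv indicator_simps, auto simp: restr_add_point)
      qed
      also have "\<dots> \<le> ennreal (1 / fact n) * (\<integral>\<^sup>+\<eta>. (\<integral>\<^sup>+\<zeta>. indicator B x * G (restr (-B) \<eta>, add_point \<zeta> x) \<partial>poisson.layer B n) \<partial>P)"
        using Suc.IH[of "\<lambda>p. indicator B x * G (fst p, add_point (snd p) x)"] by simp
      finally show "(\<integral>\<^sup>+\<eta>. ?F (x, add_point \<eta> x) \<partial>P) \<le> \<dots>" .
    qed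
    also have "\<dots> = ennreal (1 / fact n) * (\<integral>\<^sup>+x. (\<integral>\<^sup>+\<eta>. (\<integral>\<^sup>+\<zeta>. indicator B x * G (restr (-B) \<eta>, add_point \<zeta> x) \<partial>poisson.layer B n) \<partial>P) \<partial>mu)"
      by (rule nn_integral_cmult) measurable
    also have "(\<integral>\<^sup>+x. (\<integral>\<^sup>+\<eta>. (\<integral>\<^sup>+\<zeta>. indicator B x * G (restr (-B) \<eta>, add_point \<zeta> x) \<partial>poisson.layer B n) \<partial>P) \<partial>mu) =
        (\<integral>\<^sup>+\<eta>. (\<integral>\<^sup>+x. (\<integral>\<^sup>+\<zeta>. indicator B x * G (restr (-B) \<eta>, add_point \<zeta> x) \<partial>poisson.layer B n) \<partial>mu) \<partial>P)"
      by (rule pair.Fubini') measurable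
    also have "\<dots> = ?Y"
    proof (rule nn_integral_cong)
      fix \<eta> assume "\<eta> \<in> space P"
      then have [measurable]: "restr (-B) \<eta> \<in> space N_sigma" by (simp add: spP)
      have "(\<integral>\<^sup>+x. (\<integral>\<^sup>+\<zeta>. indicator B x * G (restr (-B) \<eta>, add_point \<zeta> x) \<partial>poisson.layer B n) \<partial>mu) =
          (\<integral>\<^sup>+\<zeta>. (\<integral>\<^sup>+x. indicator B x * G (restr (-B) \<eta>, add_point \<zeta> x) \<partial>mu) \<partial>poisson.layer B n)"
        by (rule pair2.Fubini') measurable
      also have "\<dots> = (\<integral>\<^sup>+\<zeta>. (\<integral>\<^sup>+x. indicator B x * 1 * G (restr (-B) \<eta>, add_point \<zeta> x) \<partial>mu) \<partial>poisson.layer B n)"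
        by simp
      also have "\<dots> = (\<integral>\<^sup>+\<zeta>. G (restr (-B) \<eta>, \<zeta>) \<partial>poisson.layer B (Suc n))"
        by (rule poisson.nn_integral_layer_Suc[symmetric]) measurable
      finally show "(\<integral>\<^sup>+x. (\<integral>\<^sup>+\<zeta>. indicator B x * G (restr (-B) \<eta>, add_point \<zeta> x) \<partial>poisson.layer B n) \<partial>mu) =
         (\<integral>\<^sup>+\<zeta>. G (restr (-B) \<eta>, \<zeta>) \<partial>poisson.layer B (Suc n))" .
    qed
    finally have *: "of_nat (Suc n) * ?L \<le> ennreal (1 / fact n) * ?Y" .
    have "?L = ennreal (1 / real (Suc n)) * (of_nat (Suc n) * ?L)"
      unfolding ennreal_of_nat_eq_real_of_nat mult.assoc[symmetric]
      by (subst ennreal_mult[symmetric]) (auto simp del: of_nat_Suc)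
    also have "\<dots> \<le> ennreal (1 / real (Suc n)) * (ennreal (1 / fact n) * ?Y)"
      using * by (rule mult_left_mono) simp
    also have "\<dots> = ennreal (1 / fact (Suc n)) * ?Y"
      unfolding mult.assoc[symmetric]
      by (subst ennreal_mult[symmetric]) (auto simp del: of_nat_Suc)
    finally show ?case .
  }
qed

text \<open>A bounded \<open>B\<close> holds exactly one number of points, so summing the previous
  bounds over all counts recovers the left-hand side and, on the right, the series that defines
  \<open>poisson B\<close>.\<close>

lemma sub_mecke_domination:
  assumes P: "prob_space P" and sP[measurable_cong]: "sets P = sets N_sigma" and sub: "sub_mecke mu P"
    and B[measurable]: "B \<in> sets borel" "bounded B" and G[measurable]: "G \<in> borel_measurable (N_sigma \<Otimes>\<^sub>M N_sigma)"
  shows "(\<integral>\<^sup>+\<eta>. G (restr (-B) \<eta>, restr B \<eta>) \<partial>P) \<le>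
    (\<integral>\<^sup>+\<eta>. (\<integral>\<^sup>+\<zeta>. G (restr (-B) \<eta>, \<zeta>) \<partial>poisson B) \<partial>P)"
proof -
  interpret poisson: papangelou mu "\<lambda>_ _. 1" by (rule papangelou_poisson)
  interpret P: prob_space P by fact
  have spP: "space P = N_space" using sets_eq_imp_space_eq[OF sP] by simp
  let ?g = "\<lambda>n \<eta>. G (restr (-B) \<eta>, restr B \<eta>) * (if emeasure \<eta> B = of_nat n then 1 else 0)"
  have split: "(\<Sum>n. ?g n \<eta>) = G (restr (-B) \<eta>, restr B \<eta>)" if h: "\<eta> \<in> N_space" for \<eta>
  proof -
    obtain k :: nat where k: "emeasure \<eta> B = of_nat k" using N_space_nat[OF h B] .
    have "(\<Sum>n. ?g n \<eta>) = (\<Sum>n\<in>{k}. ?g n \<eta>)" by (rule suminf_finite) (auto simp: k)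
    then show ?thesis by (simp add: k)
  qed
  have m: "(\<lambda>\<eta>. \<integral>\<^sup>+\<zeta>. G (restr (-B) \<eta>, \<zeta>) \<partial>poisson.layer B n) \<in> borel_measurable P" for n
  proof -
    interpret layer: finite_measure "poisson.layer B n" by (rule poisson.finite_measure_layer) fact+
    show ?thesis by measurable
  qed
  have "(\<integral>\<^sup>+\<eta>. G (restr (-B) \<eta>, restr B \<eta>) \<partial>P) = (\<integral>\<^sup>+\<eta>. (\<Sum>n. ?g n \<eta>) \<partial>P)"
    by (intro nn_integral_cong split[symmetric]) (simp add: spP)
  also have "\<dots> = (\<Sum>n. \<integral>\<^sup>+\<eta>. ?g n \<eta> \<partial>P)" by (rule nn_integral_suminf) measurable
  also have "\<dots> \<le> (\<Sum>n. ennreal (1 / fact n) * (\<integral>\<^sup>+\<eta>. (\<integral>\<^sup>+\<zeta>. G (restr (-B) \<eta>, \<zeta>) \<partial>poisson.layer B n) \<partial>P))"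
    by (intro suminf_le sub_mecke_domination_layer assms) auto
  also have "\<dots> = (\<integral>\<^sup>+\<eta>. (\<Sum>n. ennreal (1 / fact n) * (\<integral>\<^sup>+\<zeta>. G (restr (-B) \<eta>, \<zeta>) \<partial>poisson.layer B n)) \<partial>P)"
    using m by (subst nn_integral_suminf) (auto simp: nn_integral_cmult)
  also have "\<dots> = (\<integral>\<^sup>+\<eta>. (\<integral>\<^sup>+\<zeta>. G (restr (-B) \<eta>, \<zeta>) \<partial>poisson B) \<partial>P)"
  proof (rule nn_integral_cong)
    fix \<eta> assume "\<eta> \<in> space P"
    then have [measurable]: "restr (-B) \<eta> \<in> space N_sigma" by (simp add: spP)
    show "(\<Sum>n. ennreal (1 / fact n) * (\<integral>\<^sup>+\<zeta>. G (restr (-B) \<eta>, \<zeta>) \<partial>poisson.layer B n)) =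
        (\<integral>\<^sup>+\<zeta>. G (restr (-B) \<eta>, \<zeta>) \<partial>poisson B)"
      by (rule poisson.nn_integral_grand_canonical[symmetric]) measurable
  qed
  finally show ?thesis .
qed

section \<open>Shell coordinates and their product reference measure\<close>

abbreviation PiN :: "nat \<Rightarrow> (nat \<Rightarrow> 'a measure) measure" where
  "PiN m \<equiv> PiM {0..<m} (\<lambda>_. N_sigma)"

definition pieces :: "nat \<Rightarrow> 'a measure \<Rightarrow> nat \<Rightarrow> 'a measure" where
  "pieces m \<eta> = (\<lambda>j\<in>{0..<m}. restr (shell j) \<eta>)"

lemma measurable_pieces[measurable]: "pieces m \<in> measurable N_sigma (PiN m)"
  unfolding pieces_def[abs_def] by (rule measurable_restrict) simp

lemma measurable_upd[measurable]:
  "(\<lambda>q. (fst q)(m := snd q)) \<in> measurable (PiN m \<Otimes>\<^sub>M N_sigma) (PiN (Suc m))"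
  by (rule measurable_fun_upd[where J="{0..<m}"]) auto

text \<open>Independent unnormalised Poisson configurations in the shells, built one coordinate at a
  time so that the measure splits as
  \<open>poisson_pieces m \<Otimes>\<^sub>M poisson (shell m)\<close>, the product form that the
  disintegration asks for.\<close>

primrec poisson_pieces :: "nat \<Rightarrow> (nat \<Rightarrow> 'a measure) measure" where
  "poisson_pieces 0 = return (PiN 0) (\<lambda>_. undefined)"
| "poisson_pieces (Suc m) = distr (poisson_pieces m \<Otimes>\<^sub>M poisson (shell m)) (PiN (Suc m)) (\<lambda>q. (fst q)(m := snd q))"

lemma sets_poisson_pieces[simp, measurable_cong]: "sets (poisson_pieces m) = sets (PiN m)"
  by (cases m) auto

lemma sets_poisson[simp, measurable_cong]: "sets (poisson B) = sets N_sigma"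
  by (rule papangelou.sets_grand_canonical[OF papangelou_poisson])

lemma finite_poisson_shell: "finite_measure (poisson (shell m))"
  by (rule papangelou.finite_measure_grand_canonical[OF papangelou_poisson]) simp_all

lemma finite_poisson_pieces: "finite_measure (poisson_pieces m)"
proof (induction m)
  case 0
  have "prob_space (poisson_pieces 0)" by (auto intro!: prob_space_return simp: space_PiM)
  then show ?case by (rule prob_space.finite_measure)
next
  case (Suc m)
  interpret pair: pair_sigma_finite "poisson_pieces m" "poisson (shell m)"
    using Suc finite_poisson_shell by (intro pair_sigma_finite.intro finite_measure.axioms(1))
  have "finite_measure (poisson_pieces m \<Otimes>\<^sub>M poisson (shell m))"
    by (rule finite_measure_pair_measure[OF finite_poisson_shell Suc])
  then show ?case unfolding poisson_pieces.simps by (rule finite_measure.finite_measure_distr) measurable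
qed

text \<open>The outermost shell is replaced by its Poisson measure conditionally on the exterior;
  the first \<open>m\<close> pieces belong to that exterior, so the induction hypothesis applies to
  the averaged function.\<close>

lemma pieces_domination:
  assumes P: "prob_space P" and sP[measurable_cong]: "sets P = sets N_sigma" and sub: "sub_mecke mu P"
    and G: "G \<in> borel_measurable (PiN m)"
  shows "(\<integral>\<^sup>+\<eta>. G (pieces m \<eta>) \<partial>P) \<le> (\<integral>\<^sup>+\<omega>. G \<omega> \<partial>poisson_pieces m)"
  using G
proof (induction m arbitrary: G)
  interpret P: prob_space P by fact
  {
    case 0
    have "pieces 0 \<eta> = (\<lambda>_. undefined)" for \<eta> by (simp add: pieces_def restrict_def)
    then show ?case using 0 P.emeasure_space_1 by (simp add: nn_integral_return space_PiM)
  next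
    case (Suc m)
    note G[measurable] = Suc.prems
    interpret R: finite_measure "poisson (shell m)" by (rule finite_poisson_shell)
    have spP: "space P = N_space" using sets_eq_imp_space_eq[OF sP] by simp
    have pm: "pieces m (restr (- shell m) \<eta>) = pieces m \<eta>" if "\<eta> \<in> N_space" for \<eta>
    proof -
      have "restr (shell j) (restr (- shell m) \<eta>) = restr (shell j) \<eta>" if "j < m" for j
      proof -
        have e: "shell j \<inter> - shell m = (shell j :: 'a set)"
          using disjoint_family_onD[OF disjoint_shell, of j m] that by auto
        show ?thesis by (subst restr_restr) (simp_all only: e \<open>\<eta> \<in> N_space\<close>, simp_all)
      qed
      then show ?thesis by (auto simp: pieces_def intro!: restrict_ext)
    qed
    have pS: "pieces (Suc m) \<eta> = (pieces m \<eta>)(m := restr (shell m) \<eta>)" for \<eta>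
      by (auto simp: pieces_def fun_eq_iff)
    let ?H = "\<lambda>q. G ((pieces m (fst q))(m := snd q))"
    have H: "?H \<in> borel_measurable (N_sigma \<Otimes>\<^sub>M N_sigma)"
    proof -
      have "(\<lambda>q. (pieces m (fst q), snd q)) \<in> measurable (N_sigma \<Otimes>\<^sub>M N_sigma) (PiN m \<Otimes>\<^sub>M N_sigma)" by measurable
      from measurable_compose[OF measurable_compose[OF this measurable_upd] G] show ?thesis by (simp only: fst_conv snd_conv)
    qed
    have Gu[measurable]: "(\<lambda>q. G ((fst q)(m := snd q))) \<in> borel_measurable (PiN m \<Otimes>\<^sub>M N_sigma)"
      by (rule measurable_compose[OF measurable_upd G])
    have "(\<integral>\<^sup>+\<eta>. G (pieces (Suc m) \<eta>) \<partial>P) = (\<integral>\<^sup>+\<eta>. ?H (restr (- shell m) \<eta>, restr (shell m) \<eta>) \<partial>P)"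
      by (intro nn_integral_cong) (simp add: pS pm spP)
    also have "\<dots> \<le> (\<integral>\<^sup>+\<eta>. (\<integral>\<^sup>+\<zeta>. ?H (restr (- shell m) \<eta>, \<zeta>) \<partial>poisson (shell m)) \<partial>P)"
      by (rule sub_mecke_domination[OF P sP sub _ _ H]) simp_all
    also have "\<dots> = (\<integral>\<^sup>+\<eta>. (\<integral>\<^sup>+\<zeta>. G ((pieces m \<eta>)(m := \<zeta>)) \<partial>poisson (shell m)) \<partial>P)"
      by (intro nn_integral_cong) (simp add: pm spP)
    also have "\<dots> \<le> (\<integral>\<^sup>+w. (\<integral>\<^sup>+\<zeta>. G (w(m := \<zeta>)) \<partial>poisson (shell m)) \<partial>poisson_pieces m)"
    proof (rule Suc.IH)
      have "(\<lambda>w. \<integral>\<^sup>+\<zeta>. G ((fst (w, \<zeta>))(m := snd (w, \<zeta>))) \<partial>poisson (shell m)) \<in> borel_measurable (PiN m)"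
        using Gu by measurable
      then show "(\<lambda>w. \<integral>\<^sup>+\<zeta>. G (w(m := \<zeta>)) \<partial>poisson (shell m)) \<in> borel_measurable (PiN m)" by simp
    qed
    also have "\<dots> = (\<integral>\<^sup>+q. G ((fst q)(m := snd q)) \<partial>(poisson_pieces m \<Otimes>\<^sub>M poisson (shell m)))"
      by (subst R.nn_integral_fst[symmetric]) simp_all
    also have "\<dots> = (\<integral>\<^sup>+\<omega>. G \<omega> \<partial>poisson_pieces (Suc m))"
      unfolding poisson_pieces.simps by (subst nn_integral_distr) simp_all
    finally show ?case .
  }
qed


text \<open>The shell laws have a reference measure that does not depend on \<open>n\<close>, so
  they converge along \<open>U\<close> for each number of shells; the consistent limits extend to
  the full product and are glued back to one configuration. Only bounded functions of a window are
  known to converge.\<close>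

lemma local_limit:
  fixes P :: "nat \<Rightarrow> 'a measure measure"
  assumes U: "ultra U" and P: "\<And>n. prob_space (P n)" and sP[measurable_cong]: "\<And>n. sets (P n) = sets N_sigma"
    and sub: "\<And>n. sub_mecke mu (P n)"
  obtains Q where "prob_space Q" "sets Q = sets N_sigma"
    and "\<And>G K m. G \<in> borel_measurable N_sigma \<Longrightarrow> (\<And>\<eta>. \<eta> \<in> N_space \<Longrightarrow> G \<eta> \<le> ennreal K) \<Longrightarrow>
      (\<And>\<eta>. \<eta> \<in> N_space \<Longrightarrow> G (restr (window m) \<eta>) = G \<eta>) \<Longrightarrow>
      ((\<lambda>n. \<integral>\<^sup>+\<eta>. G \<eta> \<partial>P n) \<longlongrightarrow> (\<integral>\<^sup>+\<eta>. G \<eta> \<partial>Q)) U"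
proof -
  have U0: "U \<noteq> bot" using U by (simp add: ultra_def)
  have spP: "space (P n) = N_space" for n using sets_eq_imp_space_eq[OF sP] by simp
  let ?l = "\<lambda>m n. distr (P n) (PiN m) (pieces m)"
  have dom: "emeasure (?l m n) A \<le> emeasure (poisson_pieces m) A" if "A \<in> sets (PiN m)" for m n A
  proof -
    have [measurable]: "A \<in> sets (PiN m)" by fact
    have "emeasure (?l m n) A = (\<integral>\<^sup>+\<omega>. indicator A \<omega> \<partial>?l m n)" by simp
    also have "\<dots> = (\<integral>\<^sup>+\<eta>. indicator A (pieces m \<eta>) \<partial>P n)"
      by (rule nn_integral_distr) simp_all
    also have "\<dots> \<le> (\<integral>\<^sup>+\<omega>. indicator A \<omega> \<partial>poisson_pieces m)"
      by (rule pieces_domination[OF P sP sub]) simp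
    finally show ?thesis by simp
  qed
  have "\<exists>L. sets L = sets (poisson_pieces m) \<and>
     (\<forall>A\<in>sets (poisson_pieces m). ((\<lambda>n. emeasure (?l m n) A) \<longlongrightarrow> emeasure L A) U)" for m
  proof -
    obtain L where "sets L = sets (poisson_pieces m)"
      "\<And>A. A \<in> sets (poisson_pieces m) \<Longrightarrow> ((\<lambda>n. emeasure (?l m n) A) \<longlongrightarrow> emeasure L A) U"
      by (rule ultralimit_measure[OF U finite_poisson_pieces, of "?l m" m]) (auto simp: dom)
    then show ?thesis by blast
  qed
  then have "\<forall>m. \<exists>L. sets L = sets (PiN m) \<and> (\<forall>A\<in>sets (PiN m). ((\<lambda>n. emeasure (?l m n) A) \<longlongrightarrow> emeasure L A) U)"
    by simp
  from choice[OF this] obtain L where L0: "\<forall>m. sets (L m) = sets (PiN m) \<and>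
      (\<forall>A\<in>sets (PiN m). ((\<lambda>n. emeasure (?l m n) A) \<longlongrightarrow> emeasure (L m) A) U)" ..
  then have sL[measurable_cong]: "sets (L m) = sets (PiN m)"
    and lim: "A \<in> sets (PiN m) \<Longrightarrow> ((\<lambda>n. emeasure (?l m n) A) \<longlongrightarrow> emeasure (L m) A) U" for m A
    by blast+
  have spL: "space (L m) = space (PiN m)" for m using sL by (rule sets_eq_imp_space_eq)
  have prob_l: "prob_space (?l m n)" for m n
    using P by (rule prob_space.prob_space_distr) simp
  have prob_L: "prob_space (L m)" for m
  proof (rule prob_spaceI)
    have "((\<lambda>n. emeasure (?l m n) (space (PiN m))) \<longlongrightarrow> emeasure (L m) (space (PiN m))) U"
      by (rule lim) simp
    moreover have "emeasure (?l m n) (space (PiN m)) = 1" for n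
      using prob_space.emeasure_space_1[OF prob_l[of n m]] by simp
    ultimately show "emeasure (L m) (space (L m)) = 1"
      using tendsto_unique[OF U0 _ tendsto_const] by (simp add: spL)
  qed
  have L_dom: "emeasure (L m) A \<le> emeasure (poisson_pieces m) A" if "A \<in> sets (PiN m)" for m A
    by (rule tendsto_upperbound[OF lim[OF that]]) (auto simp: dom that U0)
  have res[measurable]: "(\<lambda>\<omega>. restrict \<omega> {0..<m}) \<in> measurable (PiN (Suc m)) (PiN m)" for m
    by (rule measurable_restrict) simp
  have res_pieces: "restrict (pieces (Suc m) \<eta>) {0..<m} = pieces m \<eta>" for m \<eta>
    by (auto simp: pieces_def fun_eq_iff restrict_def)
  have consistent: "L m = distr (L (Suc m)) (PiN m) (\<lambda>\<omega>. restrict \<omega> {0..<m})" for m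
  proof (rule measure_eqI)
    fix A assume "A \<in> sets (L m)"
    then have A[measurable]: "A \<in> sets (PiN m)" by (simp add: sL)
    let ?B = "(\<lambda>\<omega>. restrict \<omega> {0..<m}) -` A \<inter> space (PiN (Suc m))"
    have B: "?B \<in> sets (PiN (Suc m))" by measurable
    have "emeasure (?l (Suc m) n) ?B = emeasure (?l m n) A" for n
    proof -
      have sub: "pieces (Suc m) -` ?B \<inter> space (P n) = pieces m -` A \<inter> space (P n)"
        using measurable_space[OF measurable_pieces[of "Suc m"]] by (auto simp: res_pieces spP)
      have "emeasure (?l (Suc m) n) ?B = emeasure (P n) (pieces (Suc m) -` ?B \<inter> space (P n))"
        by (rule emeasure_distr[OF _ B]) simp
      also have "\<dots> = emeasure (?l m n) A"
        unfolding sub by (rule emeasure_distr[OF _ A, symmetric]) simp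
      finally show ?thesis .
    qed
    then have "emeasure (L m) A = emeasure (L (Suc m)) ?B"
      using tendsto_unique[OF U0 lim[OF A]] lim[OF B] by simp
    also have "\<dots> = emeasure (distr (L (Suc m)) (PiN m) (\<lambda>\<omega>. restrict \<omega> {0..<m})) A"
      by (subst emeasure_distr) (auto simp: spL)
    finally show "emeasure (L m) A = emeasure (distr (L (Suc m)) (PiN m) (\<lambda>\<omega>. restrict \<omega> {0..<m})) A" .
  qed (simp add: sL)
  \<comment> \<open>Separating coordinate \<open>m\<close> from the others undoes the update at
    \<open>m\<close>. A null set of the product thus corresponds to a null set of
    \<open>poisson_pieces (Suc m)\<close>, which dominates \<open>L (Suc m)\<close>.\<close>
  have ac: "absolutely_continuous (poisson_pieces m \<Otimes>\<^sub>M poisson (shell m))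
      (distr (L (Suc m)) (PiN m \<Otimes>\<^sub>M N_sigma) (\<lambda>\<omega>. (restrict \<omega> {0..<m}, \<omega> m)))" (is "absolutely_continuous ?S ?J") for m
    unfolding absolutely_continuous_def
  proof
    have sS: "sets ?S = sets (PiN m \<Otimes>\<^sub>M N_sigma)" by (intro sets_pair_measure_cong) simp_all
    fix A assume "A \<in> null_sets ?S"
    then have A[measurable]: "A \<in> sets (PiN m \<Otimes>\<^sub>M N_sigma)" and A0: "emeasure ?S A = 0" by (auto simp: sS)
    have split[measurable]: "(\<lambda>\<omega>. (restrict \<omega> {0..<m}, \<omega> m)) \<in> measurable (PiN (Suc m)) (PiN m \<Otimes>\<^sub>M N_sigma)"
      by measurable
    let ?B = "(\<lambda>\<omega>. (restrict \<omega> {0..<m}, \<omega> m)) -` A \<inter> space (PiN (Suc m))"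
    have B[measurable]: "?B \<in> sets (PiN (Suc m))" by measurable
    have "emeasure ?J A = emeasure (L (Suc m)) ?B" by (subst emeasure_distr) (auto simp: spL)
    also have "\<dots> \<le> emeasure (poisson_pieces (Suc m)) ?B" by (rule L_dom) fact
    also have "\<dots> = emeasure ?S ((\<lambda>q. (fst q)(m := snd q)) -` ?B \<inter> space ?S)"
      unfolding poisson_pieces.simps by (rule emeasure_distr) simp_all
    also have "\<dots> \<le> emeasure ?S A"
    proof (rule emeasure_mono)
      show "(\<lambda>q. (fst q)(m := snd q)) -` ?B \<inter> space ?S \<subseteq> A"
      proof
        fix q assume q: "q \<in> (\<lambda>q. (fst q)(m := snd q)) -` ?B \<inter> space ?S"
        then have "fst q \<in> space (PiN m)" by (auto simp: sets_eq_imp_space_eq[OF sS] sets_eq_imp_space_eq[OF sets_poisson_pieces] space_pair_measure)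
        then have "restrict ((fst q)(m := snd q)) {0..<m} = fst q"
          by (auto simp: space_PiM PiE_iff extensional_def restrict_def fun_eq_iff)
        with q show "q \<in> A" by auto
      qed
    qed (simp add: sS)
    finally have "emeasure ?J A = 0" using A0 by simp
    then show "A \<in> null_sets ?J" by auto
  qed
  obtain Q0 where Q0: "prob_space Q0" "sets Q0 = sets (PiM UNIV (\<lambda>_. N_sigma :: 'a measure measure))"
    "\<And>m. distr Q0 (PiN m) (\<lambda>\<omega>. restrict \<omega> {0..<m}) = L m"
    by (rule dominated_projective_limit[where M="\<lambda>_. N_sigma" and L=L and S=poisson_pieces and R="\<lambda>m. poisson (shell m)",
        OF sL prob_L consistent finite_poisson_pieces sets_poisson_pieces finite_poisson_shell sets_poisson ac]) blast
  note [measurable_cong] = Q0(2)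
  have spQ0: "\<omega> j \<in> N_space" if "\<omega> \<in> space Q0" for \<omega> j
    using that sets_eq_imp_space_eq[OF Q0(2)] by (auto simp: space_PiM)
  have glue[measurable]: "glue \<in> measurable Q0 N_sigma"
    by (rule measurable_glue) simp
  define Q where "Q = distr Q0 N_sigma glue"
  \<comment> \<open>The shells beyond the first \<open>m\<close> are filled with the empty
    configuration, so that a function of configurations can be evaluated on finitely many pieces; a
    function local to \<open>window m\<close> does not notice.\<close>
  define ext where "ext m \<omega> j = (if j < m then \<omega> j else null_measure borel)" for m :: nat and \<omega> :: "nat \<Rightarrow> 'a measure" and j
  have ext_N: "ext m \<omega> j \<in> N_space" if "\<omega> \<in> space (PiN m)" for \<omega> m j
    using that by (auto simp: ext_def space_PiM PiE_iff)
  have ge[measurable]: "(\<lambda>\<omega>. glue (ext m \<omega>)) \<in> measurable (PiN m) N_sigma" for m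
  proof (rule measurable_glue)
    fix j
    show "(\<lambda>\<omega>. ext m \<omega> j) \<in> measurable (PiN m) N_sigma"
      unfolding ext_def by (cases "j < m") simp_all
  qed
  show ?thesis
  proof (rule that[of Q])
    show "prob_space Q" unfolding Q_def using Q0(1) glue by (rule prob_space.prob_space_distr)
    show "sets Q = sets N_sigma" by (simp add: Q_def)
    fix G :: "'a measure \<Rightarrow> ennreal" and K m
    assume G[measurable]: "G \<in> borel_measurable N_sigma"
      and bd: "\<And>\<eta>. \<eta> \<in> N_space \<Longrightarrow> G \<eta> \<le> ennreal K"
      and loc: "\<And>\<eta>. \<eta> \<in> N_space \<Longrightarrow> G (restr (window m) \<eta>) = G \<eta>"
    let ?g = "\<lambda>\<omega>. G (glue (ext m \<omega>))"
    have "((\<lambda>n. \<integral>\<^sup>+\<omega>. ?g \<omega> \<partial>?l m n) \<longlongrightarrow> (\<integral>\<^sup>+\<omega>. ?g \<omega> \<partial>L m)) U"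
    proof (rule ultralimit_nn_integral[OF U prob_l _ prob_L])
      show "sets (?l m n) = sets (L m)" for n by (simp add: sL)
      show "((\<lambda>n. emeasure (?l m n) A) \<longlongrightarrow> emeasure (L m) A) U" if "A \<in> sets (L m)" for A
        using that by (intro lim) (simp add: sL)
      show "?g \<in> borel_measurable (L m)" by measurable
      show "?g \<omega> \<le> ennreal K" if "\<omega> \<in> space (L m)" for \<omega>
        using that by (intro bd glue_N ext_N) (simp add: spL)
    qed
    moreover have "(\<integral>\<^sup>+\<omega>. ?g \<omega> \<partial>?l m n) = (\<integral>\<^sup>+\<eta>. G \<eta> \<partial>P n)" for n
    proof -
      have "(\<integral>\<^sup>+\<omega>. ?g \<omega> \<partial>?l m n) = (\<integral>\<^sup>+\<eta>. ?g (pieces m \<eta>) \<partial>P n)"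
        by (rule nn_integral_distr) simp_all
      also have "\<dots> = (\<integral>\<^sup>+\<eta>. G \<eta> \<partial>P n)"
      proof (rule nn_integral_cong)
        fix \<eta> assume "\<eta> \<in> space (P n)"
        then have \<eta>: "\<eta> \<in> N_space" by (simp add: spP)
        have p: "pieces m \<eta> \<in> space (PiN m)" using measurable_space[OF measurable_pieces] \<eta> by simp
        have g: "glue (ext m (pieces m \<eta>)) \<in> N_space" using p by (intro glue_N ext_N)
        have "restr (window m) (glue (ext m (pieces m \<eta>))) = restr (window m) \<eta>"
        proof (rule measure_eqI)
          fix A assume "A \<in> sets (restr (window m) (glue (ext m (pieces m \<eta>))))"
          then have A[measurable]: "A \<in> sets borel" by simp
          have "emeasure (restr (window m) (glue (ext m (pieces m \<eta>)))) A = (\<Sum>j<m. emeasure (ext m (pieces m \<eta>) j) (A \<inter> window m \<inter> shell j))"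
            using g A ext_N[OF p] by (simp add: emeasure_restr emeasure_glue_window)
          also have "\<dots> = (\<Sum>j<m. emeasure \<eta> (A \<inter> shell j))"
          proof (rule sum.cong)
            fix j assume "j \<in> {..<m}"
            then have j: "j < m" by simp
            then have "A \<inter> window m \<inter> shell j \<inter> shell j = A \<inter> shell j"
              using UN_shell[of m, where 'a='a] by auto
            then show "emeasure (ext m (pieces m \<eta>) j) (A \<inter> window m \<inter> shell j) = emeasure \<eta> (A \<inter> shell j)"
              using j \<eta> A by (simp add: ext_def pieces_def emeasure_restr)
          qed simp
          also have "\<dots> = emeasure \<eta> (\<Union>j<m. A \<inter> shell j)"
            using \<eta> A disjoint_family_on_mono[OF subset_UNIV disjoint_shell, of "{..<m}"]
            by (intro sum_emeasure) (auto simp: disjoint_family_on_def)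
          also have "(\<Union>j<m. A \<inter> shell j) = A \<inter> window m" using UN_shell[of m, where 'a='a] by auto
          finally show "emeasure (restr (window m) (glue (ext m (pieces m \<eta>)))) A = emeasure (restr (window m) \<eta>) A"
            using \<eta> A by (simp add: emeasure_restr)
        qed (use g \<eta> in simp)
        then show "?g (pieces m \<eta>) = G \<eta>" using loc[OF g] loc[OF \<eta>] by simp
      qed
      finally show ?thesis .
    qed
    moreover have "(\<integral>\<^sup>+\<omega>. ?g \<omega> \<partial>L m) = (\<integral>\<^sup>+\<eta>. G \<eta> \<partial>Q)"
    proof -
      have "(\<integral>\<^sup>+\<omega>. ?g \<omega> \<partial>L m) = (\<integral>\<^sup>+\<omega>. ?g (restrict \<omega> {0..<m}) \<partial>Q0)"
        unfolding Q0(3)[symmetric] by (rule nn_integral_distr) measurable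
      also have "\<dots> = (\<integral>\<^sup>+\<omega>. G (glue \<omega>) \<partial>Q0)"
      proof (rule nn_integral_cong)
        fix \<omega> assume \<omega>: "\<omega> \<in> space Q0"
        have g: "glue \<omega> \<in> N_space" using spQ0[OF \<omega>] by (rule glue_N)
        have r: "restrict \<omega> {0..<m} \<in> space (PiN m)" using spQ0[OF \<omega>] by (auto simp: space_PiM)
        have g': "glue (ext m (restrict \<omega> {0..<m})) \<in> N_space" using r by (intro glue_N ext_N)
        have "restr (window m) (glue (ext m (restrict \<omega> {0..<m}))) = restr (window m) (glue \<omega>)"
        proof (rule measure_eqI)
          fix A assume "A \<in> sets (restr (window m) (glue (ext m (restrict \<omega> {0..<m}))))"
          then have A[measurable]: "A \<in> sets borel" by simp
          show "emeasure (restr (window m) (glue (ext m (restrict \<omega> {0..<m})))) A = emeasure (restr (window m) (glue \<omega>)) A"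
            using g g' A ext_N[OF r] spQ0[OF \<omega>]
            by (simp add: emeasure_restr emeasure_glue_window[where m=m]) (simp add: ext_def)
        qed simp
        then show "?g (restrict \<omega> {0..<m}) = G (glue \<omega>)" using loc[OF g] loc[OF g'] by simp
      qed
      also have "\<dots> = (\<integral>\<^sup>+\<eta>. G \<eta> \<partial>Q)"
        unfolding Q_def by (rule nn_integral_distr[symmetric]) measurable
      finally show ?thesis .
    qed
    ultimately show "((\<lambda>n. \<integral>\<^sup>+\<eta>. G \<eta> \<partial>P n) \<longlongrightarrow> (\<integral>\<^sup>+\<eta>. G \<eta> \<partial>Q)) U" by simp
  qed
qed

end

subsection \<open>The Boltzmann factor\<close>

definition exn :: "ennreal \<Rightarrow> ennreal" where
  "exn a = (if a = \<infinity> then 0 else ennreal (exp (- enn2real a)))"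

lemma exn_0[simp]: "exn 0 = 1" and exn_top[simp]: "exn \<top> = 0"
  by (simp_all add: exn_def)

lemma exn_le_1[simp]: "exn a \<le> 1"
  by (simp add: exn_def ennreal_le_1)

lemma exn_add: "exn (a + b) = exn a * exn b"
  by (cases a; cases b) (simp_all add: exn_def ennreal_plus[symmetric] ennreal_mult[symmetric] exp_add[symmetric] del: ennreal_plus)

lemma exn_antimono: "a \<le> b \<Longrightarrow> exn b \<le> exn a"
  by (cases a; cases b) (simp_all add: exn_def top_unique)

lemma measurable_exn[measurable]: "exn \<in> borel_measurable borel"
  unfolding exn_def[abs_def] by measurable

text \<open>Only the limit at infinity needs care. It does occur: hard cores and diverging energies
  give infinite interaction.\<close>

lemma tendsto_exn:
  assumes "((a :: nat \<Rightarrow> ennreal) \<longlongrightarrow> l) sequentially"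
  shows "(\<lambda>i. exn (a i)) \<longlonglongrightarrow> exn l"
proof (cases "l = \<infinity>")
  case False
  then have ev: "eventually (\<lambda>i. a i < \<infinity>) sequentially"
    using order_tendstoD(2)[OF assms, of \<infinity>] by (simp add: less_top)
  have "(\<lambda>i. enn2real (a i)) \<longlonglongrightarrow> enn2real l"
    using assms False by (intro tendsto_enn2real) (auto simp: less_top)
  then have "(\<lambda>i. ennreal (exp (- enn2real (a i)))) \<longlonglongrightarrow> ennreal (exp (- enn2real l))"
    by (intro tendsto_ennrealI tendsto_exp tendsto_minus)
  moreover have "eventually (\<lambda>i. ennreal (exp (- enn2real (a i))) = exn (a i)) sequentially"
    using ev by eventually_elim (simp add: exn_def)
  ultimately have "(\<lambda>i. exn (a i)) \<longlonglongrightarrow> ennreal (exp (- enn2real l))" by (rule Lim_transform_eventually)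
  then show ?thesis using False by (simp add: exn_def)
next
  case True
  show ?thesis
  proof (rule order_tendstoI)
    fix e assume "exn l < e"
    then have "0 < e" by (simp add: True)
    obtain r where r: "0 < r" "ennreal r \<le> e"
    proof (cases e)
      case (real r) then show ?thesis using \<open>0 < e\<close> by (intro that[of r]) auto
    next
      case top then show ?thesis by (intro that[of 1]) auto
    qed
    \<comment> \<open>The maximum keeps \<open>M\<close> nonnegative, as needed to read it as an
      \<open>ennreal\<close>, and the added 1 makes \<open>exp (- M) < r\<close> strict.\<close>
    define M where "M = max 0 (- ln r) + 1"
    have "0 \<le> M" by (simp add: M_def)
    have "exp (- M) < exp (ln r)" by (simp add: M_def)
    then have "exp (- M) < r" using r by simp
    have "eventually (\<lambda>i. ennreal M < a i) sequentially"
      using order_tendstoD(1)[OF assms, of "ennreal M"] by (simp add: True)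
    then show "eventually (\<lambda>i. exn (a i) < e) sequentially"
    proof eventually_elim
      fix i assume "ennreal M < a i"
      then have "exn (a i) \<le> exn (ennreal M)" by (intro exn_antimono) simp
      also have "\<dots> = ennreal (exp (- M))" using \<open>0 \<le> M\<close> by (simp add: exn_def)
      also have "\<dots> < ennreal r" using \<open>exp (- M) < r\<close> by (simp add: ennreal_lessI r)
      finally show "exn (a i) < e" using r(2) by simp
    qed
  qed (simp add: True)
qed

lemma ennreal_add_diff_1: "(e :: ennreal) \<le> 1 \<Longrightarrow> e + (1 - e) = 1"
  by (rule add_diff_inverse_ennreal)

subsection \<open>Local events\<close>

text \<open>Being determined by the window is expressed as invariance under restriction, which
  avoids a family of sub-sigma-algebras.\<close>

definition local_event :: "nat \<Rightarrow> 'a::polish_space measure set \<Rightarrow> bool" where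
  "local_event m A \<longleftrightarrow> A \<in> sets N_sigma \<and> (\<forall>\<eta>\<in>N_space. restr (window m) \<eta> \<in> A \<longleftrightarrow> \<eta> \<in> A)"

lemma restr_window_window:
  assumes "\<eta> \<in> N_space" "m \<le> k"
  shows "restr (window m) (restr (window k) \<eta>) = restr (window m) \<eta>"
proof -
  have "window m \<inter> window k = (window m :: 'a set)" using window_mono[OF assms(2)] by auto
  then show ?thesis using assms by (subst restr_restr) simp_all
qed

lemma local_event_mono:
  assumes "local_event m A" "m \<le> k" shows "local_event k A"
  unfolding local_event_def
proof (intro conjI ballI)
  show "A \<in> sets N_sigma" using assms by (simp add: local_event_def)
  fix \<eta> :: "'a measure" assume \<eta>: "\<eta> \<in> N_space"
  then have "restr (window k) \<eta> \<in> N_space" by simp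
  then have "restr (window k) \<eta> \<in> A \<longleftrightarrow> restr (window m) (restr (window k) \<eta>) \<in> A"
    using assms by (simp add: local_event_def)
  also have "\<dots> \<longleftrightarrow> \<eta> \<in> A"
    using assms \<eta> by (simp add: local_event_def restr_window_window)
  finally show "restr (window k) \<eta> \<in> A \<longleftrightarrow> \<eta> \<in> A" .
qed

lemma local_event_Int: "local_event m A \<Longrightarrow> local_event m B \<Longrightarrow> local_event m (A \<inter> B)"
  by (auto simp: local_event_def)

lemma local_event_count:
  assumes "B \<in> sets borel" "B \<subseteq> window m" "X \<in> sets borel"
  shows "local_event m {\<eta>\<in>N_space. emeasure \<eta> B \<in> X}"
proof -
  have "(\<lambda>\<eta>. emeasure \<eta> B) -` X \<inter> space N_sigma \<in> sets N_sigma"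
    using assms by (intro measurable_sets[OF measurable_emeasure_config])
  moreover have "(\<lambda>\<eta>. emeasure \<eta> B) -` X \<inter> space N_sigma = {\<eta>\<in>N_space. emeasure \<eta> B \<in> X}" by auto
  moreover have "B \<inter> window m = B" using assms by auto
  ultimately show ?thesis using assms by (auto simp: local_event_def emeasure_restr)
qed

text \<open>Counting points in a bounded set is local to any window that contains it, and such
  counts generate.\<close>

lemma sets_N_sigma_local: "sets N_sigma = sigma_sets N_space {A. \<exists>m. local_event m A}"
proof
  show "sigma_sets N_space {A. \<exists>m. local_event m A} \<subseteq> sets (N_sigma :: 'a measure measure)"
    using sets.sigma_sets_subset[of "{A. \<exists>m. local_event m A}" "N_sigma :: 'a measure measure"]
    by (auto simp: local_event_def)
  show "sets (N_sigma :: 'a measure measure) \<subseteq> sigma_sets N_space {A. \<exists>m. local_event m A}"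
    unfolding sets_N_sigma
  proof (rule sigma_sets_mono', safe)
    fix B :: "'a set" and X :: "ennreal set" assume B: "B \<in> sets borel" "bounded B" "X \<in> sets borel"
    obtain m where "B \<subseteq> window m" using bounded_subset_window[OF B(2)] ..
    then show "\<exists>m. local_event m {\<eta>\<in>N_space. emeasure \<eta> B \<in> X}"
      using B by (intro exI[of _ m] local_event_count)
  qed
qed

lemma local_event_N_space: "local_event m N_space"
  by (simp add: local_event_def)

subsection \<open>A uniqueness principle for measures on marked configurations\<close>

text \<open>Products of a bounded set and a local event form an intersection-stable generator. The
  bound \<open>K\<close> in \<open>eq\<close> confines the check to events with boundedly many
  points in the window, because local limits are available for bounded functions only;
  sigma-finiteness is asked of \<open>M\<close> alone.\<close>

lemma config_measure_eqI:
  fixes M N :: "('a::polish_space \<times> 'a measure) measure"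
  assumes sets: "sets M = sets (borel \<Otimes>\<^sub>M N_sigma)" "sets N = sets (borel \<Otimes>\<^sub>M N_sigma)"
    and fin: "\<And>m. emeasure M (window m \<times> N_space) < \<infinity>"
    and eq: "\<And>m B A K. B \<in> sets borel \<Longrightarrow> B \<subseteq> window m \<Longrightarrow> local_event m A \<Longrightarrow>
      A \<subseteq> {\<eta>. emeasure \<eta> (window m) \<le> ennreal K} \<Longrightarrow> emeasure M (B \<times> A) = emeasure N (B \<times> A)"
  shows "M = N"
proof -
  let ?E1 = "{B::'a set. B \<in> sets borel \<and> bounded B}" and ?E2 = "{A::'a measure set. \<exists>m. local_event m A}"
  let ?E = "{a \<times> b | a b. a \<in> ?E1 \<and> b \<in> ?E2}"
  have E1: "sets borel = sigma_sets UNIV ?E1"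
  proof
    show "sigma_sets UNIV ?E1 \<subseteq> sets borel"
      using sets.sigma_sets_subset[of ?E1 borel] by auto
    show "sets borel \<subseteq> sigma_sets UNIV ?E1"
    proof
      fix B :: "'a set" assume B: "B \<in> sets borel"
      have "B \<inter> window n \<in> sigma_sets UNIV ?E1" for n
        using B bounded_subset[OF bounded_window[of n], of "B \<inter> window n"] by (intro sigma_sets.Basic) auto
      then have "(\<Union>n. B \<inter> window n) \<in> sigma_sets UNIV ?E1" by (rule sigma_sets.Union)
      also have "(\<Union>n. B \<inter> window n) = B" using UN_window by auto
      finally show "B \<in> sigma_sets UNIV ?E1" .
    qed
  qed
  have sub2: "b \<subseteq> N_space" if "local_event m b" for m and b :: "'a measure set"
    using that sets.sets_into_space[of b N_sigma] by (simp add: local_event_def)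
  have sub: "?E \<subseteq> Pow (UNIV \<times> N_space)" using sub2 by fastforce
  have "sets (borel \<Otimes>\<^sub>M (N_sigma :: 'a measure measure)) = sets (sigma (space borel \<times> space N_sigma) ?E)"
  proof (rule sets_pair_eq[of _ _ "range window" _ _ "{N_space}"])
    show "?E2 \<subseteq> Pow (space N_sigma)" using sub2 by fastforce
    show "sets N_sigma = sigma_sets (space N_sigma) ?E2" using sets_N_sigma_local by simp
    show "{N_space} \<subseteq> ?E2" using local_event_N_space by auto
    show "sets borel = sigma_sets (space borel) ?E1" using E1 by (simp only: space_borel)
    show "\<Union> (range window) = (space borel :: 'a set)" by (simp add: UN_window)
  qed auto
  also have "\<dots> = sigma_sets (UNIV \<times> N_space) ?E" using sub by (simp add: sets_measure_of)
  finally have gen: "sets (borel \<Otimes>\<^sub>M (N_sigma :: 'a measure measure)) = sigma_sets (UNIV \<times> N_space) ?E" .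
  show ?thesis
  proof (rule measure_eqI_generator_eq[where E="?E" and \<Omega>="UNIV \<times> N_space" and A="\<lambda>n. window n \<times> N_space"])
    show "Int_stable ?E"
    proof (rule Int_stableI)
      fix X Y assume "X \<in> ?E" "Y \<in> ?E"
      then obtain a b m a' b' m' where X: "X = a \<times> b" "a \<in> ?E1" "local_event m b"
        and Y: "Y = a' \<times> b'" "a' \<in> ?E1" "local_event m' b'" by auto
      have "X \<inter> Y = (a \<inter> a') \<times> (b \<inter> b')" by (auto simp: X Y)
      moreover have "a \<inter> a' \<in> ?E1" using X Y by (auto intro: bounded_subset)
      moreover have "local_event (max m m') (b \<inter> b')"
        using X(3) Y(3) by (intro local_event_Int) (auto elim: local_event_mono)
      ultimately show "X \<inter> Y \<in> ?E" by blast
    qed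
    show "?E \<subseteq> Pow (UNIV \<times> N_space)" by fact
    show "sets M = sigma_sets (UNIV \<times> N_space) ?E" "sets N = sigma_sets (UNIV \<times> N_space) ?E"
      using sets gen by simp_all
    show "range (\<lambda>n. window n \<times> N_space) \<subseteq> ?E" using local_event_N_space by fastforce
    show "(\<Union>n. window n \<times> N_space) = (UNIV :: 'a set) \<times> N_space" using UN_window by auto
    show "emeasure M (window i \<times> N_space) \<noteq> \<infinity>" for i using fin[of i] by simp
    fix X assume "X \<in> ?E"
    then obtain B A m' where X: "X = B \<times> A" "B \<in> sets borel" "bounded B" "local_event m' A" by auto
    obtain m'' where m'': "B \<subseteq> window m''" using bounded_subset_window[OF X(3)] ..
    define m where "m = max m' m''"
    have B: "B \<subseteq> window m" using m'' window_mono[of m'' m] by (auto simp: m_def)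
    have A: "local_event m A" using X(4) by (rule local_event_mono) (simp add: m_def)
    \<comment> \<open>Counts in a window are finite, so these events with at most \<open>K\<close>
      points exhaust \<open>A\<close>; monotone limits then remove the bound.\<close>
    define D where "D K = A \<inter> {\<eta>\<in>N_space. emeasure \<eta> (window m) \<in> {..ennreal (real K)}}" for K :: nat
    have D: "local_event m (D K)" for K
      unfolding D_def by (intro local_event_Int A local_event_count) auto
    have DS[measurable]: "D K \<in> sets N_sigma" for K using D by (simp add: local_event_def)
    have inc: "incseq (\<lambda>K. B \<times> D K)"
      by (auto simp: incseq_def D_def elim: order_trans intro: ennreal_leI)
    have UD: "(\<Union>K. B \<times> D K) = B \<times> A"
    proof -
      have "\<exists>K::nat. emeasure \<eta> (window m) \<le> ennreal (real K)" if "\<eta> \<in> A" for \<eta>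
      proof -
        have "\<eta> \<in> N_space" using that sub2[OF A] by auto
        from N_space_nat[OF this window_sets bounded_window] obtain k :: nat where "emeasure \<eta> (window m) = of_nat k" .
        then show ?thesis by (intro exI[of _ k]) (simp add: ennreal_of_nat_eq_real_of_nat)
      qed
      then show ?thesis using sub2[OF A] by (fastforce simp: D_def)
    qed
    have rM: "range (\<lambda>K. B \<times> D K) \<subseteq> sets (borel \<Otimes>\<^sub>M N_sigma)" using X(2) by auto
    have "emeasure M (B \<times> D K) = emeasure N (B \<times> D K)" for K
      by (rule eq[OF X(2) B D, of K "real K"]) (auto simp: D_def)
    then have "(SUP K. emeasure M (B \<times> D K)) = (SUP K. emeasure N (B \<times> D K))" by simp
    then show "emeasure M X = emeasure N X"
      using rM inc by (simp add: SUP_emeasure_incseq sets UD X(1))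
  qed
qed

subsection \<open>Passing to the infinite-volume limit\<close>

text \<open>\<open>w\<close> stands for the positive part of the potential, so energies are
  integrals of nonnegative functions without cancellation, and \<open>1 - exn (w x y)\<close> is the
  absolute value of the Mayer function.\<close>

locale repulsive_pair = boundedly_finite mu for mu :: "'a::polish_space measure" +
  fixes w :: "'a \<Rightarrow> 'a \<Rightarrow> ennreal"
  assumes w_pair: "(\<lambda>(x, y). w x y) \<in> borel_measurable (borel \<Otimes>\<^sub>M borel)"
    and w_sym: "\<And>x y. w x y = w y x"
    and w_int: "AE x in mu. (\<integral>\<^sup>+y. (1 - exn (w x y)) \<partial>mu) < \<infinity>"
begin

lemma w_measurable[measurable (raw)]:
  assumes [measurable]: "f \<in> measurable M borel" "g \<in> measurable M borel"
  shows "(\<lambda>q. w (f q) (g q)) \<in> borel_measurable M"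
  using measurable_compose[OF _ w_pair, of "\<lambda>q. (f q, g q)"] by simp

text \<open>\<open>S\<close> is the cutoff: only points in \<open>S\<close> interact with
  \<open>x\<close>. With \<open>S\<close> a window the factor is local, and the complement of the
  window carries the error of the cut.\<close>

definition boltzmann :: "'a set \<Rightarrow> 'a \<Rightarrow> 'a measure \<Rightarrow> ennreal" where
  "boltzmann S x \<eta> = exn (\<integral>\<^sup>+y. indicator S y * w x y \<partial>\<eta>)"

lemma boltzmann_le_1[simp]: "boltzmann S x \<eta> \<le> 1"
  by (simp add: boltzmann_def)

lemma measurable_boltzmann[measurable (raw)]:
  assumes S[measurable]: "S \<in> sets borel" and f[measurable]: "f \<in> measurable M borel" and g: "g \<in> measurable M N_sigma"
  shows "(\<lambda>q. boltzmann S (f q) (g q)) \<in> borel_measurable M"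
proof -
  have "(\<lambda>q. \<integral>\<^sup>+y. (\<lambda>(q, y). indicator S y * w (f q) y) (q, y) \<partial>g q) \<in> borel_measurable M"
    by (rule measurable_nn_integral_config[OF _ g]) measurable
  then show ?thesis unfolding boltzmann_def by simp
qed

lemma boltzmann_add_point:
  assumes "\<eta> \<in> N_space" and [measurable]: "S \<in> sets borel"
  shows "boltzmann S x (add_point \<eta> y) = boltzmann S x \<eta> * (if y \<in> S then exn (w x y) else 1)"
  unfolding boltzmann_def using assms(1) by (subst nn_integral_add_point) (simp_all add: exn_add)

lemma boltzmann_null[simp]: "boltzmann S x (null_measure borel) = 1"
  by (simp add: boltzmann_def)

lemma boltzmann_split:
  assumes "\<eta> \<in> N_space" and [measurable]: "S \<in> sets borel"
  shows "boltzmann UNIV x \<eta> = boltzmann S x \<eta> * boltzmann (-S) x \<eta>"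
proof -
  have "(\<integral>\<^sup>+y. indicator UNIV y * w x y \<partial>\<eta>) = (\<integral>\<^sup>+y. indicator S y * w x y + indicator (-S) y * w x y \<partial>\<eta>)"
    by (intro nn_integral_cong) (simp split: split_indicator)
  also have "\<dots> = (\<integral>\<^sup>+y. indicator S y * w x y \<partial>\<eta>) + (\<integral>\<^sup>+y. indicator (-S) y * w x y \<partial>\<eta>)"
    using assms by (intro nn_integral_add) (simp_all cong: measurable_cong_sets)
  finally show ?thesis by (simp add: boltzmann_def exn_add)
qed

lemma boltzmann_antimono: "S \<subseteq> T \<Longrightarrow> boltzmann T x \<eta> \<le> boltzmann S x \<eta>"
  unfolding boltzmann_def
  by (intro exn_antimono nn_integral_mono mult_right_mono) (auto split: split_indicator)

lemma boltzmann_restr: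
  assumes "\<eta> \<in> N_space" "S \<in> sets borel"
  shows "boltzmann S x (restr S \<eta>) = boltzmann S x \<eta>"
proof -
  note [measurable] = assms(2)
  have "(\<integral>\<^sup>+y. indicator S y * w x y \<partial>restr S \<eta>) = (\<integral>\<^sup>+y. indicator S y * (indicator S y * w x y) \<partial>\<eta>)"
    by (rule nn_integral_restr[OF assms]) measurable
  also have "\<dots> = (\<integral>\<^sup>+y. indicator S y * w x y \<partial>\<eta>)"
    by (intro nn_integral_cong) (simp split: split_indicator)
  finally show ?thesis by (simp add: boltzmann_def)
qed

text \<open>The truncated energies increase to the full one, and \<open>exn\<close> is continuous
  even at an infinite limit.\<close>

lemma tendsto_boltzmann:
  assumes \<eta>: "\<eta> \<in> N_space"
  shows "(\<lambda>k. boltzmann (window k) x \<eta>) \<longlonglongrightarrow> boltzmann UNIV x \<eta>"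
proof -
  have inc: "incseq (\<lambda>k y. indicator (window k) y * w x y)"
    using window_mono by (auto simp: incseq_def le_fun_def split: split_indicator)
  have "(SUP k. \<integral>\<^sup>+y. indicator (window k) y * w x y \<partial>\<eta>) = (\<integral>\<^sup>+y. (SUP k. indicator (window k) y * w x y) \<partial>\<eta>)"
    using \<eta> inc by (intro nn_integral_monotone_convergence_SUP[symmetric]) (simp_all cong: measurable_cong_sets)
  also have "\<dots> = (\<integral>\<^sup>+y. indicator UNIV y * w x y \<partial>\<eta>)"
  proof (intro nn_integral_cong antisym)
    fix y :: 'a
    show "(SUP k. indicator (window k) y * w x y) \<le> indicator UNIV y * w x y"
      by (intro SUP_least) (auto split: split_indicator)
    obtain k where "y \<in> window k" using ex_window ..
    then show "indicator UNIV y * w x y \<le> (SUP k. indicator (window k) y * w x y)"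
      by (intro SUP_upper2[of k]) auto
  qed
  finally have "(SUP k. \<integral>\<^sup>+y. indicator (window k) y * w x y \<partial>\<eta>) = (\<integral>\<^sup>+y. indicator UNIV y * w x y \<partial>\<eta>)" .
  moreover have "(\<lambda>k. \<integral>\<^sup>+y. indicator (window k) y * w x y \<partial>\<eta>) \<longlonglongrightarrow> (SUP k. \<integral>\<^sup>+y. indicator (window k) y * w x y \<partial>\<eta>)"
    using inc by (intro LIMSEQ_SUP) (auto simp: incseq_def le_fun_def intro!: nn_integral_mono)
  ultimately show ?thesis unfolding boltzmann_def by (intro tendsto_exn) simp
qed

text \<open>The second of two inserted points picks up the extra factor \<open>exn (w x y)\<close>,
  whichever comes second; symmetry of \<open>w\<close> makes this the cocycle identity.\<close>

lemma papangelou_boltzmann: "papangelou mu (boltzmann UNIV)"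
proof unfold_locales
  show "(\<lambda>(x, \<eta>). boltzmann UNIV x \<eta>) \<in> borel_measurable (borel \<Otimes>\<^sub>M N_sigma)" by measurable
  show "boltzmann UNIV x \<eta> * boltzmann UNIV y (add_point \<eta> x) = boltzmann UNIV y \<eta> * boltzmann UNIV x (add_point \<eta> y)"
    if "\<eta> \<in> N_space" for x y \<eta>
    using that w_sym[of x y] by (simp add: boltzmann_add_point mult_ac)
qed simp

text \<open>The union bound \<open>1 - \<Prod>(1 - f\<^sub>i) \<le> \<Sum> f\<^sub>i\<close> over the points of a configuration, in a form
  that can be propagated along \<^const>\<open>add_point\<close> without enumerating the points.\<close>

lemma union_bound_step:
  assumes \<eta>: "\<eta> \<in> N_space" and S[measurable]: "S \<in> sets borel"
    and le: "1 \<le> boltzmann S x \<eta> + (\<integral>\<^sup>+y. indicator S y * (1 - exn (w x y)) \<partial>\<eta>)"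
  shows "1 \<le> boltzmann S x (add_point \<eta> y') + (\<integral>\<^sup>+y. indicator S y * (1 - exn (w x y)) \<partial>add_point \<eta> y')"
proof -
  let ?a = "boltzmann S x \<eta>" and ?s = "\<integral>\<^sup>+y. indicator S y * (1 - exn (w x y)) \<partial>\<eta>" and ?e = "exn (w x y')"
  have int: "(\<integral>\<^sup>+y. indicator S y * (1 - exn (w x y)) \<partial>add_point \<eta> y') = ?s + indicator S y' * (1 - ?e)"
    using \<eta> by (intro nn_integral_add_point) auto
  show ?thesis
  proof (cases "y' \<in> S")
    case True
    have "?a = ?a * (?e + (1 - ?e))" by (simp add: ennreal_add_diff_1)
    also have "\<dots> = ?a * ?e + ?a * (1 - ?e)" by (simp only: distrib_left)
    also have "\<dots> \<le> ?a * ?e + 1 * (1 - ?e)" by (intro add_left_mono mult_right_mono) simp_all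
    finally have "?a + ?s \<le> ?a * ?e + (?s + (1 - ?e))" by (simp add: add_ac add_left_mono)
    with le have "1 \<le> ?a * ?e + (?s + (1 - ?e))" by (rule order_trans)
    then show ?thesis using True \<eta> by (simp add: int boltzmann_add_point)
  next
    case False
    with le show ?thesis using \<eta> by (simp add: int boltzmann_add_point)
  qed
qed

text \<open>The full Boltzmann factor depends on the whole configuration, so
  \<open>local_limit\<close> does not apply to it. It is squeezed between local quantities at fixed
  cutoff, first the volume and then the cutoff is sent to infinity, and the equation is extended
  from rectangles to all test functions.\<close>

lemma ex_gibbs:
  obtains Q where "prob_space Q" "sets Q = sets N_sigma"
    and "\<And>F. F \<in> borel_measurable (borel \<Otimes>\<^sub>M N_sigma) \<Longrightarrow>
      (\<integral>\<^sup>+\<eta>. (\<integral>\<^sup>+x. F (x, \<eta>) \<partial>\<eta>) \<partial>Q) =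
      (\<integral>\<^sup>+x. (\<integral>\<^sup>+\<eta>. F (x, add_point \<eta> x) * boltzmann UNIV x \<eta> \<partial>Q) \<partial>mu)"
proof -
  interpret papangelou mu "boltzmann UNIV" by (rule papangelou_boltzmann)
  have "\<exists>P. prob_space P \<and> sets P = sets N_sigma \<and> (\<forall>F\<in>borel_measurable (borel \<Otimes>\<^sub>M N_sigma).
      (\<integral>\<^sup>+\<eta>. (\<integral>\<^sup>+x. F (x, \<eta>) \<partial>\<eta>) \<partial>P) =
      (\<integral>\<^sup>+x. indicator (window n) x * (\<integral>\<^sup>+\<eta>. F (x, add_point \<eta> x) * boltzmann UNIV x \<eta> \<partial>P) \<partial>mu)) \<and>
     (\<forall>D. Measurable.pred N_sigma D \<longrightarrow> D (null_measure borel) \<longrightarrow>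
      (\<forall>\<eta> x. \<eta> \<in> N_space \<longrightarrow> D \<eta> \<longrightarrow> D (add_point \<eta> x)) \<longrightarrow> (AE \<eta> in P. D \<eta>))" for n
    by (rule finite_volume_gibbs[OF window_sets bounded_window, of n]) blast
  then have "\<forall>n. \<exists>P. prob_space P \<and> sets P = sets N_sigma \<and> (\<forall>F\<in>borel_measurable (borel \<Otimes>\<^sub>M N_sigma).
      (\<integral>\<^sup>+\<eta>. (\<integral>\<^sup>+x. F (x, \<eta>) \<partial>\<eta>) \<partial>P) =
      (\<integral>\<^sup>+x. indicator (window n) x * (\<integral>\<^sup>+\<eta>. F (x, add_point \<eta> x) * boltzmann UNIV x \<eta> \<partial>P) \<partial>mu)) \<and>
     (\<forall>D. Measurable.pred N_sigma D \<longrightarrow> D (null_measure borel) \<longrightarrow>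
      (\<forall>\<eta> x. \<eta> \<in> N_space \<longrightarrow> D \<eta> \<longrightarrow> D (add_point \<eta> x)) \<longrightarrow> (AE \<eta> in P. D \<eta>))" ..
  from choice[OF this] obtain P where P0: "\<forall>n. prob_space (P n) \<and> sets (P n) = sets N_sigma \<and>
     (\<forall>F\<in>borel_measurable (borel \<Otimes>\<^sub>M N_sigma).
      (\<integral>\<^sup>+\<eta>. (\<integral>\<^sup>+x. F (x, \<eta>) \<partial>\<eta>) \<partial>P n) =
      (\<integral>\<^sup>+x. indicator (window n) x * (\<integral>\<^sup>+\<eta>. F (x, add_point \<eta> x) * boltzmann UNIV x \<eta> \<partial>P n) \<partial>mu)) \<and>
     (\<forall>D. Measurable.pred N_sigma D \<longrightarrow> D (null_measure borel) \<longrightarrow>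
      (\<forall>\<eta> x. \<eta> \<in> N_space \<longrightarrow> D \<eta> \<longrightarrow> D (add_point \<eta> x)) \<longrightarrow> (AE \<eta> in P n. D \<eta>))" ..
  then have P: "\<And>n. prob_space (P n)" and sP[measurable_cong]: "\<And>n. sets (P n) = sets N_sigma"
    and gnz: "\<And>n F. F \<in> borel_measurable (borel \<Otimes>\<^sub>M N_sigma) \<Longrightarrow>
      (\<integral>\<^sup>+\<eta>. (\<integral>\<^sup>+x. F (x, \<eta>) \<partial>\<eta>) \<partial>P n) =
      (\<integral>\<^sup>+x. indicator (window n) x * (\<integral>\<^sup>+\<eta>. F (x, add_point \<eta> x) * boltzmann UNIV x \<eta> \<partial>P n) \<partial>mu)"
    and ae: "\<And>n D. Measurable.pred N_sigma D \<Longrightarrow> D (null_measure borel) \<Longrightarrow>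
      (\<And>\<eta> x. \<eta> \<in> N_space \<Longrightarrow> D \<eta> \<Longrightarrow> D (add_point \<eta> x)) \<Longrightarrow> AE \<eta> in P n. D \<eta>"
    by blast+
  have spP: "space (P n) = N_space" for n using sets_eq_imp_space_eq[OF sP] by simp
  have sub: "sub_mecke mu (P n)" for n
    unfolding sub_mecke_def
  proof
    fix F :: "'a \<times> 'a measure \<Rightarrow> ennreal" assume F: "F \<in> borel_measurable (borel \<Otimes>\<^sub>M N_sigma)"
    show "(\<integral>\<^sup>+\<eta>. (\<integral>\<^sup>+x. F (x, \<eta>) \<partial>\<eta>) \<partial>P n) \<le> (\<integral>\<^sup>+x. (\<integral>\<^sup>+\<eta>. F (x, add_point \<eta> x) \<partial>P n) \<partial>mu)"
      unfolding gnz[OF F]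
    proof (rule nn_integral_mono)
      fix x :: 'a
      have "F (x, add_point \<eta> x) * boltzmann UNIV x \<eta> \<le> F (x, add_point \<eta> x)" for \<eta>
        using mult_left_mono[OF boltzmann_le_1, of "F (x, add_point \<eta> x)" UNIV x \<eta>] by simp
      then have "(\<integral>\<^sup>+\<eta>. F (x, add_point \<eta> x) * boltzmann UNIV x \<eta> \<partial>P n) \<le> (\<integral>\<^sup>+\<eta>. F (x, add_point \<eta> x) \<partial>P n)"
        by (intro nn_integral_mono)
      then show "indicator (window n) x * (\<integral>\<^sup>+\<eta>. F (x, add_point \<eta> x) * boltzmann UNIV x \<eta> \<partial>P n) \<le> (\<integral>\<^sup>+\<eta>. F (x, add_point \<eta> x) \<partial>P n)"
        by (simp split: split_indicator)
    qed
  qed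
  obtain U where U: "ultra U" using ultra_exists ..
  then have U0: "U \<noteq> bot" and Useq: "U \<le> sequentially" by (simp_all add: ultra_def)
  obtain Q where Q: "prob_space Q" and sQ[measurable_cong]: "sets Q = sets N_sigma"
    and lim: "\<And>G K m. G \<in> borel_measurable N_sigma \<Longrightarrow> (\<And>\<eta>. \<eta> \<in> N_space \<Longrightarrow> G \<eta> \<le> ennreal K) \<Longrightarrow>
      (\<And>\<eta>. \<eta> \<in> N_space \<Longrightarrow> G (restr (window m) \<eta>) = G \<eta>) \<Longrightarrow>
      ((\<lambda>n. \<integral>\<^sup>+\<eta>. G \<eta> \<partial>P n) \<longlongrightarrow> (\<integral>\<^sup>+\<eta>. G \<eta> \<partial>Q)) U"
    by (rule local_limit[where P=P, OF U P sP sub]) blast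
  have spQ: "space Q = N_space" using sets_eq_imp_space_eq[OF sQ] by simp
  interpret Q: prob_space Q by (rule Q)

  \<comment> \<open>The union bound estimates the loss by a sum over the points in \<open>S\<close>,
    whose expectation is at most the integral against \<open>mu\<close> by \<open>sub_mecke\<close>;
    the bound does not depend on \<open>n\<close>.\<close>
  have bound: "(\<integral>\<^sup>+\<eta>. (1 - boltzmann S x \<eta>) \<partial>P n) \<le> min 1 (\<integral>\<^sup>+y. indicator S y * (1 - exn (w x y)) \<partial>mu)"
    if S[measurable]: "S \<in> sets borel" for S x n
  proof (rule min.boundedI)
    interpret P: prob_space "P n" by (rule P)
    have "(\<integral>\<^sup>+\<eta>. (1 - boltzmann S x \<eta>) \<partial>P n) \<le> (\<integral>\<^sup>+\<eta>. 1 \<partial>P n)" by (intro nn_integral_mono) (simp add: diff_le_self_ennreal)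
    then show "(\<integral>\<^sup>+\<eta>. (1 - boltzmann S x \<eta>) \<partial>P n) \<le> 1" using P.emeasure_space_1 by simp
    let ?D = "\<lambda>\<eta>. 1 \<le> boltzmann S x \<eta> + (\<integral>\<^sup>+y. indicator S y * (1 - exn (w x y)) \<partial>\<eta>)"
    have "AE \<eta> in P n. ?D \<eta>"
    proof (rule ae)
      show "Measurable.pred N_sigma ?D" by measurable
      show "?D (null_measure borel)" by simp
      show "?D (add_point \<eta> y)" if "\<eta> \<in> N_space" "?D \<eta>" for \<eta> y
        using union_bound_step[OF that(1) S that(2)] .
    qed
    then have "(\<integral>\<^sup>+\<eta>. (1 - boltzmann S x \<eta>) \<partial>P n) \<le> (\<integral>\<^sup>+\<eta>. (\<integral>\<^sup>+y. indicator S y * (1 - exn (w x y)) \<partial>\<eta>) \<partial>P n)"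
      by (intro nn_integral_mono_AE) (auto elim!: eventually_mono intro!: ennreal_minus_le_iff[THEN iffD2])
    also have "\<dots> = (\<integral>\<^sup>+\<eta>. (\<integral>\<^sup>+y. (\<lambda>(y, \<eta>). indicator S y * (1 - exn (w x y))) (y, \<eta>) \<partial>\<eta>) \<partial>P n)" by simp
    also have "\<dots> \<le> (\<integral>\<^sup>+y. (\<integral>\<^sup>+\<eta>. (\<lambda>(y, \<eta>). indicator S y * (1 - exn (w x y))) (y, add_point \<eta> y) \<partial>P n) \<partial>mu)"
      using sub[of n] unfolding sub_mecke_def by (rule bspec) measurable
    also have "\<dots> = (\<integral>\<^sup>+y. indicator S y * (1 - exn (w x y)) \<partial>mu)"
      using P.emeasure_space_1 by simp
    finally show "(\<integral>\<^sup>+\<eta>. (1 - boltzmann S x \<eta>) \<partial>P n) \<le> (\<integral>\<^sup>+y. indicator S y * (1 - exn (w x y)) \<partial>mu)" .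
  qed

  \<comment> \<open>The test sets are chosen so that the left-hand integrand is both local and
    bounded by \<open>K\<close>, as required by \<open>lim\<close>.\<close>
  have local_gnz: "(\<integral>\<^sup>+\<eta>. (\<integral>\<^sup>+x. indicator (C \<times> A) (x, \<eta>) \<partial>\<eta>) \<partial>Q) =
      (\<integral>\<^sup>+x. (\<integral>\<^sup>+\<eta>. indicator (C \<times> A) (x, add_point \<eta> x) * boltzmann UNIV x \<eta> \<partial>Q) \<partial>mu)"
    if C[measurable]: "C \<in> sets borel" and Cm: "C \<subseteq> window m" and A: "local_event m A"
      and AK: "A \<subseteq> {\<eta>. emeasure \<eta> (window m) \<le> ennreal K}" for C m A K
  proof -
    have [measurable]: "A \<in> sets N_sigma" using A by (simp add: local_event_def)
    let ?F = "\<lambda>(x, \<eta>). indicator C x * indicator A \<eta> :: ennreal"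
    have F: "?F \<in> borel_measurable (borel \<Otimes>\<^sub>M N_sigma)" by measurable
    define H where "H \<eta> = (\<integral>\<^sup>+x. ?F (x, \<eta>) \<partial>\<eta>)" for \<eta> :: "'a measure"
    define g where "g S \<eta> = (\<integral>\<^sup>+x. indicator C x * indicator A (add_point \<eta> x) * boltzmann S x \<eta> \<partial>mu)" for S \<eta>
    have g[measurable]: "g S \<in> borel_measurable N_sigma" if [measurable]: "S \<in> sets borel" for S
      unfolding g_def[abs_def] by measurable
    have H_eq: "H \<eta> = emeasure \<eta> C * indicator A \<eta>" if "\<eta> \<in> N_space" for \<eta>
      unfolding H_def using that by (simp add: nn_integral_multc cong: measurable_cong_sets)
    have H_lim: "((\<lambda>n. \<integral>\<^sup>+\<eta>. H \<eta> \<partial>P n) \<longlongrightarrow> (\<integral>\<^sup>+\<eta>. H \<eta> \<partial>Q)) U"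
    proof (rule lim)
      show "H \<in> borel_measurable N_sigma" unfolding H_def[abs_def] by measurable
      show "H \<eta> \<le> ennreal K" if "\<eta> \<in> N_space" for \<eta>
      proof (cases "\<eta> \<in> A")
        case True
        have "H \<eta> = emeasure \<eta> C" using True that by (simp add: H_eq)
        also have "\<dots> \<le> emeasure \<eta> (window m)" using that by (intro emeasure_mono Cm) simp
        also have "\<dots> \<le> ennreal K" using True AK by auto
        finally show ?thesis .
      qed (simp add: H_eq that)
      show "H (restr (window m) \<eta>) = H \<eta>" if "\<eta> \<in> N_space" for \<eta>
      proof -
        have "C \<inter> window m = C" using Cm by auto
        then show ?thesis using that A by (simp add: H_eq emeasure_restr local_event_def indicator_def)
      qed
    qed
    obtain c where c: "0 \<le> c" "emeasure mu C = ennreal c"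
      using mu_finite[OF C bounded_subset[OF bounded_window Cm]] by (cases "emeasure mu C") auto
    have g_le: "g S \<eta> \<le> ennreal c" for S \<eta>
    proof -
      have "g S \<eta> \<le> (\<integral>\<^sup>+x. indicator C x \<partial>mu)"
        unfolding g_def by (intro nn_integral_mono) (auto split: split_indicator)
      then show ?thesis by (simp add: c)
    qed
    \<comment> \<open>For a cutoff window containing \<open>window m\<close>, every \<open>x\<close>
      in \<open>C\<close> lies inside it, so restriction commutes with adding \<open>x\<close> and
      \<open>g (window k)\<close> becomes local.\<close>
    have gk_lim: "((\<lambda>n. \<integral>\<^sup>+\<eta>. g (window k) \<eta> \<partial>P n) \<longlongrightarrow> (\<integral>\<^sup>+\<eta>. g (window k) \<eta> \<partial>Q)) U" if k: "m \<le> k" for k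
    proof (rule lim[OF g[OF window_sets] g_le])
      fix \<eta> :: "'a measure" assume \<eta>: "\<eta> \<in> N_space"
      have "indicator C x * indicator A (add_point (restr (window k) \<eta>) x) * boltzmann (window k) x (restr (window k) \<eta>) =
          indicator C x * indicator A (add_point \<eta> x) * boltzmann (window k) x \<eta>" for x
      proof (cases "x \<in> C")
        case True
        then have x: "x \<in> window k" using Cm window_mono[OF k] by auto
        have "local_event k A" using A k by (rule local_event_mono)
        then have "restr (window k) (add_point \<eta> x) \<in> A \<longleftrightarrow> add_point \<eta> x \<in> A"
          using \<eta> by (simp add: local_event_def)
        then show ?thesis using x \<eta> by (simp add: restr_add_point boltzmann_restr indicator_def)
      qed simp
      then show "g (window k) (restr (window k) \<eta>) = g (window k) \<eta>" by (simp add: g_def)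
    qed
    \<comment> \<open>As soon as \<open>C\<close> lies in the volume, the volume indicator is
      invisible and the finite-volume equation is exact with the full interaction.\<close>
    have H_eq_g: "(\<integral>\<^sup>+\<eta>. H \<eta> \<partial>P n) = (\<integral>\<^sup>+\<eta>. g UNIV \<eta> \<partial>P n)" if n: "m \<le> n" for n
    proof -
      interpret P: prob_space "P n" by (rule P)
      interpret pair: pair_sigma_finite "P n" mu ..
      have "(\<integral>\<^sup>+\<eta>. H \<eta> \<partial>P n) = (\<integral>\<^sup>+x. indicator (window n) x * (\<integral>\<^sup>+\<eta>. ?F (x, add_point \<eta> x) * boltzmann UNIV x \<eta> \<partial>P n) \<partial>mu)"
        unfolding H_def by (rule gnz[OF F])
      also have "\<dots> = (\<integral>\<^sup>+x. (\<integral>\<^sup>+\<eta>. indicator C x * indicator A (add_point \<eta> x) * boltzmann UNIV x \<eta> \<partial>P n) \<partial>mu)"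
        using Cm window_mono[OF n] by (intro nn_integral_cong) (auto split: split_indicator)
      also have "\<dots> = (\<integral>\<^sup>+\<eta>. g UNIV \<eta> \<partial>P n)"
        unfolding g_def by (rule pair.Fubini') measurable
      finally show ?thesis .
    qed
    \<comment> \<open>The price of the cut at \<open>window k\<close>. It does not mention
      \<open>n\<close>, so it survives the limit along \<open>U\<close> unchanged.\<close>
    define e where "e k = (\<integral>\<^sup>+x. indicator C x * min 1 (\<integral>\<^sup>+y. indicator (- window k) y * (1 - exn (w x y)) \<partial>mu) \<partial>mu)" for k
    have upper: "(\<integral>\<^sup>+\<eta>. g (window k) \<eta> \<partial>P n) \<le> (\<integral>\<^sup>+\<eta>. g UNIV \<eta> \<partial>P n) + e k" for k n
    proof -
      interpret P: prob_space "P n" by (rule P)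
      interpret pair: pair_sigma_finite "P n" mu ..
      let ?r = "\<lambda>\<eta>. \<integral>\<^sup>+x. indicator C x * (1 - boltzmann (- window k) x \<eta>) \<partial>mu"
      have "g (window k) \<eta> \<le> g UNIV \<eta> + ?r \<eta>" if "\<eta> \<in> N_space" for \<eta>
      proof -
        have [measurable]: "\<eta> \<in> space N_sigma" using that by simp
        have "g (window k) \<eta> \<le> (\<integral>\<^sup>+x. indicator C x * indicator A (add_point \<eta> x) * boltzmann UNIV x \<eta> +
            indicator C x * (1 - boltzmann (- window k) x \<eta>) \<partial>mu)"
          unfolding g_def
        proof (rule nn_integral_mono)
          fix x :: 'a
          let ?a = "boltzmann (window k) x \<eta>" and ?b = "boltzmann (- window k) x \<eta>"
          have "?a = ?a * (?b + (1 - ?b))" by (simp add: ennreal_add_diff_1)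
          also have "\<dots> = ?a * ?b + ?a * (1 - ?b)" by (simp only: distrib_left)
          also have "\<dots> \<le> ?a * ?b + 1 * (1 - ?b)" by (intro add_left_mono mult_right_mono) simp_all
          also have "?a * ?b = boltzmann UNIV x \<eta>" by (rule boltzmann_split[symmetric, OF that]) simp
          finally have *: "?a \<le> boltzmann UNIV x \<eta> + (1 - ?b)" by simp
          show "indicator C x * indicator A (add_point \<eta> x) * ?a \<le>
            indicator C x * indicator A (add_point \<eta> x) * boltzmann UNIV x \<eta> + indicator C x * (1 - ?b)"
            using * by (auto split: split_indicator)
        qed
        also have "\<dots> = g UNIV \<eta> + ?r \<eta>" unfolding g_def by (rule nn_integral_add) measurable
        finally show ?thesis .
      qed
      then have "(\<integral>\<^sup>+\<eta>. g (window k) \<eta> \<partial>P n) \<le> (\<integral>\<^sup>+\<eta>. g UNIV \<eta> + ?r \<eta> \<partial>P n)"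
        by (intro nn_integral_mono) (simp add: spP)
      also have "\<dots> = (\<integral>\<^sup>+\<eta>. g UNIV \<eta> \<partial>P n) + (\<integral>\<^sup>+\<eta>. ?r \<eta> \<partial>P n)" by (rule nn_integral_add) measurable
      also have "(\<integral>\<^sup>+\<eta>. ?r \<eta> \<partial>P n) = (\<integral>\<^sup>+x. (\<integral>\<^sup>+\<eta>. indicator C x * (1 - boltzmann (- window k) x \<eta>) \<partial>P n) \<partial>mu)"
        by (rule pair.Fubini'[symmetric]) measurable
      also have "\<dots> = (\<integral>\<^sup>+x. indicator C x * (\<integral>\<^sup>+\<eta>. (1 - boltzmann (- window k) x \<eta>) \<partial>P n) \<partial>mu)"
        by (intro nn_integral_cong nn_integral_cmult) measurable
      also have "\<dots> \<le> e k"
        unfolding e_def by (intro nn_integral_mono mult_left_mono bound) auto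
      finally show ?thesis by (simp add: add_left_mono)
    qed
    have g_lim: "((\<lambda>n. \<integral>\<^sup>+\<eta>. g UNIV \<eta> \<partial>P n) \<longlongrightarrow> (\<integral>\<^sup>+\<eta>. H \<eta> \<partial>Q)) U"
    proof (rule Lim_transform_eventually[OF H_lim])
      have "eventually (\<lambda>n. m \<le> n) U" using Useq eventually_ge_at_top by (rule filter_leD)
      then show "eventually (\<lambda>n. (\<integral>\<^sup>+\<eta>. H \<eta> \<partial>P n) = (\<integral>\<^sup>+\<eta>. g UNIV \<eta> \<partial>P n)) U"
        by eventually_elim (rule H_eq_g)
    qed
    \<comment> \<open>The limit of \<open>g UNIV\<close> along \<open>U\<close> is known only
      through that of \<open>H\<close>, not yet as an integral of \<open>g UNIV\<close> against
      \<open>Q\<close>. Hence the two inequalities at fixed \<open>k\<close>, whose cutoff side is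
      local.\<close>
    have lo: "(\<integral>\<^sup>+\<eta>. H \<eta> \<partial>Q) \<le> (\<integral>\<^sup>+\<eta>. g (window k) \<eta> \<partial>Q)" if "m \<le> k" for k
      by (rule tendsto_le[OF U0 gk_lim[OF that] g_lim])
        (auto simp: g_def intro!: always_eventually nn_integral_mono mult_left_mono boltzmann_antimono)
    have hi: "(\<integral>\<^sup>+\<eta>. g (window k) \<eta> \<partial>Q) \<le> (\<integral>\<^sup>+\<eta>. H \<eta> \<partial>Q) + e k" if "m \<le> k" for k
      by (rule tendsto_le[OF U0 tendsto_add[OF g_lim tendsto_const] gk_lim[OF that]])
        (auto intro!: always_eventually upper)
    \<comment> \<open>Dominated convergence twice: in \<open>y\<close>, for almost every
      \<open>x\<close>, by integrability of the Mayer function; in \<open>x\<close>, by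
      \<open>indicator C\<close>, which dominates thanks to \<open>min 1\<close>.\<close>
    have e_lim: "e \<longlonglongrightarrow> 0"
    proof -
      have "e \<longlonglongrightarrow> (\<integral>\<^sup>+x. 0 \<partial>mu)"
        unfolding e_def
      proof (rule nn_integral_dominated_convergence[where w="indicator C"])
        show "(\<integral>\<^sup>+x. indicator C x \<partial>mu) < \<infinity>" by (simp add: c)
        show "AE x in mu. indicator C x * min 1 (\<integral>\<^sup>+y. indicator (- window k) y * (1 - exn (w x y)) \<partial>mu) \<le> indicator C x" for k
          by (auto split: split_indicator)
        show "AE x in mu. (\<lambda>k. indicator C x * min 1 (\<integral>\<^sup>+y. indicator (- window k) y * (1 - exn (w x y)) \<partial>mu)) \<longlonglongrightarrow> 0"
          using w_int
        proof eventually_elim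
          fix x assume fin: "(\<integral>\<^sup>+y. (1 - exn (w x y)) \<partial>mu) < \<infinity>"
          have "(\<lambda>k. \<integral>\<^sup>+y. indicator (- window k) y * (1 - exn (w x y)) \<partial>mu) \<longlonglongrightarrow> (\<integral>\<^sup>+y. 0 \<partial>mu)"
          proof (rule nn_integral_dominated_convergence[where w="\<lambda>y. 1 - exn (w x y)"])
            show "AE y in mu. (\<lambda>k. indicator (- window k) y * (1 - exn (w x y))) \<longlonglongrightarrow> 0"
            proof (rule AE_I2)
              fix y :: 'a
              obtain k where k: "y \<in> window k" using ex_window ..
              have "eventually (\<lambda>k. 0 = indicator (- window k) y * (1 - exn (w x y))) sequentially"
                using eventually_ge_at_top[of k]
              proof eventually_elim
                fix i assume "k \<le> i"
                then have "y \<in> window i" using k window_mono by blast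
                then show "0 = indicator (- window i) y * (1 - exn (w x y))" by simp
              qed
              then show "(\<lambda>k. indicator (- window k) y * (1 - exn (w x y))) \<longlonglongrightarrow> 0"
                by (rule Lim_transform_eventually[OF tendsto_const])
            qed
          qed (use fin in \<open>auto split: split_indicator\<close>)
          then have "(\<lambda>k. min 1 (\<integral>\<^sup>+y. indicator (- window k) y * (1 - exn (w x y)) \<partial>mu)) \<longlonglongrightarrow> min 1 0"
            by (intro tendsto_min tendsto_const) simp
          then show "(\<lambda>k. indicator C x * min 1 (\<integral>\<^sup>+y. indicator (- window k) y * (1 - exn (w x y)) \<partial>mu)) \<longlonglongrightarrow> 0"
            by (cases "x \<in> C") simp_all
        qed
      qed measurable
      then show ?thesis by simp
    qed
    have "(\<lambda>k. \<integral>\<^sup>+\<eta>. g (window k) \<eta> \<partial>Q) \<longlonglongrightarrow> (\<integral>\<^sup>+\<eta>. H \<eta> \<partial>Q)"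
    proof (rule tendsto_sandwich)
      show "eventually (\<lambda>k. (\<integral>\<^sup>+\<eta>. H \<eta> \<partial>Q) \<le> (\<integral>\<^sup>+\<eta>. g (window k) \<eta> \<partial>Q)) sequentially"
        using eventually_ge_at_top[of m] by eventually_elim (rule lo)
      show "eventually (\<lambda>k. (\<integral>\<^sup>+\<eta>. g (window k) \<eta> \<partial>Q) \<le> (\<integral>\<^sup>+\<eta>. H \<eta> \<partial>Q) + e k) sequentially"
        using eventually_ge_at_top[of m] by eventually_elim (rule hi)
      show "(\<lambda>k. (\<integral>\<^sup>+\<eta>. H \<eta> \<partial>Q) + e k) \<longlonglongrightarrow> (\<integral>\<^sup>+\<eta>. H \<eta> \<partial>Q)"
        using tendsto_add[OF tendsto_const e_lim] by simp
    qed (rule tendsto_const)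
    \<comment> \<open>Here a single measure \<open>Q\<close> is fixed and \<open>k\<close> runs
      along the ordinary sequence, so dominated convergence is available.\<close>
    moreover have "(\<lambda>k. \<integral>\<^sup>+\<eta>. g (window k) \<eta> \<partial>Q) \<longlonglongrightarrow> (\<integral>\<^sup>+\<eta>. g UNIV \<eta> \<partial>Q)"
    proof (rule nn_integral_dominated_convergence[where w="\<lambda>_. ennreal c"])
      show "(\<integral>\<^sup>+\<eta>. ennreal c \<partial>Q) < \<infinity>" using Q.emeasure_space_1 by simp
      show "AE \<eta> in Q. (\<lambda>k. g (window k) \<eta>) \<longlonglongrightarrow> g UNIV \<eta>"
      proof (rule AE_I2)
        fix \<eta> assume "\<eta> \<in> space Q"
        then have \<eta>: "\<eta> \<in> N_space" by (simp add: spQ)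
        then have [measurable]: "\<eta> \<in> space N_sigma" by simp
        show "(\<lambda>k. g (window k) \<eta>) \<longlonglongrightarrow> g UNIV \<eta>"
          unfolding g_def
        proof (rule nn_integral_dominated_convergence[where w="indicator C"])
          show "(\<integral>\<^sup>+x. indicator C x \<partial>mu) < \<infinity>" by (simp add: c)
          show "AE x in mu. indicator C x * indicator A (add_point \<eta> x) * boltzmann (window k) x \<eta> \<le> indicator C x" for k
            by (auto split: split_indicator)
          show "AE x in mu. (\<lambda>k. indicator C x * indicator A (add_point \<eta> x) * boltzmann (window k) x \<eta>)
              \<longlonglongrightarrow> indicator C x * indicator A (add_point \<eta> x) * boltzmann UNIV x \<eta>"
            by (intro AE_I2 ennreal_tendsto_cmult tendsto_boltzmann \<eta>) (auto split: split_indicator)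
        qed measurable
      qed
    qed (auto simp: g_le)
    ultimately have "(\<integral>\<^sup>+\<eta>. H \<eta> \<partial>Q) = (\<integral>\<^sup>+\<eta>. g UNIV \<eta> \<partial>Q)" by (rule LIMSEQ_unique)
    also have "\<dots> = (\<integral>\<^sup>+x. (\<integral>\<^sup>+\<eta>. indicator C x * indicator A (add_point \<eta> x) * boltzmann UNIV x \<eta> \<partial>Q) \<partial>mu)"
    proof -
      interpret pair: pair_sigma_finite Q mu ..
      show ?thesis unfolding g_def by (rule pair.Fubini'[symmetric]) measurable
    qed
    finally show ?thesis by (simp add: H_def indicator_times)
  qed

  \<comment> \<open>The two sides of the equation are turned into measures on marked configurations,
    so that agreement on rectangles extends to every \<open>F\<close> by uniqueness of
    measures.\<close>
  define \<Phi>1 where "\<Phi>1 F = (\<integral>\<^sup>+\<eta>. (\<integral>\<^sup>+x. F (x, \<eta>) \<partial>\<eta>) \<partial>Q)" for F :: "'a \<times> 'a measure \<Rightarrow> ennreal"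
  define \<Phi>2 where "\<Phi>2 F = (\<integral>\<^sup>+x. (\<integral>\<^sup>+\<eta>. F (x, add_point \<eta> x) * boltzmann UNIV x \<eta> \<partial>Q) \<partial>mu)" for F :: "'a \<times> 'a measure \<Rightarrow> ennreal"
  let ?X = "borel \<Otimes>\<^sub>M N_sigma :: ('a \<times> 'a measure) measure"
  have sec[measurable]: "(\<lambda>x. F (x, \<eta>)) \<in> borel_measurable borel" if "F \<in> borel_measurable ?X" "\<eta> \<in> N_space" for F :: "'a \<times> 'a measure \<Rightarrow> ennreal" and \<eta>
    using measurable_Pair1[OF that(1), of \<eta>] that(2) by simp
  obtain M1 where M1: "sets M1 = sets ?X" "\<And>F. F \<in> borel_measurable ?X \<Longrightarrow> (\<integral>\<^sup>+p. F p \<partial>M1) = \<Phi>1 F"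
  proof (rule measure_of_functional[of ?X \<Phi>1])
    fix f g :: "'a \<times> 'a measure \<Rightarrow> ennreal" assume fg: "\<And>x. x \<in> space ?X \<Longrightarrow> f x = g x"
    show "\<Phi>1 f = \<Phi>1 g" unfolding \<Phi>1_def by (intro nn_integral_cong) (simp add: fg space_pair_measure spQ)
  next
    fix c and f :: "'a \<times> 'a measure \<Rightarrow> ennreal" assume f[measurable]: "f \<in> borel_measurable ?X"
    have "\<Phi>1 (\<lambda>x. c * f x) = (\<integral>\<^sup>+\<eta>. c * (\<integral>\<^sup>+x. f (x, \<eta>) \<partial>\<eta>) \<partial>Q)"
      unfolding \<Phi>1_def using sec[OF f] by (intro nn_integral_cong nn_integral_cmult) (simp add: spQ cong: measurable_cong_sets)
    also have "\<dots> = c * \<Phi>1 f" unfolding \<Phi>1_def by (rule nn_integral_cmult) measurable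
    finally show "\<Phi>1 (\<lambda>x. c * f x) = c * \<Phi>1 f" .
  next
    fix f g :: "'a \<times> 'a measure \<Rightarrow> ennreal" assume f[measurable]: "f \<in> borel_measurable ?X" and g[measurable]: "g \<in> borel_measurable ?X"
    have "\<Phi>1 (\<lambda>x. f x + g x) = (\<integral>\<^sup>+\<eta>. (\<integral>\<^sup>+x. f (x, \<eta>) \<partial>\<eta>) + (\<integral>\<^sup>+x. g (x, \<eta>) \<partial>\<eta>) \<partial>Q)"
      unfolding \<Phi>1_def using sec[OF f] sec[OF g] by (intro nn_integral_cong nn_integral_add) (simp_all add: spQ cong: measurable_cong_sets)
    also have "\<dots> = \<Phi>1 f + \<Phi>1 g" unfolding \<Phi>1_def by (rule nn_integral_add) measurable
    finally show "\<Phi>1 (\<lambda>x. f x + g x) = \<Phi>1 f + \<Phi>1 g" .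
  next
    fix F :: "nat \<Rightarrow> 'a \<times> 'a measure \<Rightarrow> ennreal" assume F[measurable]: "\<And>i. F i \<in> borel_measurable ?X" and inc: "incseq F"
    have "\<Phi>1 (\<lambda>x. SUP i. F i x) = (\<integral>\<^sup>+\<eta>. (SUP i. \<integral>\<^sup>+x. F i (x, \<eta>) \<partial>\<eta>) \<partial>Q)"
      unfolding \<Phi>1_def using sec[OF F] inc
      by (intro nn_integral_cong nn_integral_monotone_convergence_SUP) (auto simp: spQ incseq_def le_fun_def cong: measurable_cong_sets)
    also have "\<dots> = (SUP i. \<Phi>1 (F i))"
      unfolding \<Phi>1_def using inc
      by (intro nn_integral_monotone_convergence_SUP) (auto simp: incseq_def le_fun_def intro!: nn_integral_mono)
    finally show "\<Phi>1 (\<lambda>x. SUP i. F i x) = (SUP i. \<Phi>1 (F i))" .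
  qed blast
  have addm[measurable]: "(\<lambda>\<eta>. add_point \<eta> x) \<in> measurable N_sigma N_sigma" for x :: 'a by measurable
  obtain M2 where M2: "sets M2 = sets ?X" "\<And>F. F \<in> borel_measurable ?X \<Longrightarrow> (\<integral>\<^sup>+p. F p \<partial>M2) = \<Phi>2 F"
  proof (rule measure_of_functional[of ?X \<Phi>2])
    fix f g :: "'a \<times> 'a measure \<Rightarrow> ennreal" assume fg: "\<And>x. x \<in> space ?X \<Longrightarrow> f x = g x"
    show "\<Phi>2 f = \<Phi>2 g" unfolding \<Phi>2_def by (intro nn_integral_cong) (simp add: fg space_pair_measure spQ)
  next
    fix c and f :: "'a \<times> 'a measure \<Rightarrow> ennreal" assume f[measurable]: "f \<in> borel_measurable ?X"
    show "\<Phi>2 (\<lambda>x. c * f x) = c * \<Phi>2 f"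
      unfolding \<Phi>2_def mult.assoc by (subst nn_integral_cmult[symmetric], measurable, intro nn_integral_cong nn_integral_cmult, measurable)
  next
    fix f g :: "'a \<times> 'a measure \<Rightarrow> ennreal" assume f[measurable]: "f \<in> borel_measurable ?X" and g[measurable]: "g \<in> borel_measurable ?X"
    show "\<Phi>2 (\<lambda>x. f x + g x) = \<Phi>2 f + \<Phi>2 g"
      unfolding \<Phi>2_def distrib_right by (subst nn_integral_add[symmetric], measurable, intro nn_integral_cong nn_integral_add, measurable)
  next
    fix F :: "nat \<Rightarrow> 'a \<times> 'a measure \<Rightarrow> ennreal" assume F[measurable]: "\<And>i. F i \<in> borel_measurable ?X" and inc: "incseq F"
    have "\<Phi>2 (\<lambda>x. SUP i. F i x) = (\<integral>\<^sup>+x. (SUP i. \<integral>\<^sup>+\<eta>. F i (x, add_point \<eta> x) * boltzmann UNIV x \<eta> \<partial>Q) \<partial>mu)"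
      unfolding \<Phi>2_def SUP_mult_right_ennreal using inc
      by (intro nn_integral_cong nn_integral_monotone_convergence_SUP) (auto simp: incseq_def le_fun_def intro!: mult_right_mono)
    also have "\<dots> = (SUP i. \<Phi>2 (F i))"
      unfolding \<Phi>2_def using inc
      by (intro nn_integral_monotone_convergence_SUP) (auto simp: incseq_def le_fun_def intro!: nn_integral_mono mult_right_mono)
    finally show "\<Phi>2 (\<lambda>x. SUP i. F i x) = (SUP i. \<Phi>2 (F i))" .
  qed blast
  have em1: "emeasure M1 Y = \<Phi>1 (indicator Y)" and em2: "emeasure M2 Y = \<Phi>2 (indicator Y)" if "Y \<in> sets ?X" for Y
    using that M1(2)[of "indicator Y"] M2(2)[of "indicator Y"] M1(1) M2(1) by simp_all
  have "M2 = M1"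
  proof (rule config_measure_eqI[OF M2(1) M1(1)])
    fix m
    have "emeasure M2 (window m \<times> N_space) = \<Phi>2 (indicator (window m \<times> N_space))" by (rule em2) simp
    also have "\<dots> \<le> (\<integral>\<^sup>+x. (\<integral>\<^sup>+\<eta>. indicator (window m) x \<partial>Q) \<partial>mu)"
      unfolding \<Phi>2_def by (intro nn_integral_mono) (auto split: split_indicator)
    also have "\<dots> = emeasure mu (window m)" using Q.emeasure_space_1 by simp
    also have "\<dots> < \<infinity>" by (rule mu_finite) simp_all
    finally show "emeasure M2 (window m \<times> N_space) < \<infinity>" .
  next
    fix m K and B :: "'a set" and A :: "'a measure set"
    assume B: "B \<in> sets borel" "B \<subseteq> window m" and A: "local_event m A" "A \<subseteq> {\<eta>. emeasure \<eta> (window m) \<le> ennreal K}"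
    have "B \<times> A \<in> sets ?X" using B(1) A(1) by (simp add: local_event_def)
    then show "emeasure M2 (B \<times> A) = emeasure M1 (B \<times> A)"
      using local_gnz[OF B A] by (simp add: em1 em2 \<Phi>1_def \<Phi>2_def)
  qed
  then have "(\<integral>\<^sup>+\<eta>. (\<integral>\<^sup>+x. F (x, \<eta>) \<partial>\<eta>) \<partial>Q) = (\<integral>\<^sup>+x. (\<integral>\<^sup>+\<eta>. F (x, add_point \<eta> x) * boltzmann UNIV x \<eta> \<partial>Q) \<partial>mu)"
    if "F \<in> borel_measurable ?X" for F
    using M1(2)[OF that] M2(2)[OF that] by (simp add: \<Phi>1_def \<Phi>2_def)
  with Q sQ show ?thesis by (rule that)
qed

end

subsection \<open>From the potential to the Boltzmann factor\<close>

lemma mayer_f_nonneg: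
  assumes "0 \<le> v x y"
  shows "ennreal \<bar>mayer_f v x y\<bar> = 1 - exn (e2ennreal (max 0 (v x y)))"
proof (cases "v x y")
  case (real r)
  then have r: "0 \<le> r" using assms by simp
  have "exn (e2ennreal (max 0 (v x y))) = ennreal (exp (- r))"
    using r real by (simp add: exn_def max_def e2ennreal_ereal)
  moreover have "1 - ennreal (exp (- r)) = ennreal (1 - exp (- r))"
    by (subst ennreal_1[symmetric], subst ennreal_minus) auto
  moreover have "\<bar>mayer_f v x y\<bar> = 1 - exp (- r)"
    using r real by (simp add: mayer_f_def)
  ultimately show ?thesis by simp
qed (use assms in \<open>simp_all add: mayer_f_def max_def\<close>)

lemma exp_neg_W_int:
  assumes "(\<integral>\<^sup>+y. e2ennreal (max 0 (- v x y)) \<partial>\<eta>) = 0"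
  shows "exp_neg (W_int v x \<eta>) = exn (\<integral>\<^sup>+y. e2ennreal (max 0 (v x y)) \<partial>\<eta>)"
proof (cases "\<integral>\<^sup>+y. e2ennreal (max 0 (v x y)) \<partial>\<eta>")
  case (real r)
  then show ?thesis using assms by (simp add: W_int_def exp_neg_def exn_def zero_ennreal.rep_eq)
next
  case top
  then show ?thesis by (simp add: W_int_def exp_neg_def)
qed

theorem mainTheorem13:
  fixes lam :: "('a::polish_space) measure" and z :: "'a \<Rightarrow> real" and v :: "'a \<Rightarrow> 'a \<Rightarrow> ereal"
  assumes lam_sets: "sets lam = sets borel"
    and lam_fin: "\<And>B. B \<in> sets borel \<Longrightarrow> bounded B \<Longrightarrow> emeasure lam B < \<infinity>"
    and z_meas: "z \<in> borel_measurable borel"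
    and z_nonneg: "\<And>x. z x \<ge> 0"
    and lamz_fin: "\<And>B. B \<in> sets borel \<Longrightarrow> bounded B \<Longrightarrow> emeasure (density lam z) B < \<infinity>"
    and v_meas: "(\<lambda>p. v (fst p) (snd p)) \<in> borel_measurable (borel \<Otimes>\<^sub>M borel)"
    and v_sym: "\<And>x y. v x y = v y x"
    and v_not_minf: "\<And>x y. v x y \<noteq> -\<infinity>"
    and v_nonneg_ae: "AE p in (density lam z \<Otimes>\<^sub>M density lam z). v (fst p) (snd p) \<ge> 0"
    and f_int: "AE x in lam. (\<integral>\<^sup>+ y. ennreal \<bar>mayer_f v x y\<bar> \<partial>(density lam z)) < \<infinity>"
  shows "Gibbs lam z v \<noteq> {}"
proof -
  define mu where "mu = density lam z"
  define w where "w x y = e2ennreal (max 0 (v x y))" for x y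
  define u where "u x y = e2ennreal (max 0 (- v x y))" for x y
  note [measurable] = z_meas v_meas and [measurable_cong] = lam_sets
  have z[measurable]: "(\<lambda>x. ennreal (z x)) \<in> borel_measurable lam" by measurable
  interpret boundedly_finite mu
    by unfold_locales (use lamz_fin in \<open>simp_all add: mu_def lam_sets\<close>)
  interpret pair: pair_sigma_finite mu mu ..
  have nonneg: "AE x in mu. AE y in mu. 0 \<le> v x y"
    using pair.AE_pair[OF v_nonneg_ae[folded mu_def]] by simp
  have AE_mu: "AE x in mu. Pr x" if "AE x in lam. Pr x" for Pr
    using that unfolding mu_def by (subst AE_density) auto
  interpret repulsive_pair mu w
  proof
    show "(\<lambda>(x, y). w x y) \<in> borel_measurable (borel \<Otimes>\<^sub>M borel)"
      unfolding w_def split_beta' by measurable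
    show "w x y = w y x" for x y by (simp add: w_def v_sym[of x y])
    show "AE x in mu. (\<integral>\<^sup>+y. (1 - exn (w x y)) \<partial>mu) < \<infinity>"
      using nonneg AE_mu[OF f_int]
    proof eventually_elim
      fix x assume pos: "AE y in mu. 0 \<le> v x y"
        and fin: "(\<integral>\<^sup>+ y. ennreal \<bar>mayer_f v x y\<bar> \<partial>(density lam z)) < \<infinity>"
      have "(\<integral>\<^sup>+y. (1 - exn (w x y)) \<partial>mu) = (\<integral>\<^sup>+y. ennreal \<bar>mayer_f v x y\<bar> \<partial>mu)"
        using pos by (intro nn_integral_cong_AE) (auto elim!: eventually_mono simp: w_def mayer_f_nonneg)
      with fin show "(\<integral>\<^sup>+y. (1 - exn (w x y)) \<partial>mu) < \<infinity>" by (simp add: mu_def)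
    qed
  qed
  obtain Q where Q: "prob_space Q" and sQ[measurable_cong]: "sets Q = sets N_sigma"
    and gnz: "\<And>F. F \<in> borel_measurable (borel \<Otimes>\<^sub>M N_sigma) \<Longrightarrow>
      (\<integral>\<^sup>+\<eta>. (\<integral>\<^sup>+x. F (x, \<eta>) \<partial>\<eta>) \<partial>Q) =
      (\<integral>\<^sup>+x. (\<integral>\<^sup>+\<eta>. F (x, add_point \<eta> x) * boltzmann UNIV x \<eta> \<partial>Q) \<partial>mu)"
    by (rule ex_gibbs) blast
  have spQ: "space Q = space N_sigma" using sQ by (rule sets_eq_imp_space_eq)
  interpret Q: prob_space Q by (rule Q)
  have u[measurable]: "(\<lambda>y. u x y) \<in> borel_measurable borel" for x
  proof -
    have "(\<lambda>y. v (fst (x, y)) (snd (x, y))) \<in> borel_measurable borel"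
      by (rule measurable_compose[OF measurable_Pair1' v_meas]) simp
    then have [measurable]: "(\<lambda>y. v x y) \<in> borel_measurable borel" by simp
    show ?thesis unfolding u_def by measurable
  qed
  have W: "AE x in mu. AE \<eta> in Q. exp_neg (W_int v x \<eta>) = boltzmann UNIV x \<eta>"
    using nonneg
  proof eventually_elim
    fix x assume pos: "AE y in mu. 0 \<le> v x y"
    have "(\<integral>\<^sup>+\<eta>. (\<integral>\<^sup>+y. u x y \<partial>\<eta>) \<partial>Q) = (\<integral>\<^sup>+y. (\<integral>\<^sup>+\<eta>. u x y * boltzmann UNIV y \<eta> \<partial>Q) \<partial>mu)"
      using gnz[of "\<lambda>(y, \<eta>). u x y"] by simp
    also have "\<dots> = (\<integral>\<^sup>+y. 0 \<partial>mu)"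
      using pos by (intro nn_integral_cong_AE) (auto elim!: eventually_mono simp: u_def max_def)
    finally have "(\<integral>\<^sup>+\<eta>. (\<integral>\<^sup>+y. u x y \<partial>\<eta>) \<partial>Q) = 0" by simp
    moreover have "(\<lambda>\<eta>. \<integral>\<^sup>+y. u x y \<partial>\<eta>) \<in> borel_measurable Q"
    proof -
      have "(\<lambda>q. u x (snd q)) \<in> borel_measurable (N_sigma \<Otimes>\<^sub>M borel)"
        by (rule measurable_compose[OF measurable_snd u])
      from measurable_nn_integral_config[OF this measurable_ident_sets[OF refl]]
      show ?thesis by (simp cong: measurable_cong_sets add: sQ)
    qed
    ultimately have "AE \<eta> in Q. (\<integral>\<^sup>+y. u x y \<partial>\<eta>) = 0"
      by (simp add: nn_integral_0_iff_AE)
    then show "AE \<eta> in Q. exp_neg (W_int v x \<eta>) = boltzmann UNIV x \<eta>"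
      by eventually_elim (simp add: u_def exp_neg_W_int boltzmann_def w_def)
  qed
  have "Q \<in> Gibbs lam z v"
    unfolding Gibbs_def
  proof (intro CollectI conjI ballI Q spQ sQ)
    fix F :: "'a \<times> 'a measure \<Rightarrow> ennreal" assume F[measurable]: "F \<in> borel_measurable (borel \<Otimes>\<^sub>M N_sigma)"
    let ?h = "\<lambda>x. \<integral>\<^sup>+\<eta>. F (x, add_point \<eta> x) * exp_neg (W_int v x \<eta>) \<partial>Q"
    let ?h' = "\<lambda>x. \<integral>\<^sup>+\<eta>. F (x, add_point \<eta> x) * boltzmann UNIV x \<eta> \<partial>Q"
    have h'[measurable]: "?h' \<in> borel_measurable borel" by measurable
    have "AE x in mu. ?h x = ?h' x"
      using W by eventually_elim (auto intro!: nn_integral_cong_AE elim!: eventually_mono)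
    then have "AE x in lam. 0 < ennreal (z x) \<longrightarrow> ?h x = ?h' x"
      unfolding mu_def by (subst (asm) AE_density) auto
    then have "AE x in lam. ?h x * ennreal (z x) = ennreal (z x) * ?h' x"
    proof eventually_elim
      case (elim x)
      show ?case
      proof (cases "z x = 0")
        case False
        then have "0 < ennreal (z x)" using z_nonneg[of x] by simp
        then have "?h x = ?h' x" using elim by blast
        then show ?thesis by (simp only: mult.commute)
      qed simp
    qed
    then have "(\<integral>\<^sup>+x. ?h x * ennreal (z x) \<partial>lam) = (\<integral>\<^sup>+x. ennreal (z x) * ?h' x \<partial>lam)"
      by (rule nn_integral_cong_AE)
    also have "\<dots> = (\<integral>\<^sup>+x. ?h' x \<partial>mu)"
      unfolding mu_def by (rule nn_integral_density[symmetric]) measurable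
    finally show "(\<integral>\<^sup>+\<eta>. (\<integral>\<^sup>+x. F (x, \<eta>) \<partial>\<eta>) \<partial>Q) = (\<integral>\<^sup>+x. ?h x * ennreal (z x) \<partial>lam)"
      using gnz[OF F] by simp
  qed
  then show ?thesis by auto
qed

end
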